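(* Let $\mathcal{G} : \mathcal{P}_2(\mathbb{R}^d) \to (-\infty,+\infty]$ be proper, lower semicontinuous (with respect to $W_2$) and convex along generalized geodesics, and suppose $\operatorname{arg\,min} \mathcal{G} \neq \emptyset$. Let $\{\epsilon_n\}_{n\ge0}\subset \mathbb{R}_{\geq 0}$ with $\sum_{n=0}^{\infty} \epsilon_n < \infty$ and let $\{\tau_n\}_{n\ge0} \subset \mathbb{R}_{> 0}$ with $\sum_{i=0}^{\infty}\tau_i= \infty$. Define $\sigma_n:= \sum_{i=0}^{n-1}\tau_i$ for $n\in\mathbb{N}$. Let $\{\mu_n\}_{n\ge0}\subset\mathcal{P}_2(\mathbb{R}^d)$ be such that for all $n\in \mathbb{N}$ $$\mathcal{G}(\mu_{n+1})+\frac{1}{2\tau_n}W_2^2(\mu_{n+1},\mu_n)\leq \mathcal{G}(J_{\tau_n}(\mu_n))+\frac{1}{2\tau_n}W_2^2(J_{\tau_n}(\mu_n),\mu_n)+ \frac{\epsilon_n^2}{2\tau_n}.$$ 1. It holds that $$\mathcal{G}(\beta_n)-\inf \mathcal{G} = O\left(\frac{1}{\sigma_n}\right) \quad \text{as } n\to \infty,$$ where $\beta_n := \mu_{j_n}$ with $j_n = \operatorname{arg\,min}_{i=0,\dots,n-1}\{\mathcal{G}(\mu_i)\}$ defines the sequence of the best iterate. 2. If $\sum_{n=0}^{\infty}\frac{\sigma_n}{\tau_n}\epsilon_{n}^2 < \infty$, then $$\mathcal{G}(\mu_n)-\inf \mathcal{G} = O\left(\frac{1}{\sigma_n}\right) \quad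 \text{as } n\to \infty,$$ and $\{\mu_n\}_n$ converges with respect to the topology $\tau_{w,2}$ to some $\mu^*\in \operatorname{arg\,min} \mathcal{G}$. In particular $W_p(\mu_n,\mu^* )\to 0$ for all $p\in[1,2)$.
   Context: $\mathbb{N}$ includes $0$. $\mathcal{P}_2(\mathbb{R}^d)$ is the set of Borel probability measures on $\mathbb{R}^d$ with finite second moment. For $p\in[1,2]$, $W_p$ is the $p$-Wasserstein distance for the Euclidean cost, $W_p^p(\mu,\nu)=\inf_{\gamma\in\Gamma(\mu,\nu)}\int\|x-y\|^p\,d\gamma$, with $\Gamma(\mu,\nu)$ the set of couplings; $\Gamma_{\rm opt}(\mu,\nu)$ is the set of optimal couplings for $p=2$. A generalized geodesic between $\mu_0,\mu_1\in\mathcal{P}_2(\mathbb{R}^d)$ with base $\nu\in\mathcal{P}_2(\mathbb{R}^d)$ is a curve $\mu_t=((1-t)\pi^2+t\pi^3)_{\#}\gamma$, $t\in[0,1]$, where $\gamma$ is a probability measure on $(\mathbb{R}^d)^3$ with marginals $\nu,\mu_0,\mu_1$ such that $\pi^{1,2}_{\#}\gamma\in\Gamma_{\rm opt}(\nu,\mu_0)$ and $\pi^{1,3}_{\#}\gamma\in\Gamma_{\rm opt}(\nu,\mu_1)$ ($\pi^i$, $\pi^{i,j}$ are the coordinate projections). A proper function $\mathcal{G}$ is convex along generalized geodesics if for every $\mu_0,\mu_1,\nu\in\mathcal{P}_2(\mathbb{R}^d)$ there is a generalized geodesic $(\mu_s)_{s\in[0,1]}$ between $\mu_0$ and $\mu_1$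 with base $\nu$ such that $\mathcal{G}(\mu_s)\le(1-s)\mathcal{G}(\mu_0)+s\,\mathcal{G}(\mu_1)$ for all $s\in[0,1]$. For $\tau>0$, $J_\tau(\mu)$ is the minimizer of $\nu\mapsto \mathcal{G}(\nu)+\frac{1}{2\tau}W_2^2(\nu,\mu)$ over $\mathcal{P}_2(\mathbb{R}^d)$; under the assumptions above it exists and is unique for every $\mu\in\mathcal{P}_2(\mathbb{R}^d)$. Topology $\tau_{w,2}$: let $C_2^w(\mathbb{R}^d)$ be the space of continuous $f:\mathbb{R}^d\to\mathbb{R}$ with $\lim_{\|x\|\to\infty} f(x)/(1+\|x\|^2)=0$, normed by $\sup_x |f(x)|/(1+\|x\|^2)$. Its dual is the space of signed measures with finite second moment, and $\tau_{w,2}$ is the weak-$*$ topology restricted to $\mathcal{P}_2(\mathbb{R}^d)$; thus $\mu_n\to\mu$ in $\tau_{w,2}$ iff $\int f\,d\mu_n\to\int f\,d\mu$ for all $f\in C_2^w(\mathbb{R}^d)$.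
   Formalization: In Part 1 the best iterate is taken over i = 0,…,n rather than i = 0,…,n−1: with the printed range the rate O(1/σ_n) fails, e.g. for G(μ)=∫|x|²/2 dμ with exact steps from a unit point mass and τ_n=|x_n|^{-4}. *)

theory Defs
  imports "HOL-Probability.Probability"
begin

text \<open>
  The Euclidean space \<open>\<real>\<^sup>d\<close> is a type \<open>'a::euclidean_space\<close>, and the measures on it are those whose
  \<open>\<sigma>\<close>-algebra is \<open>sets borel\<close>. Functionals on \<open>\<P>\<^sub>2(\<real>\<^sup>d)\<close> are total functions
  \<open>'a measure \<Rightarrow> ereal\<close>, of which only the values on \<open>P2\<close> are ever used.
\<close>

definition P2 :: "'a::euclidean_space measure set" where
  "P2 = {\<mu>. sets \<mu> = sets borel \<and> prob_space \<mu> \<and> integrable \<mu> (\<lambda>x. (norm x)\<^sup>2)}"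


section \<open>Wasserstein distances\<close>

definition couplings ::
    "'a::euclidean_space measure \<Rightarrow> 'a measure \<Rightarrow> ('a \<times> 'a) measure set" where
  "couplings \<mu> \<nu> = {\<gamma>. sets \<gamma> = sets borel \<and> prob_space \<gamma> \<and>
                        distr \<gamma> borel fst = \<mu> \<and> distr \<gamma> borel snd = \<nu>}"

definition plan_cost :: "real \<Rightarrow> ('a::euclidean_space \<times> 'a) measure \<Rightarrow> ennreal" where
  "plan_cost p \<gamma> = (\<integral>\<^sup>+ z. ennreal (norm (fst z - snd z) powr p) \<partial>\<gamma>)"

definition transport_cost ::
    "real \<Rightarrow> 'a::euclidean_space measure \<Rightarrow> 'a measure \<Rightarrow> ennreal" where
  "transport_cost p \<mu> \<nu> = (INF \<gamma>\<in>couplings \<mu> \<nu>. plan_cost p \<gamma>)"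

text \<open>
  The conversion to \<open>real\<close> loses nothing on \<open>P2\<close> for \<open>1 \<le> p \<le> 2\<close>: the product coupling then has
  finite cost.
\<close>

definition W :: "real \<Rightarrow> 'a::euclidean_space measure \<Rightarrow> 'a measure \<Rightarrow> real" where
  "W p \<mu> \<nu> = enn2real (transport_cost p \<mu> \<nu>) powr (1 / p)"

definition opt_couplings ::
    "'a::euclidean_space measure \<Rightarrow> 'a measure \<Rightarrow> ('a \<times> 'a) measure set" where
  "opt_couplings \<mu> \<nu> = {\<gamma> \<in> couplings \<mu> \<nu>. plan_cost 2 \<gamma> = transport_cost 2 \<mu> \<nu>}"


section \<open>Functionals on the Wasserstein space\<close>

definition proper_on_P2 :: "('a::euclidean_space measure \<Rightarrow> ereal) \<Rightarrow> bool" where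
  "proper_on_P2 G \<longleftrightarrow> (\<forall>\<mu>\<in>P2. G \<mu> \<noteq> - \<infinity>) \<and> (\<exists>\<mu>\<in>P2. G \<mu> < \<infinity>)"

definition lsc_W2 :: "('a::euclidean_space measure \<Rightarrow> ereal) \<Rightarrow> bool" where
  "lsc_W2 G \<longleftrightarrow>
     (\<forall>\<mu>\<in>P2. \<forall>c<G \<mu>. \<exists>\<delta>>0. \<forall>\<nu>\<in>P2. W 2 \<nu> \<mu> < \<delta> \<longrightarrow> c < G \<nu>)"

text \<open>\<open>c\<close> is a generalized geodesic between \<open>\<mu>\<^sub>0\<close> and \<open>\<mu>\<^sub>1\<close> with base \<open>\<nu>\<close>.\<close>

definition generalized_geodesic ::
    "'a::euclidean_space measure \<Rightarrow> 'a measure \<Rightarrow> 'a measure \<Rightarrow> (real \<Rightarrow> 'a measure) \<Rightarrow> bool" where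
  "generalized_geodesic \<nu> \<mu>\<^sub>0 \<mu>\<^sub>1 c \<longleftrightarrow>
     (\<exists>\<gamma> :: ('a \<times> 'a \<times> 'a) measure. sets \<gamma> = sets borel \<and> prob_space \<gamma> \<and>
        distr \<gamma> borel (\<lambda>(x, y, z). x) = \<nu> \<and>
        distr \<gamma> borel (\<lambda>(x, y, z). y) = \<mu>\<^sub>0 \<and>
        distr \<gamma> borel (\<lambda>(x, y, z). z) = \<mu>\<^sub>1 \<and>
        distr \<gamma> borel (\<lambda>(x, y, z). (x, y)) \<in> opt_couplings \<nu> \<mu>\<^sub>0 \<and>
        distr \<gamma> borel (\<lambda>(x, y, z). (x, z)) \<in> opt_couplings \<nu> \<mu>\<^sub>1 \<and>
        (\<forall>t\<in>{0..1}. c t = distr \<gamma> borel (\<lambda>(x, y, z). (1 - t) *\<^sub>R y + t *\<^sub>R z)))"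

definition convex_along_generalized_geodesics ::
    "('a::euclidean_space measure \<Rightarrow> ereal) \<Rightarrow> bool" where
  "convex_along_generalized_geodesics G \<longleftrightarrow>
     (\<forall>\<mu>\<^sub>0\<in>P2. \<forall>\<mu>\<^sub>1\<in>P2. \<forall>\<nu>\<in>P2. \<exists>c. generalized_geodesic \<nu> \<mu>\<^sub>0 \<mu>\<^sub>1 c \<and>
        (\<forall>s\<in>{0..1}. G (c s) \<le> ereal (1 - s) * G \<mu>\<^sub>0 + ereal s * G \<mu>\<^sub>1))"

text \<open>
  \<open>J G \<tau> \<mu>\<close> is the proximal (JKO) step. For \<open>\<tau> > 0\<close>, \<open>\<mu> \<in> P2\<close> and a proper, lower
  semicontinuous \<open>G\<close> that is convex along generalized geodesics and has a minimizer, there is exactly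
  one minimizer, so that \<open>arg_min\<close> involves no choice.
\<close>

definition J ::
    "('a::euclidean_space measure \<Rightarrow> ereal) \<Rightarrow> real \<Rightarrow> 'a measure \<Rightarrow> 'a measure" where
  "J G \<tau> \<mu> = arg_min (\<lambda>\<nu>. G \<nu> + ereal ((W 2 \<nu> \<mu>)\<^sup>2 / (2 * \<tau>))) (\<lambda>\<nu>. \<nu> \<in> P2)"


section \<open>Rates\<close>

text \<open>
  The Landau symbol for extended-real sequences. As \<open>c\<close> and \<open>g\<close> are real, the bound forces \<open>f n\<close> to
  be eventually finite.
\<close>

definition bigO_ereal :: "(nat \<Rightarrow> ereal) \<Rightarrow> (nat \<Rightarrow> real) \<Rightarrow> bool" where
  "bigO_ereal f g \<longleftrightarrow> (\<exists>c>0. eventually (\<lambda>n. \<bar>f n\<bar> \<le> ereal (c * \<bar>g n\<bar>)) sequentially)"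

text \<open>
  \<open>j n\<close> is an index of the best of the iterates \<open>0, \<dots>, n\<close>, i.e. of those available after the
  \<open>n\<close> steps with step sizes \<open>\<tau> 0, \<dots>, \<tau> (n - 1)\<close>, whose total is \<open>\<sigma> n\<close>; ties are broken arbitrarily.
  Stopping at \<open>n - 1\<close> instead would make the rate \<open>1 / \<sigma> n\<close> false: the last step size in \<open>\<sigma> n\<close>
  would not have influenced any of the iterates compared, and could be chosen so large, given these
  iterates, that the rate fails. An example is \<open>G \<mu> = \<integral> \<parallel>x\<parallel>\<^sup>2 / 2 d\<mu>\<close> with exact steps from the
  point mass at a unit vector, where \<open>\<mu> n\<close> is the point mass at a vector of norm
  \<open>r n = 1 / \<Prod>i<n. 1 + \<tau> i\<close>, and \<open>\<tau> n = 1 / (r n)\<^sup>4\<close>.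
\<close>

definition best_index :: "(nat \<Rightarrow> ereal) \<Rightarrow> (nat \<Rightarrow> nat) \<Rightarrow> bool" where
  "best_index g j \<longleftrightarrow> (\<forall>n. is_arg_min g (\<lambda>i. i \<in> {0..n}) (j n))"


section \<open>The topology \<open>\<tau>\<^sub>w\<^sub>,\<^sub>2\<close>\<close>

definition C2w :: "('a::euclidean_space \<Rightarrow> real) set" where
  "C2w = {f. continuous_on UNIV f \<and> ((\<lambda>x. f x / (1 + (norm x)\<^sup>2)) \<longlongrightarrow> 0) at_infinity}"

text \<open>
  The weak-* topology is the coarsest one that makes all evaluations \<open>\<mu> \<mapsto> \<integral> f d\<mu>\<close>, \<open>f \<in> C2w\<close>,
  continuous; here it is restricted to \<open>P2\<close>, which is its \<open>topspace\<close>.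
\<close>

definition tau_w2 :: "'a::euclidean_space measure topology" where
  "tau_w2 = topology_generated_by
     {{\<mu> \<in> P2. (\<integral>x. f x \<partial>\<mu>) \<in> U} | f U. f \<in> C2w \<and> open U}"

lemma topspace_tau_w2: "topspace tau_w2 = P2"
proof -
  have "(\<lambda>_. 0) \<in> (C2w :: ('a \<Rightarrow> real) set)"
    by (simp add: C2w_def)
  then have "(P2 :: 'a measure set) \<in>
      {{\<mu> \<in> P2. (\<integral>x. f x \<partial>\<mu>) \<in> U} | f U. f \<in> C2w \<and> open U}"
    by (auto intro!: exI[of _ "\<lambda>_. 0"] exI[of _ UNIV])
  then show ?thesis
    unfolding tau_w2_def topology_generated_by_topspace by blast
qed

lemma limitin_tau_w2_iff:
  fixes \<mu> :: "nat \<Rightarrow> 'a::euclidean_space measure"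
  assumes "\<And>n. \<mu> n \<in> P2"
  shows "limitin tau_w2 \<mu> \<mu>s sequentially \<longleftrightarrow>
    \<mu>s \<in> P2 \<and> (\<forall>f\<in>C2w. (\<lambda>n. \<integral>x. f x \<partial>\<mu> n) \<longlonglongrightarrow> (\<integral>x. f x \<partial>\<mu>s))"
proof (intro iffI conjI ballI)
  assume lim: "limitin tau_w2 \<mu> \<mu>s sequentially"
  show "\<mu>s \<in> P2"
    using lim unfolding limitin_def topspace_tau_w2 by blast
  fix f :: "'a \<Rightarrow> real" assume f: "f \<in> C2w"
  show "(\<lambda>n. \<integral>x. f x \<partial>\<mu> n) \<longlonglongrightarrow> (\<integral>x. f x \<partial>\<mu>s)"
  proof (rule topological_tendstoI)
    fix U :: "real set" assume U: "open U" "(\<integral>x. f x \<partial>\<mu>s) \<in> U"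
    have "openin tau_w2 {\<mu> \<in> P2. (\<integral>x. f x \<partial>\<mu>) \<in> U}"
      unfolding tau_w2_def by (rule topology_generated_by_Basis) (use f U in blast)
    then have "eventually (\<lambda>n. \<mu> n \<in> {\<mu> \<in> P2. (\<integral>x. f x \<partial>\<mu>) \<in> U}) sequentially"
      using lim U \<open>\<mu>s \<in> P2\<close> unfolding limitin_def by blast
    then show "eventually (\<lambda>n. (\<integral>x. f x \<partial>\<mu> n) \<in> U) sequentially"
      by eventually_elim simp
  qed
next
  assume R: "\<mu>s \<in> P2 \<and> (\<forall>f\<in>C2w. (\<lambda>n. \<integral>x. f x \<partial>\<mu> n) \<longlonglongrightarrow> (\<integral>x. f x \<partial>\<mu>s))"
  have "\<mu>s \<in> V \<longrightarrow> eventually (\<lambda>n. \<mu> n \<in> V) sequentially"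
    if "generate_topology_on
          {{\<mu> \<in> P2. (\<integral>x. f x \<partial>\<mu>) \<in> U} | f U. f \<in> C2w \<and> open U} V" for V
    using that
  proof induction
    case Empty
    then show ?case by simp
  next
    case (Int a b)
    then show ?case by (auto intro: eventually_conj)
  next
    case (UN K)
    show ?case
    proof
      assume "\<mu>s \<in> \<Union> K"
      then obtain k where k: "k \<in> K" "\<mu>s \<in> k"
        by blast
      with UN have "eventually (\<lambda>n. \<mu> n \<in> k) sequentially"
        by blast
      then show "eventually (\<lambda>n. \<mu> n \<in> \<Union> K) sequentially"
        by eventually_elim (use k in blast)
    qed
  next
    case (Basis s)
    then obtain f U where s: "s = {\<mu> \<in> P2. (\<integral>x. f x \<partial>\<mu>) \<in> U}" "f \<in> C2w" "open U"
      by blast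
    show ?case
    proof
      assume "\<mu>s \<in> s"
      then have "eventually (\<lambda>n. (\<integral>x. f x \<partial>\<mu> n) \<in> U) sequentially"
        using R s by (intro topological_tendstoD) auto
      then show "eventually (\<lambda>n. \<mu> n \<in> s) sequentially"
        using assms s by (auto elim: eventually_mono)
    qed
  qed
  then show "limitin tau_w2 \<mu> \<mu>s sequentially"
    using R unfolding limitin_def topspace_tau_w2
    by (auto simp: tau_w2_def openin_topology_generated_by_iff)
qed

end

theory Submission
  imports Defs
begin

text \<open>
  Convexity along generalized geodesics based at \<open>\<mu>\<close> makes \<open>\<nu> \<mapsto> 2 \<tau> G(\<nu>) + W\<^sub>2\<^sup>2(\<nu>, \<mu>)\<close> strongly convex along
  such curves, so the proximal point \<open>J\<close> satisfies
  \<open>2 \<tau> G(J) + W\<^sub>2\<^sup>2(J, \<mu>) + W\<^sub>2\<^sup>2(J, \<nu>) \<le> 2 \<tau> G(\<nu>) + W\<^sub>2\<^sup>2(\<nu>, \<mu>)\<close> for all \<open>\<nu>\<close>. For an inexact step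
  this gives \<open>W\<^sub>2(\<mu>\<^sub>n\<^sub>+\<^sub>1, J) \<le> \<epsilon>\<^sub>n\<close>; testing with a minimizer shows that the distances to it are
  quasi-Fejer monotone and that \<open>\<Sum> \<tau>\<^sub>i (G(\<mu>\<^sub>i\<^sub>+\<^sub>1) - inf G)\<close> is bounded, which is the rate of the best
  iterate; testing with \<open>\<mu>\<^sub>n\<close> shows that \<open>G\<close> increases by at most \<open>\<epsilon>\<^sub>n\<^sup>2 / (2 \<tau>\<^sub>n)\<close>, which gives the rate of the
  last one.

  Convergence rests on the Opial property: if \<open>\<mu>\<^sub>n \<rightarrow> \<rho>\<close> weakly with bounded second moments, then
  \<open>liminf (W\<^sub>2\<^sup>2(\<nu>, \<mu>\<^sub>n) - W\<^sub>2\<^sup>2(\<rho>, \<mu>\<^sub>n)) \<ge> W\<^sub>2\<^sup>2(\<nu>, \<rho>)\<close>. Together with the inequality for \<open>J\<close> it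
  yields the existence of proximal points, that weak cluster points of the iterates are minimizers,
  and that there is only one. Weak compactness is obtained together with a Skorokhod representation,
  by encoding \<open>\<real>\<^sup>d\<close> into a Cantor set, where the one-dimensional theorems of Helly and Skorokhod apply.
\<close>


section \<open>Weakly convergent subsequences in Euclidean spaces\<close>

text \<open>\<open>G\<close> is lower semicontinuous for \<open>W 2\<close>, whereas the iterates
  are only known to converge weakly, and a weak limit may lose second moment. The inequality for the
  proximal point bridges this gap: with a cluster point as base and the iterates as test measures,
  it bounds \<open>G\<close> at the proximal point of the cluster point without passing
  \<open>G\<close> to a weak limit. Generalized geodesics make this inequality available: along them
  the squared distance to the base satisfies the Hilbert space convexity inequality, because both
  plans that involve the base are optimal, while along ordinary geodesics it can fail to be convex.
  The Opial inequality tolerates the loss of second moment because the moments of the iterates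
  cancel in the difference of the two distances. The tolerance is scaled as \<epsilon>^2 / (2
  \<tau>) so that an error in the objective becomes a distance \<epsilon> to the exact step,
  whatever \<tau> is. The weights \<sigma>_n / \<tau>_n in the second claim come from multiplying
  the possible increase of \<open>G\<close> by \<sigma>_n.\<close>

text \<open>
  A point is encoded by the answers to \<open>x \<bullet> e < q\<close> for all basis vectors \<open>e\<close> and rationals \<open>q\<close>. Base 4
  with digits 0 and 1 leaves gaps between different expansions, so that convergence of codes means
  that each digit is eventually constant.
\<close>

definition rational_cut :: "nat \<Rightarrow> 'a::euclidean_space \<times> real" where
  "rational_cut = from_nat_into (Basis \<times> \<rat>)"

lemma range_rational_cut: "range (rational_cut :: nat \<Rightarrow> 'a::euclidean_space \<times> real) = Basis \<times> \<rat>"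
proof -
  have "countable (Basis \<times> \<rat> :: ('a \<times> real) set)"
    by (intro countable_SIGMA countable_finite finite_Basis countable_rat)
  moreover have "(Basis \<times> \<rat> :: ('a \<times> real) set) \<noteq> {}"
    using nonempty_Basis Rats_0 by blast
  ultimately show ?thesis
    unfolding rational_cut_def by simp
qed

definition below_cut :: "'a::euclidean_space \<Rightarrow> nat \<Rightarrow> bool" where
  "below_cut x k \<longleftrightarrow> x \<bullet> fst (rational_cut k) < snd (rational_cut k :: 'a \<times> real)"

definition encode :: "'a::euclidean_space \<Rightarrow> real" where
  "encode x = (\<Sum>k. of_bool (below_cut x k) / 4 ^ k)"

definition bit4 :: "nat \<Rightarrow> real \<Rightarrow> bool" where
  "bit4 k t \<longleftrightarrow> odd \<lfloor>4 ^ k * t\<rfloor>"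

text \<open>A coordinate is the infimum of the rationals above it. The function is total and Borel
  on the whole line because the random codes supplied by Skorokhod's theorem are codes of points
  only almost surely; its values at other reals are irrelevant.\<close>

definition decode :: "real \<Rightarrow> 'a::euclidean_space" where
  "decode t = (\<Sum>e\<in>Basis. real_of_ereal
     (INF k. if fst (rational_cut k :: 'a \<times> real) = e \<and> bit4 k t then ereal (snd (rational_cut k :: 'a \<times> real)) else \<infinity>) *\<^sub>R e)"

lemma summable_encode: "summable (\<lambda>k. of_bool (P k) / 4 ^ k :: real)"
  by (rule summable_comparison_test'[of "\<lambda>k. (1 / 4) ^ k" 0])
     (auto simp: power_one_over[symmetric] intro!: summable_geometric)

lemma encode_bounds: "0 \<le> encode x" "encode x \<le> 4 / 3"
proof -
  show "0 \<le> encode x"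
    unfolding encode_def by (intro suminf_nonneg summable_encode) auto
  have "encode x \<le> (\<Sum>k. (1 / 4) ^ k)"
    unfolding encode_def
    by (intro suminf_le summable_encode summable_geometric) (auto simp: power_divide)
  also have "\<dots> = 4 / 3"
    by (subst suminf_geometric) auto
  finally show "encode x \<le> 4 / 3" .
qed

text \<open>The integer part of \<open>4 ^ k * encode x\<close>: the expansion up to digit
  \<open>k\<close>, in which that digit alone has odd weight, so that parity reads it off.\<close>

definition prefix4 :: "nat \<Rightarrow> 'a::euclidean_space \<Rightarrow> int" where
  "prefix4 k x = (\<Sum>j\<le>k. of_bool (below_cut x j) * 4 ^ (k - j))"

text \<open>The later digits contribute at most 1/4 + 1/16 + ... = 1/3. This identifies the floor,
  and it leaves a gap of at least 2/3 between scaled codes with different prefixes.\<close>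

lemma encode_prefix:
  "0 \<le> 4 ^ k * encode x - prefix4 k x" "4 ^ k * encode x - prefix4 k x \<le> 1 / 3"
proof -
  let ?b = "\<lambda>k. of_bool (below_cut x k) / 4 ^ k :: real"
  have split: "encode x = (\<Sum>j. ?b (j + Suc k)) + (\<Sum>j\<le>k. ?b j)"
    unfolding encode_def using suminf_split_initial_segment[OF summable_encode, of "below_cut x" "Suc k"]
    by (simp add: lessThan_Suc_atMost)
  have of_int_eq: "(4 :: real) ^ k / 4 ^ j = of_int (4 ^ (k - j))" if "j \<le> k" for j
    by (subst of_int_power) (simp add: power_diff that)
  have pre: "4 ^ k * (\<Sum>j\<le>k. ?b j) = prefix4 k x"
    unfolding prefix4_def sum_distrib_left of_int_sum
    by (intro sum.cong) (auto simp: of_int_eq simp del: of_int_power)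
  have eq: "4 ^ k * encode x - prefix4 k x = 4 ^ k * (\<Sum>j. ?b (j + Suc k))"
    using pre unfolding split by (simp add: algebra_simps)
  have sm: "summable (\<lambda>j. ?b (j + Suc k))"
    using summable_iff_shift[of ?b "Suc k"] summable_encode by simp
  have "0 \<le> (\<Sum>j. ?b (j + Suc k))"
    by (intro suminf_nonneg sm) auto
  then show "0 \<le> 4 ^ k * encode x - prefix4 k x"
    unfolding eq by simp
  have "(\<Sum>j. ?b (j + Suc k)) \<le> (\<Sum>j. (1 / 4) ^ j * (1 / 4 ^ Suc k))"
    by (intro suminf_le sm summable_mult2 summable_geometric) (auto simp: power_divide power_add)
  also have "\<dots> = (\<Sum>j. (1 / 4) ^ j) * (1 / 4 ^ Suc k)"
    by (intro suminf_mult2[symmetric] summable_geometric) auto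
  also have "\<dots> = 1 / (3 * 4 ^ k)"
    by (subst suminf_geometric) auto
  finally show "4 ^ k * encode x - prefix4 k x \<le> 1 / 3"
    unfolding eq by (simp add: field_simps)
qed

lemma bit4_encode: "bit4 k (encode x) \<longleftrightarrow> below_cut x k"
proof -
  have "\<lfloor>4 ^ k * encode x\<rfloor> = prefix4 k x"
    using encode_prefix[of k x] by (intro floor_unique) auto
  moreover have "prefix4 k x = (\<Sum>j<k. of_bool (below_cut x j) * 4 ^ (k - j)) + of_bool (below_cut x k)"
    unfolding prefix4_def by (simp add: lessThan_Suc_atMost[symmetric])
  moreover have "even (\<Sum>j<k. of_bool (below_cut x j) * 4 ^ (k - j) :: int)"
    by (intro dvd_sum) auto
  ultimately show ?thesis
    unfolding bit4_def by simp
qed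

lemma decode_encode: "decode (encode x) = x"
proof -
  have "(INF k. if fst (rational_cut k :: 'a \<times> real) = e \<and> bit4 k (encode x)
          then ereal (snd (rational_cut k :: 'a \<times> real)) else \<infinity>) = ereal (x \<bullet> e)"
    if e: "e \<in> Basis" for e :: 'a
  proof (rule antisym)
    show "ereal (x \<bullet> e) \<le> (INF k. if fst (rational_cut k :: 'a \<times> real) = e \<and> bit4 k (encode x)
          then ereal (snd (rational_cut k :: 'a \<times> real)) else \<infinity>)"
      by (rule INF_greatest) (auto simp: bit4_encode below_cut_def)
    show "(INF k. if fst (rational_cut k :: 'a \<times> real) = e \<and> bit4 k (encode x)
          then ereal (snd (rational_cut k :: 'a \<times> real)) else \<infinity>) \<le> ereal (x \<bullet> e)"
    proof (rule ereal_le_epsilon2)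
      fix d :: real assume "0 < d"
      then obtain q where q: "q \<in> \<rat>" "x \<bullet> e < q" "q < x \<bullet> e + d"
        using Rats_dense_in_real[of "x \<bullet> e" "x \<bullet> e + d"] by auto
      then have "(e, q) \<in> range rational_cut"
        using e unfolding range_rational_cut by auto
      then obtain k where k: "rational_cut k = (e, q)"
        by (metis rangeE)
      have "(INF k. if fst (rational_cut k :: 'a \<times> real) = e \<and> bit4 k (encode x)
          then ereal (snd (rational_cut k :: 'a \<times> real)) else \<infinity>)
          \<le> (if fst (rational_cut k :: 'a \<times> real) = e \<and> bit4 k (encode x)
          then ereal (snd (rational_cut k :: 'a \<times> real)) else \<infinity>)"
        by (rule INF_lower) auto
      also have "\<dots> = ereal q"
        using q by (simp add: k bit4_encode below_cut_def)
      also have "\<dots> \<le> ereal (x \<bullet> e) + ereal d"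
        using q by simp
      finally show "(INF k. if fst (rational_cut k :: 'a \<times> real) = e \<and> bit4 k (encode x)
          then ereal (snd (rational_cut k :: 'a \<times> real)) else \<infinity>) \<le> ereal (x \<bullet> e) + ereal d" .
    qed
  qed
  then have "decode (encode x) = (\<Sum>e\<in>Basis. (x \<bullet> e) *\<^sub>R e)"
    unfolding decode_def by (intro sum.cong) auto
  then show ?thesis
    by (simp add: euclidean_representation)
qed

lemma measurable_encode [measurable]: "encode \<in> borel_measurable borel"
  unfolding encode_def[abs_def] below_cut_def by measurable

lemma measurable_bit4 [measurable]: "Measurable.pred borel (bit4 k)"
  unfolding bit4_def[abs_def] by measurable

lemma measurable_decode [measurable]: "decode \<in> borel_measurable borel"
  unfolding decode_def[abs_def] by measurable

lemma eventually_below_cut_const: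
  assumes "Cauchy (\<lambda>n. encode (x n))"
  shows "(\<forall>\<^sub>F n in sequentially. below_cut (x n) k) \<or> (\<forall>\<^sub>F n in sequentially. \<not> below_cut (x n) k)"
proof -
  \<comment> \<open>Scaled by \<open>4 ^ k\<close> this distance is less than 1/3; the remainders
    lie in [0, 1/3], so the prefixes differ by less than 2/3, hence not at all.\<close>
  obtain N where N: "\<And>m n. m \<ge> N \<Longrightarrow> n \<ge> N \<Longrightarrow> dist (encode (x m)) (encode (x n)) < 1 / (3 * 4 ^ k)"
    using metric_CauchyD[OF assms, of "1 / (3 * 4 ^ k)"] by auto
  have "prefix4 k (x n) = prefix4 k (x N)" if "n \<ge> N" for n
  proof -
    have "\<bar>encode (x n) - encode (x N)\<bar> < 1 / (3 * 4 ^ k)"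
      using N[OF that order_refl] by (simp add: dist_real_def)
    then have "\<bar>4 ^ k * encode (x n) - 4 ^ k * encode (x N)\<bar> < 1 / 3"
      by (subst right_diff_distrib[symmetric], subst abs_mult) (simp add: field_simps)
    then have "\<bar>of_int (prefix4 k (x n)) - of_int (prefix4 k (x N)) :: real\<bar> < 1"
      using encode_prefix[of k "x n"] encode_prefix[of k "x N"] by linarith
    then show ?thesis
      by linarith
  qed
  moreover have "\<lfloor>4 ^ k * encode (x n)\<rfloor> = prefix4 k (x n)" for n
    using encode_prefix[of k "x n"] by (intro floor_unique) auto
  ultimately have "below_cut (x n) k \<longleftrightarrow> below_cut (x N) k" if "n \<ge> N" for n
    using that unfolding bit4_encode[symmetric] bit4_def by metis
  then have "\<forall>\<^sub>F n in sequentially. below_cut (x n) k \<longleftrightarrow> below_cut (x N) k"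
    unfolding eventually_sequentially by blast
  then show ?thesis
    by (cases "below_cut (x N) k") simp_all
qed

text \<open>The rationals that eventually lie above the sequence form a Dedekind cut, whose infimum
  is the limit. Since the position relative to every rational is eventually decided, a bound that
  holds infinitely often already rules out both infinities; this is the form that Fatou's lemma
  provides.\<close>

lemma convergent_of_rational_cuts:
  fixes x :: "nat \<Rightarrow> real"
  assumes cuts: "\<And>q. q \<in> \<rat> \<Longrightarrow>
      (\<forall>\<^sub>F n in sequentially. x n < q) \<or> (\<forall>\<^sub>F n in sequentially. \<not> x n < q)"
    and bdd: "\<exists>\<^sub>F n in sequentially. \<bar>x n\<bar> \<le> R"
  shows "convergent x"
proof -
  define S where "S = {q \<in> \<rat>. \<forall>\<^sub>F n in sequentially. x n < q}"
  have up: "\<exists>q\<in>S. R < q"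
  proof -
    obtain q where q: "q \<in> \<rat>" "R < q"
      using Rats_dense_in_real[of R "R + 1"] by auto
    have "\<not> (\<forall>\<^sub>F n in sequentially. \<not> x n < q)"
    proof
      assume "\<forall>\<^sub>F n in sequentially. \<not> x n < q"
      then have "\<forall>\<^sub>F n in sequentially. \<not> \<bar>x n\<bar> \<le> R"
        by eventually_elim (use q in auto)
      then show False
        using bdd by (simp add: frequently_def)
    qed
    then show ?thesis
      using cuts q unfolding S_def by blast
  qed
  have low: "- R \<le> q" if "q \<in> S" for q
  proof (rule ccontr)
    assume "\<not> - R \<le> q"
    have "\<forall>\<^sub>F n in sequentially. x n < q"
      using that by (auto simp: S_def)
    then have "\<forall>\<^sub>F n in sequentially. \<not> \<bar>x n\<bar> \<le> R"
      by eventually_elim (use \<open>\<not> - R \<le> q\<close> in auto)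
    then show False
      using bdd by (simp add: frequently_def)
  qed
  have "S \<noteq> {}" "bdd_below S"
    using up low by (auto intro!: bdd_belowI)
  have "x \<longlonglongrightarrow> Inf S"
  proof (rule order_tendstoI)
    fix a assume "a < Inf S"
    then obtain q where q: "q \<in> \<rat>" "a < q" "q < Inf S"
      using Rats_dense_in_real by blast
    then have "q \<notin> S"
      using cInf_lower[OF _ \<open>bdd_below S\<close>] by force
    then have "\<forall>\<^sub>F n in sequentially. \<not> x n < q"
      using cuts q by (auto simp: S_def)
    then show "\<forall>\<^sub>F n in sequentially. a < x n"
      by eventually_elim (use q in auto)
  next
    fix a assume "Inf S < a"
    then obtain q where q: "q \<in> S" "q < a"
      using cInf_lessD[OF \<open>S \<noteq> {}\<close>] by blast
    then have "\<forall>\<^sub>F n in sequentially. x n < q"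
      by (auto simp: S_def)
    then show "\<forall>\<^sub>F n in sequentially. x n < a"
      by eventually_elim (use q in auto)
  qed
  then show ?thesis
    by (auto simp: convergent_def)
qed

text \<open>The bound excludes the points at infinity that the codes also converge to.\<close>

lemma convergent_of_encode:
  fixes x :: "nat \<Rightarrow> 'a::euclidean_space"
  assumes encode: "convergent (\<lambda>n. encode (x n))"
    and bdd: "\<exists>\<^sub>F n in sequentially. norm (x n) \<le> R"
  shows "convergent x"
proof -
  have conv: "convergent (\<lambda>n. x n \<bullet> e)" if e: "e \<in> Basis" for e
  proof (rule convergent_of_rational_cuts)
    show "\<exists>\<^sub>F n in sequentially. \<bar>x n \<bullet> e\<bar> \<le> R"
      using bdd by (rule frequently_elim1) (use Basis_le_norm[OF e] order_trans in blast)
    fix q :: real assume "q \<in> \<rat>"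
    then have "(e, q) \<in> range rational_cut"
      using e unfolding range_rational_cut by auto
    then obtain k where "rational_cut k = (e, q)"
      by (metis rangeE)
    then show "(\<forall>\<^sub>F n in sequentially. x n \<bullet> e < q) \<or> (\<forall>\<^sub>F n in sequentially. \<not> x n \<bullet> e < q)"
      using eventually_below_cut_const[OF convergent_Cauchy[OF encode], of k] by (simp add: below_cut_def)
  qed
  have "(\<lambda>n. \<Sum>e\<in>Basis. (x n \<bullet> e) *\<^sub>R e) \<longlonglongrightarrow> (\<Sum>e\<in>Basis. lim (\<lambda>n. x n \<bullet> e) *\<^sub>R e)"
    using conv by (intro tendsto_intros) (simp add: convergent_LIMSEQ_iff)
  then show ?thesis
    by (auto simp: convergent_def euclidean_representation)
qed

text \<open>Codes lie in a bounded interval, so their laws are tight whatever \<open>m\<close> is;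
  the second moments keep the decoded points from escaping to infinity. Since codes determine
  points, decoding the Skorokhod variables restores the laws \<open>m (r n)\<close>.\<close>

theorem Skorokhod_subsequence:
  fixes m :: "nat \<Rightarrow> 'a::euclidean_space measure"
  assumes sets: "\<And>n. sets (m n) = sets borel" and prob: "\<And>n. prob_space (m n)"
    and bound: "\<And>n. (\<integral>\<^sup>+x. ennreal ((norm x)\<^sup>2) \<partial>m n) \<le> ennreal C"
  obtains r \<Omega> X Z where "strict_mono (r :: nat \<Rightarrow> nat)" "prob_space (\<Omega> :: real measure)"
    "\<And>n. X n \<in> borel_measurable \<Omega>" "Z \<in> borel_measurable \<Omega>"
    "\<And>n. distr \<Omega> borel (X n) = m (r n)" "AE \<omega> in \<Omega>. (\<lambda>n. X n \<omega>) \<longlonglongrightarrow> Z \<omega>"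
proof -
  define \<nu> where "\<nu> n = distr (m n) borel encode" for n
  have mc [measurable]: "encode \<in> borel_measurable (m n)" for n
    using measurable_cong_sets[OF sets refl] measurable_encode by blast
  have rd: "real_distribution (\<nu> n)" for n
    unfolding \<nu>_def using prob_space.real_distribution_distr[OF prob] mc by blast
  have tight: "tight \<nu>"
    unfolding tight_def
  proof (intro conjI allI impI rd)
    fix \<epsilon> :: real assume "0 < \<epsilon>"
    have in_range: "encode x \<in> {-1<..4/3}" for x :: 'a
      using encode_bounds[of x] by auto
    have "measure (\<nu> n) {-1<..4/3} = 1" for n
    proof -
      have "measure (\<nu> n) {-1<..4/3} = measure (m n) (encode -` {-1<..4/3} \<inter> space (m n))"
        unfolding \<nu>_def by (rule measure_distr) auto
      also have "encode -` {-1<..4/3} \<inter> space (m n) = space (m n)"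
        using in_range by blast
      finally show ?thesis
        using prob_space.prob_space[OF prob] by simp
    qed
    then show "\<exists>a b. a < b \<and> (\<forall>n. 1 - \<epsilon> < measure (\<nu> n) {a<..b})"
      using \<open>0 < \<epsilon>\<close> by (intro exI[of _ "-1"] exI[of _ "4/3"]) auto
  qed
  obtain r M where r: "strict_mono (r :: nat \<Rightarrow> nat)" and M: "real_distribution M"
    and wc: "weak_conv_m (\<nu> \<circ> id \<circ> r) M"
    using tight_imp_convergent_subsubsequence[OF tight, of id] by (auto simp: strict_mono_def)
  obtain \<Omega> :: "real measure" and Y :: "nat \<Rightarrow> real \<Rightarrow> real" and Y' :: "real \<Rightarrow> real"
    where \<Omega>: "prob_space \<Omega>" and Y [measurable]: "\<And>n. Y n \<in> borel_measurable \<Omega>"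
    and dY: "\<And>n. distr \<Omega> borel (Y n) = (\<nu> \<circ> id \<circ> r) n"
    and lim: "\<And>\<omega>. \<omega> \<in> space \<Omega> \<Longrightarrow> (\<lambda>n. Y n \<omega>) \<longlonglongrightarrow> Y' \<omega>"
  proof -
    have "\<And>n. real_distribution ((\<nu> \<circ> id \<circ> r) n)"
      by (simp add: rd)
    from Skorohod[OF this M wc] show thesis
      using that by blast
  qed
  interpret \<Omega>: prob_space \<Omega> by (rule \<Omega>)
  define X where "X n = (\<lambda>\<omega>. decode (Y n \<omega>) :: 'a)" for n
  have X [measurable]: "X n \<in> borel_measurable \<Omega>" for n
    unfolding X_def by measurable
  have dX: "distr \<Omega> borel (X n) = m (r n)" for n
  proof -
    have "distr \<Omega> borel (X n) = distr (distr \<Omega> borel (Y n)) borel decode"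
      unfolding X_def by (subst distr_distr) (auto simp: comp_def)
    also have "\<dots> = distr (m (r n)) borel (\<lambda>x. decode (encode x))"
      unfolding dY \<nu>_def by (simp add: distr_distr comp_def)
    also have "\<dots> = m (r n)"
      unfolding decode_encode by (rule distr_id2) (simp add: sets)
    finally show ?thesis .
  qed
  \<comment> \<open>\<open>Y n\<close> has the law of \<open>encode\<close> under
    \<open>m (r n)\<close>, so it is almost surely the code of a point.\<close>
  have "AE \<omega> in \<Omega>. Y n \<omega> = encode (X n \<omega>)" for n
  proof -
    have "AE t in distr \<Omega> borel (Y n). t = encode (decode t :: 'a)"
      unfolding dY \<nu>_def o_def id_def
      by (subst AE_distr_iff, measurable) (simp add: decode_encode)
    then show ?thesis
      unfolding X_def by (subst (asm) AE_distr_iff) measurable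
  qed
  then have encode: "AE \<omega> in \<Omega>. \<forall>n. Y n \<omega> = encode (X n \<omega>)"
    by (simp add: AE_all_countable)
  \<comment> \<open>Fatou's lemma: along almost every path the norms have a finite lower limit, so
    they stay below a bound, depending on the path, infinitely often.\<close>
  have "(\<integral>\<^sup>+\<omega>. liminf (\<lambda>n. ennreal ((norm (X n \<omega>))\<^sup>2)) \<partial>\<Omega>)
      \<le> liminf (\<lambda>n. \<integral>\<^sup>+\<omega>. ennreal ((norm (X n \<omega>))\<^sup>2) \<partial>\<Omega>)"
    by (rule nn_integral_liminf) measurable
  also have "\<dots> \<le> ennreal C"
  proof (rule Liminf_le, simp, rule always_eventually, rule allI)
    fix n
    have "(\<integral>\<^sup>+\<omega>. ennreal ((norm (X n \<omega>))\<^sup>2) \<partial>\<Omega>) = (\<integral>\<^sup>+x. ennreal ((norm x)\<^sup>2) \<partial>m (r n))"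
      unfolding dX[symmetric] by (rule nn_integral_distr[symmetric]) measurable
    then show "(\<integral>\<^sup>+\<omega>. ennreal ((norm (X n \<omega>))\<^sup>2) \<partial>\<Omega>) \<le> ennreal C"
      using bound by simp
  qed
  finally have "(\<integral>\<^sup>+\<omega>. liminf (\<lambda>n. ennreal ((norm (X n \<omega>))\<^sup>2)) \<partial>\<Omega>) \<noteq> \<infinity>"
    by (auto simp: top_unique)
  then have fin: "AE \<omega> in \<Omega>. liminf (\<lambda>n. ennreal ((norm (X n \<omega>))\<^sup>2)) \<noteq> \<infinity>"
    by (rule nn_integral_PInf_AE[rotated]) measurable
  \<comment> \<open>The limit of the codes need not be the code of any point, so \<open>Z\<close> is
    defined as the limit of the decoded variables.\<close>
  define Z where "Z \<omega> = lim (\<lambda>n. X n \<omega>)" for \<omega>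
  have Z: "Z \<in> borel_measurable \<Omega>"
    unfolding Z_def by (rule borel_measurable_lim_metric) auto
  have "AE \<omega> in \<Omega>. (\<lambda>n. X n \<omega>) \<longlonglongrightarrow> Z \<omega>"
    using encode fin AE_space
  proof eventually_elim
    case (elim \<omega>)
    have "convergent (\<lambda>n. encode (X n \<omega>))"
      using convergentI[OF lim[OF elim(3)]] elim(1) by simp
    moreover obtain R where R: "liminf (\<lambda>n. ennreal ((norm (X n \<omega>))\<^sup>2)) < ennreal R" "R \<ge> 0"
    proof (cases "liminf (\<lambda>n. ennreal ((norm (X n \<omega>))\<^sup>2))")
      case (real l)
      then show thesis
        by (intro that[of "l + 1"]) (auto simp: ennreal_less_iff)
    qed (use elim(2) in simp)
    have "\<exists>\<^sub>F n in sequentially. norm (X n \<omega>) \<le> sqrt R"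
    proof (rule ccontr)
      assume "\<not> ?thesis"
      then have "\<forall>\<^sub>F n in sequentially. \<not> norm (X n \<omega>) \<le> sqrt R"
        by (simp add: not_frequently)
      then have "\<forall>\<^sub>F n in sequentially. ennreal R \<le> ennreal ((norm (X n \<omega>))\<^sup>2)"
        by eventually_elim (auto intro!: ennreal_leI simp: not_le dest!: less_imp_le[THEN sqrt_le_D])
      then have "ennreal R \<le> liminf (\<lambda>n. ennreal ((norm (X n \<omega>))\<^sup>2))"
        by (rule Liminf_bounded)
      then show False
        using R by simp
    qed
    ultimately have "convergent (\<lambda>n. X n \<omega>)"
      by (rule convergent_of_encode)
    then show ?case
      unfolding Z_def by (simp add: convergent_LIMSEQ_iff)
  qed
  with r \<Omega> X Z dX show thesis
    by (rule that)
qed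


section \<open>Limits of integrals\<close>

lemma nn_integral_le_AE_tendsto:
  fixes f :: "nat \<Rightarrow> 'a \<Rightarrow> ennreal"
  assumes [measurable]: "\<And>n. f n \<in> borel_measurable M"
    and lim: "AE x in M. (\<lambda>n. f n x) \<longlonglongrightarrow> g x"
    and bound: "\<And>n. (\<integral>\<^sup>+x. f n x \<partial>M) \<le> C"
  shows "(\<integral>\<^sup>+x. g x \<partial>M) \<le> C"
proof -
  have "(\<integral>\<^sup>+x. g x \<partial>M) \<le> (\<integral>\<^sup>+x. liminf (\<lambda>n. f n x) \<partial>M)"
    using lim by (intro nn_integral_mono_AE) (auto elim!: eventually_mono dest!: lim_imp_Liminf[rotated])
  also have "\<dots> \<le> liminf (\<lambda>n. \<integral>\<^sup>+x. f n x \<partial>M)"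
    by (rule nn_integral_liminf) measurable
  also have "\<dots> \<le> C"
    using bound by (intro Liminf_le) auto
  finally show ?thesis .
qed

text \<open>As \<open>ennreal\<close> sends negative reals to 0, the integrand in
  \<open>tail\<close> is the positive part of |Z| - K, which is exactly how far truncation to
  [-K, K] moves \<open>Z\<close>. It is continuous in \<open>Z\<close>, so such tail bounds pass to
  limits.\<close>

lemma (in prob_space) truncation_error:
  fixes Z :: "'a \<Rightarrow> real"
  assumes [measurable]: "Z \<in> borel_measurable M" and "0 \<le> K" "0 \<le> e"
    and tail: "(\<integral>\<^sup>+\<omega>. ennreal (\<bar>Z \<omega>\<bar> - K) \<partial>M) \<le> ennreal e"
  shows "integrable M Z" "\<bar>expectation Z - expectation (\<lambda>\<omega>. max (- K) (min K (Z \<omega>)))\<bar> \<le> e"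
proof -
  have "(\<integral>\<^sup>+\<omega>. ennreal (norm (Z \<omega>)) \<partial>M) \<le> (\<integral>\<^sup>+\<omega>. ennreal K + ennreal (\<bar>Z \<omega>\<bar> - K) \<partial>M)"
  proof (rule nn_integral_mono)
    fix \<omega>
    show "ennreal (norm (Z \<omega>)) \<le> ennreal K + ennreal (\<bar>Z \<omega>\<bar> - K)"
      using \<open>0 \<le> K\<close> by (cases "K \<le> \<bar>Z \<omega>\<bar>") (auto simp: ennreal_plus[symmetric] ennreal_neg intro: ennreal_leI simp del: ennreal_plus)
  qed
  also have "\<dots> = ennreal K + (\<integral>\<^sup>+\<omega>. ennreal (\<bar>Z \<omega>\<bar> - K) \<partial>M)"
    by (subst nn_integral_add) (auto simp: emeasure_space_1)
  also have "\<dots> \<le> ennreal K + ennreal e"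
    using tail by (intro add_left_mono)
  also have "\<dots> < \<infinity>"
    by (simp add: less_top[symmetric])
  finally show int: "integrable M Z"
    by (intro integrableI_bounded) auto
  let ?T = "\<lambda>\<omega>. max (- K) (min K (Z \<omega>))"
  have intT: "integrable M ?T"
    using \<open>0 \<le> K\<close> by (intro integrable_const_bound[where B = K]) auto
  have "ennreal (expectation (\<lambda>\<omega>. \<bar>Z \<omega> - ?T \<omega>\<bar>)) = (\<integral>\<^sup>+\<omega>. ennreal \<bar>Z \<omega> - ?T \<omega>\<bar> \<partial>M)"
    using int intT by (intro nn_integral_eq_integral[symmetric]) auto
  also have "\<dots> \<le> (\<integral>\<^sup>+\<omega>. ennreal (\<bar>Z \<omega>\<bar> - K) \<partial>M)"
  proof (rule nn_integral_mono)
    fix \<omega>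
    have "\<bar>Z \<omega> - ?T \<omega>\<bar> = 0 \<or> \<bar>Z \<omega> - ?T \<omega>\<bar> \<le> \<bar>Z \<omega>\<bar> - K"
      using \<open>0 \<le> K\<close> by (auto simp: max_def min_def)
    then show "ennreal \<bar>Z \<omega> - ?T \<omega>\<bar> \<le> ennreal (\<bar>Z \<omega>\<bar> - K)"
      by (metis ennreal_0 ennreal_leI zero_le)
  qed
  also have "\<dots> \<le> ennreal e"
    by (rule tail)
  finally have "expectation (\<lambda>\<omega>. \<bar>Z \<omega> - ?T \<omega>\<bar>) \<le> e"
    using \<open>0 \<le> e\<close> by (simp add: ennreal_le_iff)
  moreover have "\<bar>expectation (\<lambda>\<omega>. Z \<omega> - ?T \<omega>)\<bar> \<le> expectation (\<lambda>\<omega>. \<bar>Z \<omega> - ?T \<omega>\<bar>)"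
    by (rule integral_abs_bound)
  moreover have "expectation (\<lambda>\<omega>. Z \<omega> - ?T \<omega>) = expectation Z - expectation ?T"
    using int intT by (rule Bochner_Integration.integral_diff)
  ultimately show "\<bar>expectation Z - expectation ?T\<bar> \<le> e"
    by simp
qed

text \<open>Truncation at \<open>K\<close> costs at most e/3 uniformly in \<open>n\<close> and, by
  Fatou's lemma, also in the limit; the truncated variables are dominated by the constant
  \<open>K\<close>.\<close>

lemma (in prob_space) Vitali_limit:
  fixes Z :: "nat \<Rightarrow> 'a \<Rightarrow> real"
  assumes meas [measurable]: "\<And>n. Z n \<in> borel_measurable M" "Z' \<in> borel_measurable M"
    and lim: "AE \<omega> in M. (\<lambda>n. Z n \<omega>) \<longlonglongrightarrow> Z' \<omega>"
    and ui: "\<And>e. 0 < e \<Longrightarrow> \<exists>K\<ge>0. \<forall>n. (\<integral>\<^sup>+\<omega>. ennreal (\<bar>Z n \<omega>\<bar> - K) \<partial>M) \<le> ennreal e"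
  shows "(\<lambda>n. expectation (Z n)) \<longlonglongrightarrow> expectation Z'"
proof (rule LIMSEQ_I)
  fix e :: real assume "0 < e"
  then obtain K where K: "0 \<le> K" "\<And>n. (\<integral>\<^sup>+\<omega>. ennreal (\<bar>Z n \<omega>\<bar> - K) \<partial>M) \<le> ennreal (e / 3)"
    using ui[of "e / 3"] by auto
  have K': "(\<integral>\<^sup>+\<omega>. ennreal (\<bar>Z' \<omega>\<bar> - K) \<partial>M) \<le> ennreal (e / 3)"
  proof (rule nn_integral_le_AE_tendsto[OF _ _ K(2)])
    show "AE \<omega> in M. (\<lambda>n. ennreal (\<bar>Z n \<omega>\<bar> - K)) \<longlonglongrightarrow> ennreal (\<bar>Z' \<omega>\<bar> - K)"
      using lim by eventually_elim (intro tendsto_intros)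
  qed measurable
  let ?T = "\<lambda>z. max (- K) (min K z)"
  have "(\<lambda>n. expectation (\<lambda>\<omega>. ?T (Z n \<omega>))) \<longlonglongrightarrow> expectation (\<lambda>\<omega>. ?T (Z' \<omega>))"
  proof (rule integral_dominated_convergence[where w = "\<lambda>_. K"])
    show "AE \<omega> in M. (\<lambda>n. ?T (Z n \<omega>)) \<longlonglongrightarrow> ?T (Z' \<omega>)"
      using lim by eventually_elim (intro tendsto_intros)
  qed (use \<open>0 \<le> K\<close> in auto)
  then obtain N where N: "\<And>n. n \<ge> N \<Longrightarrow>
      \<bar>expectation (\<lambda>\<omega>. ?T (Z n \<omega>)) - expectation (\<lambda>\<omega>. ?T (Z' \<omega>))\<bar> < e / 3"
    using LIMSEQ_D[of _ _ "e / 3"] \<open>0 < e\<close> by fastforce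
  have "norm (expectation (Z n) - expectation Z') < e" if "n \<ge> N" for n
    using truncation_error(2)[OF meas(1) K(1) _ K(2), of n]
      truncation_error(2)[OF meas(2) K(1) _ K'] N[OF that] \<open>0 < e\<close>
    unfolding real_norm_def by linarith
  then show "\<exists>N. \<forall>n\<ge>N. norm (expectation (Z n) - expectation Z') < e"
    by blast
qed

text \<open>The quadratic term has an arbitrarily small coefficient, which is what turns a bound on
  second moments into uniform integrability.\<close>

lemma C2w_bound:
  fixes f :: "'a::euclidean_space \<Rightarrow> real"
  assumes f: "f \<in> C2w" and "0 < e"
  obtains K where "0 \<le> K" "\<And>x. \<bar>f x\<bar> \<le> K + e * (norm x)\<^sup>2"
proof -
  have "((\<lambda>x. f x / (1 + (norm x)\<^sup>2)) \<longlongrightarrow> 0) at_infinity"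
    using f by (simp add: C2w_def)
  then have "\<forall>\<^sub>F x in at_infinity. \<bar>f x / (1 + (norm x)\<^sup>2)\<bar> < e"
    by (auto dest: tendstoD[OF _ \<open>0 < e\<close>] simp: dist_real_def)
  then obtain b where b: "\<And>x. b \<le> norm x \<Longrightarrow> \<bar>f x / (1 + (norm x)\<^sup>2)\<bar> < e"
    unfolding eventually_at_infinity by blast
  have "continuous_on (cball 0 b) f"
    using f by (auto simp: C2w_def intro: continuous_on_subset)
  then have "bounded (f ` cball 0 b)"
    by (intro compact_imp_bounded compact_continuous_image) auto
  then obtain B where "\<forall>x\<in>cball 0 b. \<bar>f x\<bar> \<le> B"
    unfolding bounded_iff by auto
  then have B: "\<bar>f x\<bar> \<le> B" if "norm x \<le> b" for x
    using that by simp
  show thesis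
  proof (rule that)
    show "0 \<le> \<bar>B\<bar> + e"
      using \<open>0 < e\<close> by simp
    fix x
    show "\<bar>f x\<bar> \<le> \<bar>B\<bar> + e + e * (norm x)\<^sup>2"
    proof (cases "norm x \<le> b")
      case True
      moreover have "0 \<le> e * (norm x)\<^sup>2"
        using \<open>0 < e\<close> by simp
      ultimately show ?thesis
        using B[of x] \<open>0 < e\<close> by linarith
    next
      case False
      have pos: "0 < 1 + (norm x)\<^sup>2"
        by (simp add: add_pos_nonneg)
      then have "\<bar>f x\<bar> < e * (1 + (norm x)\<^sup>2)"
        using b[of x] False by (simp add: abs_divide pos_divide_less_eq)
      then show ?thesis
        by (simp add: algebra_simps)
    qed
  qed
qed

lemma C2w_measurable [measurable_dest]: "f \<in> C2w \<Longrightarrow> f \<in> borel_measurable borel"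
  by (auto simp: C2w_def intro: borel_measurable_continuous_onI)

lemma (in prob_space) C2w_limit:
  fixes X :: "nat \<Rightarrow> 'a \<Rightarrow> 'b::euclidean_space"
  assumes [measurable]: "\<And>n. X n \<in> borel_measurable M" "Z \<in> borel_measurable M"
    and lim: "AE \<omega> in M. (\<lambda>n. X n \<omega>) \<longlonglongrightarrow> Z \<omega>"
    and bound: "\<And>n. (\<integral>\<^sup>+\<omega>. ennreal ((norm (X n \<omega>))\<^sup>2) \<partial>M) \<le> ennreal C"
    and f: "f \<in> C2w"
  shows "(\<lambda>n. expectation (\<lambda>\<omega>. f (X n \<omega>))) \<longlonglongrightarrow> expectation (\<lambda>\<omega>. f (Z \<omega>))"
proof (rule Vitali_limit)
  have [measurable]: "f \<in> borel_measurable borel"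
    by (rule C2w_measurable[OF f])
  show "(\<lambda>\<omega>. f (X n \<omega>)) \<in> borel_measurable M" "(\<lambda>\<omega>. f (Z \<omega>)) \<in> borel_measurable M" for n
    by measurable
  have cont: "isCont f x" for x
    using f by (simp add: C2w_def continuous_on_eq_continuous_at)
  show "AE \<omega> in M. (\<lambda>n. f (X n \<omega>)) \<longlonglongrightarrow> f (Z \<omega>)"
    using lim by eventually_elim (rule isCont_tendsto_compose[OF cont])
  fix e :: real assume "0 < e"
  \<comment> \<open>With this \<open>d\<close> the quadratic part of the tail is at most
    \<open>e\<close>; the absolute value and the 1 cover every sign of \<open>C\<close> and
    \<open>C = 0\<close>.\<close>
  define d where "d = e / (\<bar>C\<bar> + 1)"
  have d: "0 < d" "d * \<bar>C\<bar> \<le> e"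
    using \<open>0 < e\<close> unfolding d_def by (auto simp: field_simps)
  obtain K where K: "0 \<le> K" "\<And>x. \<bar>f x\<bar> \<le> K + d * (norm x)\<^sup>2"
    using C2w_bound[OF f d(1)] by blast
  have "(\<integral>\<^sup>+\<omega>. ennreal (\<bar>f (X n \<omega>)\<bar> - K) \<partial>M) \<le> ennreal e" for n
  proof -
    have "(\<integral>\<^sup>+\<omega>. ennreal (\<bar>f (X n \<omega>)\<bar> - K) \<partial>M) \<le> (\<integral>\<^sup>+\<omega>. ennreal d * ennreal ((norm (X n \<omega>))\<^sup>2) \<partial>M)"
      using K(2) d(1) by (intro nn_integral_mono) (auto simp: ennreal_mult[symmetric] algebra_simps intro!: ennreal_leI)
    also have "\<dots> = ennreal d * (\<integral>\<^sup>+\<omega>. ennreal ((norm (X n \<omega>))\<^sup>2) \<partial>M)"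
      by (rule nn_integral_cmult) measurable
    also have "\<dots> \<le> ennreal d * ennreal \<bar>C\<bar>"
      by (intro mult_left_mono order_trans[OF bound] ennreal_leI) auto
    also have "\<dots> \<le> ennreal e"
      using d by (simp add: ennreal_mult[symmetric] ennreal_leI)
    finally show ?thesis .
  qed
  then show "\<exists>K\<ge>0. \<forall>n. (\<integral>\<^sup>+\<omega>. ennreal (\<bar>f (X n \<omega>)\<bar> - K) \<partial>M) \<le> ennreal e"
    using K(1) by blast
qed

section \<open>Members of \<open>C2w\<close> and the laws they determine\<close>

lemma bounded_continuous_in_C2w:
  fixes f :: "'a::euclidean_space \<Rightarrow> real"
  assumes "continuous_on UNIV f" "\<And>x. \<bar>f x\<bar> \<le> B"
  shows "f \<in> C2w"
proof -
  have "filterlim (\<lambda>x::'a. (norm x)\<^sup>2) at_top at_infinity"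
    by (intro filterlim_pow_at_top filterlim_norm_at_top) simp
  then have "filterlim (\<lambda>x::'a. 1 + (norm x)\<^sup>2) at_top at_infinity"
    by (intro filterlim_tendsto_add_at_top[OF tendsto_const])
  then have "((\<lambda>x::'a. B / (1 + (norm x)\<^sup>2)) \<longlongrightarrow> 0) at_infinity"
    by (intro tendsto_divide_0[OF tendsto_const] filterlim_at_top_imp_at_infinity)
  then have "((\<lambda>x. f x / (1 + (norm x)\<^sup>2)) \<longlongrightarrow> 0) at_infinity"
    by (rule Lim_null_comparison[rotated])
       (use assms(2) in \<open>auto intro!: always_eventually divide_right_mono simp: abs_divide\<close>)
  then show ?thesis
    using assms(1) by (simp add: C2w_def)
qed

lemma norm_powr_in_C2w:
  assumes "0 < p" "p < 2"
  shows "(\<lambda>x::'a::euclidean_space. norm x powr p) \<in> C2w"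
proof -
  have "((\<lambda>t::real. t powr (p - 2)) \<longlongrightarrow> 0) at_top"
    using assms by (intro tendsto_neg_powr filterlim_ident) auto
  then have "((\<lambda>x::'a. norm x powr (p - 2)) \<longlongrightarrow> 0) at_infinity"
    by (rule filterlim_compose[OF _ filterlim_norm_at_top])
  then have "((\<lambda>x::'a. norm x powr p / (1 + (norm x)\<^sup>2)) \<longlongrightarrow> 0) at_infinity"
  proof (rule Lim_null_comparison[rotated])
    have "norm (norm x powr p / (1 + (norm x)\<^sup>2)) \<le> norm x powr (p - 2)" if "1 \<le> norm x" for x :: 'a
    proof -
      have "norm x powr p = norm x powr (p - 2) * (norm x)\<^sup>2"
        using that powr_add[of "norm x" "p - 2" 2] by (simp add: powr_numeral)
      also have "\<dots> \<le> norm x powr (p - 2) * (1 + (norm x)\<^sup>2)"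
        by (intro mult_left_mono) auto
      finally show ?thesis
        by (simp add: abs_divide divide_le_eq add_pos_nonneg)
    qed
    then show "\<forall>\<^sub>F x::'a in at_infinity. norm (norm x powr p / (1 + (norm x)\<^sup>2)) \<le> norm x powr (p - 2)"
      unfolding eventually_at_infinity by blast
  qed
  moreover have "continuous_on UNIV (\<lambda>x::'a. norm x powr p)"
    using assms by (intro continuous_on_powr' continuous_intros) auto
  ultimately show ?thesis
    by (simp add: C2w_def)
qed

text \<open>Open sets form an intersection-stable generator of the Borel sets, and the indicator of
  an open set is a pointwise limit of bounded continuous functions, built from the distance to the
  complement.\<close>

lemma measure_eq_if_C2w_integrals_eq:
  fixes M N :: "'a::euclidean_space measure"
  assumes M: "prob_space M" "sets M = sets borel" and N: "prob_space N" "sets N = sets borel"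
    and eq: "\<And>f. f \<in> C2w \<Longrightarrow> (\<integral>x. f x \<partial>M) = (\<integral>x. f x \<partial>N)"
  shows "M = N"
proof (rule measure_eqI_generator_eq[where E = "{S. open S}" and \<Omega> = UNIV and A = "\<lambda>_. UNIV"])
  interpret M: prob_space M by fact
  interpret N: prob_space N by fact
  show "Int_stable {S::'a set. open S}"
    by (auto simp: Int_stable_def)
  show "sets M = sigma_sets UNIV {S. open S}" "sets N = sigma_sets UNIV {S. open S}"
    using M N by (simp_all add: sets_borel)
  show "emeasure M UNIV \<noteq> \<infinity>"
    using M.emeasure_finite by simp
  fix U :: "'a set" assume "U \<in> {S. open S}"
  then have U: "open U" by simp
  show "emeasure M U = emeasure N U"
  proof (cases "U = UNIV")
    \<comment> \<open>\<open>infdist\<close> to the empty set is 0 by convention, so the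
      approximating functions used below would vanish for the whole space.\<close>
    case True
    then show ?thesis
      using M.emeasure_space_1 N.emeasure_space_1 sets_eq_imp_space_eq[OF M(2)] sets_eq_imp_space_eq[OF N(2)] by simp
  next
    case False
    define f where "f k x = min 1 (real k * infdist x (- U))" for k x
    have f: "f k \<in> C2w" for k
      by (rule bounded_continuous_in_C2w[of _ 1])
         (auto simp: f_def abs_le_iff infdist_nonneg intro!: continuous_intros order_trans[of _ 0])
    have lim: "(\<lambda>k. f k x) \<longlonglongrightarrow> indicator U x" for x
    proof (cases "x \<in> U")
      case True
      then have "0 < infdist x (- U)"
        using U False by (intro infdist_pos_not_in_closed) auto
      then obtain k0 where k0: "1 < real k0 * infdist x (- U)"
        using reals_Archimedean3 by blast
      have "f k x = 1" if "k \<ge> k0" for k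
        using k0 that mult_right_mono[of "real k0" "real k" "infdist x (- U)"] infdist_nonneg[of x "- U"]
        by (simp add: f_def)
      then have "\<forall>\<^sub>F k in sequentially. f k x = 1"
        unfolding eventually_sequentially by blast
      then show ?thesis
        using True by (simp add: tendsto_eventually)
    next
      case False
      then show ?thesis
        by (simp add: f_def)
    qed
    have conv: "(\<lambda>k. \<integral>x. f k x \<partial>L) \<longlonglongrightarrow> measure L U" if "prob_space L" "sets L = sets borel" for L
    proof -
      interpret L: prob_space L by fact
      have [measurable]: "f k \<in> borel_measurable L" "U \<in> sets L" for k
        using C2w_measurable[OF f] measurable_cong_sets[OF that(2) refl] U that(2) by auto
      have "(\<lambda>k. \<integral>x. f k x \<partial>L) \<longlonglongrightarrow> (\<integral>x. indicator U x \<partial>L)"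
        by (rule integral_dominated_convergence[where w = "\<lambda>_. 1"])
           (auto simp: lim, auto simp: f_def infdist_nonneg abs_le_iff intro!: order_trans[of _ 0])
      then show ?thesis
        by (simp add: Int_absorb2 sets.sets_into_space)
    qed
    have "measure M U = measure N U"
      using conv[OF M] conv[OF N] eq[OF f] by (auto intro: LIMSEQ_unique)
    then show ?thesis
      by (simp add: M.emeasure_eq_measure N.emeasure_eq_measure)
  qed
qed auto

text \<open>Two representations of the same laws live on different probability spaces with unrelated
  paths; their limits are compared through integrals of \<open>C2w\<close> functions, which are
  equal along the sequences.\<close>

lemma law_limit_unique:
  fixes X :: "nat \<Rightarrow> 'a \<Rightarrow> 'c::euclidean_space" and X' :: "nat \<Rightarrow> 'b \<Rightarrow> 'c"
  assumes M: "prob_space M" and N: "prob_space N"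
    and X [measurable]: "\<And>n. X n \<in> borel_measurable M" "Z \<in> borel_measurable M"
    and X' [measurable]: "\<And>n. X' n \<in> borel_measurable N" "Z' \<in> borel_measurable N"
    and lim: "AE \<omega> in M. (\<lambda>n. X n \<omega>) \<longlonglongrightarrow> Z \<omega>" and lim': "AE \<omega> in N. (\<lambda>n. X' n \<omega>) \<longlonglongrightarrow> Z' \<omega>"
    and bound: "\<And>n. (\<integral>\<^sup>+\<omega>. ennreal ((norm (X n \<omega>))\<^sup>2) \<partial>M) \<le> ennreal C"
    and eq: "\<And>n. distr M borel (X n) = distr N borel (X' n)"
  shows "distr M borel Z = distr N borel Z'"
proof (rule measure_eq_if_C2w_integrals_eq)
  interpret M: prob_space M by fact
  interpret N: prob_space N by fact
  show "prob_space (distr M borel Z)" "prob_space (distr N borel Z')"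
    by (simp_all add: M.prob_space_distr N.prob_space_distr)
  fix f :: "'c \<Rightarrow> real" assume f: "f \<in> C2w"
  have [measurable]: "f \<in> borel_measurable borel"
    by (rule C2w_measurable[OF f])
  have bound': "(\<integral>\<^sup>+\<omega>. ennreal ((norm (X' n \<omega>))\<^sup>2) \<partial>N) \<le> ennreal C" for n
  proof -
    have "(\<integral>\<^sup>+\<omega>. ennreal ((norm (X' n \<omega>))\<^sup>2) \<partial>N) = (\<integral>\<^sup>+x. ennreal ((norm x)\<^sup>2) \<partial>distr N borel (X' n))"
      by (rule nn_integral_distr[symmetric]) measurable
    also have "\<dots> = (\<integral>\<^sup>+\<omega>. ennreal ((norm (X n \<omega>))\<^sup>2) \<partial>M)"
      unfolding eq[symmetric] by (rule nn_integral_distr) measurable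
    finally show ?thesis
      using bound by simp
  qed
  have "(\<integral>\<omega>. f (X n \<omega>) \<partial>M) = (\<integral>\<omega>. f (X' n \<omega>) \<partial>N)" for n
    using integral_distr[of "X n" M borel f] integral_distr[of "X' n" N borel f] eq[of n] by simp
  then have "(\<integral>\<omega>. f (Z \<omega>) \<partial>M) = (\<integral>\<omega>. f (Z' \<omega>) \<partial>N)"
    using M.C2w_limit[OF X lim bound f] N.C2w_limit[OF X' lim' bound' f]
    by (auto intro: LIMSEQ_unique)
  then show "(\<integral>x. f x \<partial>distr M borel Z) = (\<integral>x. f x \<partial>distr N borel Z')"
    by (simp add: integral_distr)
qed auto


section \<open>Optimal couplings and the Opial property\<close>

text \<open>Plans are measures on the Borel sets of a product type and not on a product
  \<sigma>-algebra; second countability makes the two agree.\<close>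

lemma
  fixes f :: "'a \<Rightarrow> 'b::second_countable_topology \<times> 'c::second_countable_topology"
  assumes "f \<in> borel_measurable M"
  shows borel_measurable_fst: "(\<lambda>x. fst (f x)) \<in> borel_measurable M"
    and borel_measurable_snd: "(\<lambda>x. snd (f x)) \<in> borel_measurable M"
  using assms unfolding borel_prod[symmetric] by measurable

lemma
  shows fst_borel: "fst \<in> borel_measurable (borel :: ('b::second_countable_topology \<times> 'c::second_countable_topology) measure)"
    and snd_borel: "snd \<in> borel_measurable (borel :: ('b::second_countable_topology \<times> 'c::second_countable_topology) measure)"
  using borel_measurable_fst[of "\<lambda>x. x :: 'b \<times> 'c" borel] borel_measurable_snd[of "\<lambda>x. x :: 'b \<times> 'c" borel]
  by simp_all

lemma W2_sq: "(W 2 \<mu> \<nu>)\<^sup>2 = enn2real (transport_cost 2 \<mu> \<nu>)"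
  by (simp add: W_def powr_half_sqrt)

lemma W_nonneg: "0 \<le> W p \<mu> \<nu>"
  by (simp add: W_def)

lemma P2_D:
  assumes "\<mu> \<in> P2"
  shows "sets \<mu> = sets borel" "prob_space \<mu>" "integrable \<mu> (\<lambda>x. (norm x)\<^sup>2)"
  using assms by (auto simp: P2_def)

lemma distr_in_P2_iff:
  fixes X :: "'a \<Rightarrow> 'b::euclidean_space"
  assumes "prob_space M" and [measurable]: "X \<in> borel_measurable M"
  shows "distr M borel X \<in> P2 \<longleftrightarrow> integrable M (\<lambda>\<omega>. (norm (X \<omega>))\<^sup>2)"
  by (auto simp: P2_def prob_space.prob_space_distr[OF assms] integrable_distr_eq)

lemma second_moment_eq:
  fixes X :: "'a \<Rightarrow> 'b::euclidean_space"
  assumes [measurable]: "X \<in> borel_measurable M" and int: "integrable M (\<lambda>\<omega>. (norm (X \<omega>))\<^sup>2)"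
  shows "(\<integral>\<^sup>+\<omega>. ennreal ((norm (X \<omega>))\<^sup>2) \<partial>M) = ennreal (\<integral>x. (norm x)\<^sup>2 \<partial>distr M borel X)"
    "(\<integral>\<omega>. (norm (X \<omega>))\<^sup>2 \<partial>M) = (\<integral>x. (norm x)\<^sup>2 \<partial>distr M borel X)"
  using int by (simp_all add: nn_integral_eq_integral integral_distr)

text \<open>Plans are handled as laws of pairs of random variables on some probability space, so
  that costs become expectations and the Skorokhod variables can be inserted directly.\<close>

lemma pair_in_couplings:
  fixes X Y :: "'a \<Rightarrow> 'b::euclidean_space"
  assumes M: "prob_space M" and [measurable]: "X \<in> borel_measurable M" "Y \<in> borel_measurable M"
  shows "distr M borel (\<lambda>\<omega>. (X \<omega>, Y \<omega>)) \<in> couplings (distr M borel X) (distr M borel Y)"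
  unfolding couplings_def
  by (auto simp: prob_space.prob_space_distr[OF M] distr_distr[OF fst_borel] distr_distr[OF snd_borel] comp_def)

lemma borel_measurable_fst_minus_snd:
  "(\<lambda>z :: 'b::euclidean_space \<times> 'b. fst z - snd z) \<in> borel_measurable borel"
  by (intro borel_measurable_diff fst_borel snd_borel)

lemma plan_cost_distr:
  fixes X Y :: "'a \<Rightarrow> 'b::euclidean_space"
  assumes [measurable]: "X \<in> borel_measurable M" "Y \<in> borel_measurable M"
  shows "plan_cost p (distr M borel (\<lambda>\<omega>. (X \<omega>, Y \<omega>))) = (\<integral>\<^sup>+\<omega>. ennreal (norm (X \<omega> - Y \<omega>) powr p) \<partial>M)"
  using measurable_compose[OF borel_measurable_fst_minus_snd[where 'b = 'b], of "\<lambda>d. ennreal (norm d powr p)" borel]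
  unfolding plan_cost_def by (subst nn_integral_distr) auto

lemma integral_plan_distr:
  fixes X Y :: "'a \<Rightarrow> 'b::euclidean_space"
  assumes [measurable]: "X \<in> borel_measurable M" "Y \<in> borel_measurable M"
  shows "(\<integral>z. (norm (fst z - snd z))\<^sup>2 \<partial>distr M borel (\<lambda>\<omega>. (X \<omega>, Y \<omega>))) = (\<integral>\<omega>. (norm (X \<omega> - Y \<omega>))\<^sup>2 \<partial>M)"
  using measurable_compose[OF borel_measurable_fst_minus_snd, of "\<lambda>d :: 'b. (norm d)\<^sup>2" borel]
  by (subst integral_distr) auto

lemma transport_cost_le:
  fixes X Y :: "'a \<Rightarrow> 'b::euclidean_space"
  assumes M: "prob_space M" and [measurable]: "X \<in> borel_measurable M" "Y \<in> borel_measurable M"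
  shows "transport_cost p (distr M borel X) (distr M borel Y)
    \<le> (\<integral>\<^sup>+\<omega>. ennreal (norm (X \<omega> - Y \<omega>) powr p) \<partial>M)"
proof -
  have "transport_cost p (distr M borel X) (distr M borel Y)
      \<le> plan_cost p (distr M borel (\<lambda>\<omega>. (X \<omega>, Y \<omega>)))"
    unfolding transport_cost_def by (intro INF_lower pair_in_couplings M) measurable
  also have "\<dots> = (\<integral>\<^sup>+\<omega>. ennreal (norm (X \<omega> - Y \<omega>) powr p) \<partial>M)"
    by (rule plan_cost_distr) measurable
  finally show ?thesis .
qed

lemma integrable_inner:
  fixes X Y :: "'a \<Rightarrow> 'b::euclidean_space"
  assumes [measurable]: "X \<in> borel_measurable M" "Y \<in> borel_measurable M"
    and "integrable M (\<lambda>\<omega>. (norm (X \<omega>))\<^sup>2)" "integrable M (\<lambda>\<omega>. (norm (Y \<omega>))\<^sup>2)"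
  shows "integrable M (\<lambda>\<omega>. X \<omega> \<bullet> Y \<omega>)"
proof (rule Bochner_Integration.integrable_bound)
  show "integrable M (\<lambda>\<omega>. (norm (X \<omega>))\<^sup>2 + (norm (Y \<omega>))\<^sup>2)"
    using assms by simp
  have "\<bar>x \<bullet> y\<bar> \<le> (norm x)\<^sup>2 + (norm y)\<^sup>2" for x y :: 'b
    using Cauchy_Schwarz_ineq2[of x y] sum_squares_bound[of "norm x" "norm y"]
      mult_nonneg_nonneg[of "norm x" "norm y"] by simp
  then show "AE \<omega> in M. norm (X \<omega> \<bullet> Y \<omega>) \<le> norm ((norm (X \<omega>))\<^sup>2 + (norm (Y \<omega>))\<^sup>2)"
    by (intro AE_I2) simp
qed measurable

lemma norm_diff_sq:
  fixes x y :: "'a::real_inner"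
  shows "(norm (x - y))\<^sup>2 = (norm x)\<^sup>2 + (norm y)\<^sup>2 - 2 * (x \<bullet> y)"
  by (simp add: power2_norm_eq_inner inner_diff inner_commute algebra_simps)

lemma
  fixes X Y :: "'a \<Rightarrow> 'b::euclidean_space"
  assumes "X \<in> borel_measurable M" "Y \<in> borel_measurable M"
    and "integrable M (\<lambda>\<omega>. (norm (X \<omega>))\<^sup>2)" "integrable M (\<lambda>\<omega>. (norm (Y \<omega>))\<^sup>2)"
  shows integrable_norm_diff_sq: "integrable M (\<lambda>\<omega>. (norm (X \<omega> - Y \<omega>))\<^sup>2)"
    and integral_norm_diff_sq: "(\<integral>\<omega>. (norm (X \<omega> - Y \<omega>))\<^sup>2 \<partial>M) =
      (\<integral>\<omega>. (norm (X \<omega>))\<^sup>2 \<partial>M) + (\<integral>\<omega>. (norm (Y \<omega>))\<^sup>2 \<partial>M) - 2 * (\<integral>\<omega>. X \<omega> \<bullet> Y \<omega> \<partial>M)"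
  using integrable_inner[OF assms] assms(3,4) by (simp_all add: norm_diff_sq)

lemma W2_sq_le:
  fixes X Y :: "'a \<Rightarrow> 'b::euclidean_space"
  assumes M: "prob_space M" and XY [measurable]: "X \<in> borel_measurable M" "Y \<in> borel_measurable M"
    and int: "integrable M (\<lambda>\<omega>. (norm (X \<omega>))\<^sup>2)" "integrable M (\<lambda>\<omega>. (norm (Y \<omega>))\<^sup>2)"
  shows "(W 2 (distr M borel X) (distr M borel Y))\<^sup>2 \<le> (\<integral>\<omega>. (norm (X \<omega> - Y \<omega>))\<^sup>2 \<partial>M)"
proof -
  have "transport_cost 2 (distr M borel X) (distr M borel Y)
      \<le> (\<integral>\<^sup>+\<omega>. ennreal ((norm (X \<omega> - Y \<omega>))\<^sup>2) \<partial>M)"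
    using transport_cost_le[OF M XY, of 2] by (simp add: powr_numeral)
  also have "\<dots> = ennreal (\<integral>\<omega>. (norm (X \<omega> - Y \<omega>))\<^sup>2 \<partial>M)"
    using integrable_norm_diff_sq[OF XY int] by (intro nn_integral_eq_integral) auto
  finally show ?thesis
    unfolding W2_sq by (intro enn2real_leI) auto
qed

text \<open>The product coupling has finite cost. Finiteness makes almost optimal plans available:
  the infimum is then strictly smaller than itself plus a positive number.\<close>

lemma transport_cost_finite:
  fixes \<mu> \<nu> :: "'a::euclidean_space measure"
  assumes \<mu>: "\<mu> \<in> P2" and \<nu>: "\<nu> \<in> P2"
  shows "transport_cost 2 \<mu> \<nu> < \<infinity>"
proof -
  interpret \<mu>: prob_space \<mu> using P2_D[OF \<mu>] by simp
  interpret \<nu>: prob_space \<nu> using P2_D[OF \<nu>] by simp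
  interpret pair_prob_space \<mu> \<nu> ..
  have [measurable_cong]: "sets \<mu> = sets borel" "sets \<nu> = sets borel"
    using P2_D[OF \<mu>] P2_D[OF \<nu>] by simp_all
  have X [measurable]: "fst \<in> borel_measurable (\<mu> \<Otimes>\<^sub>M \<nu>)" "snd \<in> borel_measurable (\<mu> \<Otimes>\<^sub>M \<nu>)"
    by measurable
  have d: "distr (\<mu> \<Otimes>\<^sub>M \<nu>) borel fst = \<mu>" "distr (\<mu> \<Otimes>\<^sub>M \<nu>) borel snd = \<nu>"
  proof -
    have "distr (\<mu> \<Otimes>\<^sub>M \<nu>) borel fst = distr (\<mu> \<Otimes>\<^sub>M \<nu>) \<mu> fst"
      using P2_D[OF \<mu>] by (intro distr_cong) auto
    then show "distr (\<mu> \<Otimes>\<^sub>M \<nu>) borel fst = \<mu>"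
      by (simp add: \<nu>.distr_pair_fst)
    have "distr (\<mu> \<Otimes>\<^sub>M \<nu>) borel snd = distr (distr (\<nu> \<Otimes>\<^sub>M \<mu>) (\<mu> \<Otimes>\<^sub>M \<nu>) (\<lambda>(x, y). (y, x))) borel snd"
      by (subst distr_pair_swap) simp
    also have "\<dots> = distr (\<nu> \<Otimes>\<^sub>M \<mu>) \<nu> fst"
      using P2_D[OF \<nu>] by (subst distr_distr) (auto intro!: distr_cong simp: split_beta')
    finally show "distr (\<mu> \<Otimes>\<^sub>M \<nu>) borel snd = \<nu>"
      by (simp add: \<mu>.distr_pair_fst)
  qed
  have i: "integrable (\<mu> \<Otimes>\<^sub>M \<nu>) (\<lambda>z. (norm (fst z))\<^sup>2)" "integrable (\<mu> \<Otimes>\<^sub>M \<nu>) (\<lambda>z. (norm (snd z))\<^sup>2)"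
    using distr_in_P2_iff[OF P.prob_space_axioms X(1)] distr_in_P2_iff[OF P.prob_space_axioms X(2)]
    unfolding d using \<mu> \<nu> by simp_all
  have "transport_cost 2 \<mu> \<nu> \<le> (\<integral>\<^sup>+z. ennreal ((norm (fst z - snd z))\<^sup>2) \<partial>(\<mu> \<Otimes>\<^sub>M \<nu>))"
    using transport_cost_le[OF P.prob_space_axioms X, of 2] unfolding d by (simp add: powr_numeral)
  also have "\<dots> = ennreal (\<integral>z. (norm (fst z - snd z))\<^sup>2 \<partial>(\<mu> \<Otimes>\<^sub>M \<nu>))"
    using integrable_norm_diff_sq[OF X i] by (intro nn_integral_eq_integral) auto
  finally show ?thesis
    by (simp add: le_less_trans)
qed

lemma coupling_facts:
  fixes \<mu> \<nu> :: "'a::euclidean_space measure"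
  assumes \<mu>: "\<mu> \<in> P2" and \<nu>: "\<nu> \<in> P2" and \<gamma>: "\<gamma> \<in> couplings \<mu> \<nu>"
  shows "prob_space \<gamma>" "sets \<gamma> = sets borel"
    "fst \<in> borel_measurable \<gamma>" "snd \<in> borel_measurable \<gamma>"
    "distr \<gamma> borel fst = \<mu>" "distr \<gamma> borel snd = \<nu>"
    "integrable \<gamma> (\<lambda>z. (norm (fst z))\<^sup>2)" "integrable \<gamma> (\<lambda>z. (norm (snd z))\<^sup>2)"
    "plan_cost 2 \<gamma> = ennreal (\<integral>z. (norm (fst z - snd z))\<^sup>2 \<partial>\<gamma>)"
    "(\<integral>\<^sup>+z. ennreal ((norm z)\<^sup>2) \<partial>\<gamma>) = ennreal ((\<integral>x. (norm x)\<^sup>2 \<partial>\<mu>) + (\<integral>x. (norm x)\<^sup>2 \<partial>\<nu>))"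
proof -
  show g: "prob_space \<gamma>" "sets \<gamma> = sets borel" "distr \<gamma> borel fst = \<mu>" "distr \<gamma> borel snd = \<nu>"
    using \<gamma> by (auto simp: couplings_def)
  have "(\<lambda>z. z) \<in> borel_measurable \<gamma>"
    using g(2) by (simp add: measurable_ident_sets)
  from borel_measurable_fst[OF this] borel_measurable_snd[OF this]
  show m: "fst \<in> borel_measurable \<gamma>" "snd \<in> borel_measurable \<gamma>"
    by simp_all
  show i: "integrable \<gamma> (\<lambda>z. (norm (fst z))\<^sup>2)" "integrable \<gamma> (\<lambda>z. (norm (snd z))\<^sup>2)"
    using distr_in_P2_iff[OF g(1) m(1)] distr_in_P2_iff[OF g(1) m(2)] g \<mu> \<nu> by simp_all
  show "plan_cost 2 \<gamma> = ennreal (\<integral>z. (norm (fst z - snd z))\<^sup>2 \<partial>\<gamma>)"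
    unfolding plan_cost_def using integrable_norm_diff_sq[OF m i]
    by (simp add: powr_numeral nn_integral_eq_integral)
  have "(\<integral>\<^sup>+z. ennreal ((norm z)\<^sup>2) \<partial>\<gamma>) = (\<integral>\<^sup>+z. ennreal ((norm (fst z))\<^sup>2 + (norm (snd z))\<^sup>2) \<partial>\<gamma>)"
    by (intro nn_integral_cong) (auto simp: norm_prod_def)
  also have "\<dots> = ennreal (\<integral>z. (norm (fst z))\<^sup>2 + (norm (snd z))\<^sup>2 \<partial>\<gamma>)"
    using i by (intro nn_integral_eq_integral) auto
  also have "(\<integral>z. (norm (fst z))\<^sup>2 + (norm (snd z))\<^sup>2 \<partial>\<gamma>) = (\<integral>x. (norm x)\<^sup>2 \<partial>\<mu>) + (\<integral>x. (norm x)\<^sup>2 \<partial>\<nu>)"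
    using i second_moment_eq(2)[OF m(1) i(1)] second_moment_eq(2)[OF m(2) i(2)] g by simp
  finally show "(\<integral>\<^sup>+z. ennreal ((norm z)\<^sup>2) \<partial>\<gamma>) = ennreal ((\<integral>x. (norm x)\<^sup>2 \<partial>\<mu>) + (\<integral>x. (norm x)\<^sup>2 \<partial>\<nu>))" .
qed

lemma opt_coupling_cost:
  assumes "\<mu> \<in> P2" "\<nu> \<in> P2" "\<gamma> \<in> opt_couplings \<mu> \<nu>"
  shows "(W 2 \<mu> \<nu>)\<^sup>2 = (\<integral>z. (norm (fst z - snd z))\<^sup>2 \<partial>\<gamma>)"
proof -
  have "\<gamma> \<in> couplings \<mu> \<nu>" and opt: "plan_cost 2 \<gamma> = transport_cost 2 \<mu> \<nu>"
    using assms(3) by (auto simp: opt_couplings_def)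
  then show ?thesis
    unfolding W2_sq opt[symmetric] by (simp add: coupling_facts(9)[OF assms(1,2)])
qed

text \<open>The representation theorem is applied to the plans as measures on the Euclidean space
  \<open>'a \<times> 'a\<close>; their second moments are the sums of those of the marginals, hence
  bounded.\<close>

lemma couplings_limit:
  fixes \<mu> \<nu> :: "nat \<Rightarrow> 'a::euclidean_space measure"
  assumes P2: "\<And>n. \<mu> n \<in> P2" "\<And>n. \<nu> n \<in> P2" and \<gamma>: "\<And>n. \<gamma> n \<in> couplings (\<mu> n) (\<nu> n)"
    and bound: "\<And>n. (\<integral>x. (norm x)\<^sup>2 \<partial>\<mu> n) \<le> C" "\<And>n. (\<integral>x. (norm x)\<^sup>2 \<partial>\<nu> n) \<le> D"
  obtains r \<Omega> X Y X' Y' where "strict_mono (r :: nat \<Rightarrow> nat)" "prob_space (\<Omega> :: real measure)"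
    "\<And>n. X n \<in> borel_measurable \<Omega>" "\<And>n. Y n \<in> borel_measurable \<Omega>"
    "X' \<in> borel_measurable \<Omega>" "Y' \<in> borel_measurable \<Omega>"
    "\<And>n. distr \<Omega> borel (\<lambda>\<omega>. (X n \<omega>, Y n \<omega>)) = \<gamma> (r n)"
    "\<And>n. distr \<Omega> borel (X n) = \<mu> (r n)" "\<And>n. distr \<Omega> borel (Y n) = \<nu> (r n)"
    "AE \<omega> in \<Omega>. (\<lambda>n. X n \<omega>) \<longlonglongrightarrow> X' \<omega>" "AE \<omega> in \<Omega>. (\<lambda>n. Y n \<omega>) \<longlonglongrightarrow> Y' \<omega>"
proof -
  have "(\<integral>\<^sup>+z. ennreal ((norm z)\<^sup>2) \<partial>\<gamma> n) \<le> ennreal (C + D)" for n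
    unfolding coupling_facts(10)[OF P2 \<gamma>] using bound by (intro ennreal_leI add_mono)
  then obtain r \<Omega> U Z where r: "strict_mono (r :: nat \<Rightarrow> nat)" and \<Omega>: "prob_space (\<Omega> :: real measure)"
    and U: "\<And>n. U n \<in> borel_measurable \<Omega>" "Z \<in> borel_measurable \<Omega>"
      "\<And>n. distr \<Omega> borel (U n) = \<gamma> (r n)" "AE \<omega> in \<Omega>. (\<lambda>n. U n \<omega>) \<longlonglongrightarrow> Z \<omega>"
    using Skorokhod_subsequence[of \<gamma> "C + D"] coupling_facts(1,2)[OF P2 \<gamma>] by blast
  have distr_comp: "distr \<Omega> borel (\<lambda>\<omega>. f (U n \<omega>)) = distr (\<gamma> (r n)) borel f"
    if "f \<in> borel_measurable borel" for f :: "'a \<times> 'a \<Rightarrow> 'a" and n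
    unfolding U(3)[symmetric] using that U(1) by (simp add: distr_distr comp_def)
  show thesis
  proof (rule that[OF r \<Omega>])
    show "(\<lambda>\<omega>. fst (U n \<omega>)) \<in> borel_measurable \<Omega>" "(\<lambda>\<omega>. snd (U n \<omega>)) \<in> borel_measurable \<Omega>" for n
      using U(1) by (simp_all add: borel_measurable_fst borel_measurable_snd)
    show "(\<lambda>\<omega>. fst (Z \<omega>)) \<in> borel_measurable \<Omega>" "(\<lambda>\<omega>. snd (Z \<omega>)) \<in> borel_measurable \<Omega>"
      using U(2) by (simp_all add: borel_measurable_fst borel_measurable_snd)
    show "distr \<Omega> borel (\<lambda>\<omega>. (fst (U n \<omega>), snd (U n \<omega>))) = \<gamma> (r n)" for n
      using U(3) by simp
    show "distr \<Omega> borel (\<lambda>\<omega>. fst (U n \<omega>)) = \<mu> (r n)" "distr \<Omega> borel (\<lambda>\<omega>. snd (U n \<omega>)) = \<nu> (r n)" for n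
      using distr_comp[of fst n] distr_comp[of snd n] coupling_facts(5,6)[OF P2 \<gamma>]
      by (simp_all add: fst_borel snd_borel)
    show "AE \<omega> in \<Omega>. (\<lambda>n. fst (U n \<omega>)) \<longlonglongrightarrow> fst (Z \<omega>)" "AE \<omega> in \<Omega>. (\<lambda>n. snd (U n \<omega>)) \<longlonglongrightarrow> snd (Z \<omega>)"
      using U(4) by (auto elim!: eventually_mono intro: tendsto_fst tendsto_snd)
  qed
qed

section \<open>Limits of second moments and of inner products\<close>

lemma second_moment_limit:
  fixes X :: "nat \<Rightarrow> 'a \<Rightarrow> 'b::euclidean_space"
  assumes [measurable]: "\<And>n. X n \<in> borel_measurable M" "Z \<in> borel_measurable M"
    and lim: "AE \<omega> in M. (\<lambda>n. X n \<omega>) \<longlonglongrightarrow> Z \<omega>"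
    and bound: "\<And>n. (\<integral>\<^sup>+\<omega>. ennreal ((norm (X n \<omega>))\<^sup>2) \<partial>M) \<le> ennreal C"
  shows "(\<integral>\<^sup>+\<omega>. ennreal ((norm (Z \<omega>))\<^sup>2) \<partial>M) \<le> ennreal C"
    "integrable M (\<lambda>\<omega>. (norm (Z \<omega>))\<^sup>2)"
proof -
  show le: "(\<integral>\<^sup>+\<omega>. ennreal ((norm (Z \<omega>))\<^sup>2) \<partial>M) \<le> ennreal C"
  proof (rule nn_integral_le_AE_tendsto[OF _ _ bound])
    show "AE \<omega> in M. (\<lambda>n. ennreal ((norm (X n \<omega>))\<^sup>2)) \<longlonglongrightarrow> ennreal ((norm (Z \<omega>))\<^sup>2)"
      using lim by eventually_elim (intro tendsto_intros)
  qed measurable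
  show "integrable M (\<lambda>\<omega>. (norm (Z \<omega>))\<^sup>2)"
    using le by (intro integrableI_bounded) (auto simp: le_less_trans)
qed

lemma integrable_tail:
  assumes int: "integrable M g" and nonneg: "\<And>x. 0 \<le> (g x :: real)" and "0 < e"
  shows "\<exists>K\<ge>0. (\<integral>\<^sup>+x. ennreal (g x - K) \<partial>M) \<le> ennreal e"
proof -
  have [measurable]: "g \<in> borel_measurable M"
    using int by auto
  have "(\<lambda>k. \<integral>\<^sup>+x. ennreal (g x - real k) \<partial>M) \<longlonglongrightarrow> (\<integral>\<^sup>+x. 0 \<partial>M)"
  proof (rule nn_integral_dominated_convergence[where w = "\<lambda>x. ennreal (g x)"])
    show "(\<integral>\<^sup>+x. ennreal (g x) \<partial>M) < \<infinity>"
      using int nonneg by (simp add: nn_integral_eq_integral)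
    have "(\<lambda>k. ennreal (g x - real k)) \<longlonglongrightarrow> 0" for x
    proof (rule tendsto_eventually)
      obtain k0 where k0: "g x \<le> real k0"
        using real_arch_simple by blast
      show "\<forall>\<^sub>F k in sequentially. ennreal (g x - real k) = 0"
        using eventually_ge_at_top[of k0] by eventually_elim (use k0 in \<open>auto intro!: ennreal_neg\<close>)
    qed
    then show "AE x in M. (\<lambda>k. ennreal (g x - real k)) \<longlonglongrightarrow> 0"
      by simp
  qed (auto intro!: ennreal_leI)
  then have "\<forall>\<^sub>F k in sequentially. (\<integral>\<^sup>+x. ennreal (g x - real k) \<partial>M) < ennreal e"
    using \<open>0 < e\<close> by (intro order_tendstoD) auto
  then obtain k where "(\<integral>\<^sup>+x. ennreal (g x - real k) \<partial>M) < ennreal e"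
    by (auto simp: eventually_sequentially)
  then show ?thesis
    by (intro exI[of _ "real k"]) auto
qed

text \<open>Bounded second moments of both factors would not make the products uniformly integrable.
  Young's inequality bounds |x . y| by |x|^2 / (2 a) + a |y|^2 / 2: the first term has a uniform
  tail because the law of \<open>X n\<close> is fixed, and the second is made small by
  \<open>a\<close>.\<close>

lemma (in prob_space) inner_limit:
  fixes X Y :: "nat \<Rightarrow> 'a \<Rightarrow> 'b::euclidean_space"
  assumes [measurable]: "\<And>n. X n \<in> borel_measurable M" "X' \<in> borel_measurable M"
      "\<And>n. Y n \<in> borel_measurable M" "Y' \<in> borel_measurable M"
    and lim: "AE \<omega> in M. (\<lambda>n. X n \<omega>) \<longlonglongrightarrow> X' \<omega>" "AE \<omega> in M. (\<lambda>n. Y n \<omega>) \<longlonglongrightarrow> Y' \<omega>"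
    and law: "\<And>n. distr M borel (X n) = \<nu>" and \<nu>: "\<nu> \<in> P2"
    and bound: "\<And>n. (\<integral>\<^sup>+\<omega>. ennreal ((norm (Y n \<omega>))\<^sup>2) \<partial>M) \<le> ennreal C"
  shows "(\<lambda>n. expectation (\<lambda>\<omega>. X n \<omega> \<bullet> Y n \<omega>)) \<longlonglongrightarrow> expectation (\<lambda>\<omega>. X' \<omega> \<bullet> Y' \<omega>)"
proof (rule Vitali_limit)
  show "AE \<omega> in M. (\<lambda>n. X n \<omega> \<bullet> Y n \<omega>) \<longlonglongrightarrow> X' \<omega> \<bullet> Y' \<omega>"
    using lim by eventually_elim (intro tendsto_intros)
  fix e :: real assume "0 < e"
  \<comment> \<open>With this \<open>a\<close> the second term of Young's inequality contributes at
    most e/2; the tail of the first takes the other half.\<close>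
  define a where "a = e / (\<bar>C\<bar> + 1)"
  have a: "0 < a" "a * \<bar>C\<bar> \<le> e"
    using \<open>0 < e\<close> unfolding a_def by (auto simp: field_simps)
  have "integrable \<nu> (\<lambda>x. (norm x)\<^sup>2 / (2 * a))"
    using P2_D[OF \<nu>] by simp
  then obtain K where K: "0 \<le> K" "(\<integral>\<^sup>+x. ennreal ((norm x)\<^sup>2 / (2 * a) - K) \<partial>\<nu>) \<le> ennreal (e / 2)"
    using integrable_tail[of \<nu> "\<lambda>x. (norm x)\<^sup>2 / (2 * a)" "e / 2"] a \<open>0 < e\<close> by auto
  have young: "\<bar>x \<bullet> y\<bar> \<le> (norm x)\<^sup>2 / (2 * a) + a / 2 * (norm y)\<^sup>2" for x y :: 'b
  proof -
    have "0 \<le> (norm x - a * norm y)\<^sup>2 / (2 * a)"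
      using a by simp
    also have "\<dots> = (norm x)\<^sup>2 / (2 * a) + a / 2 * (norm y)\<^sup>2 - norm x * norm y"
      using a by (simp add: field_simps power2_eq_square)
    finally show ?thesis
      using Cauchy_Schwarz_ineq2[of x y] by simp
  qed
  have "(\<integral>\<^sup>+\<omega>. ennreal (\<bar>X n \<omega> \<bullet> Y n \<omega>\<bar> - K) \<partial>M) \<le> ennreal e" for n
  proof -
    have "(\<integral>\<^sup>+\<omega>. ennreal (\<bar>X n \<omega> \<bullet> Y n \<omega>\<bar> - K) \<partial>M)
        \<le> (\<integral>\<^sup>+\<omega>. ennreal ((norm (X n \<omega>))\<^sup>2 / (2 * a) - K) + ennreal (a / 2) * ennreal ((norm (Y n \<omega>))\<^sup>2) \<partial>M)"
    proof (rule nn_integral_mono)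
      fix \<omega>
      have "ennreal (\<bar>X n \<omega> \<bullet> Y n \<omega>\<bar> - K) \<le> ennreal (max 0 ((norm (X n \<omega>))\<^sup>2 / (2 * a) - K) + a / 2 * (norm (Y n \<omega>))\<^sup>2)"
        using young[of "X n \<omega>" "Y n \<omega>"] by (intro ennreal_leI) linarith
      also have "\<dots> = ennreal ((norm (X n \<omega>))\<^sup>2 / (2 * a) - K) + ennreal (a / 2) * ennreal ((norm (Y n \<omega>))\<^sup>2)"
        using a by (subst ennreal_plus) (auto simp: ennreal_max_0 ennreal_mult'[symmetric])
      finally show "ennreal (\<bar>X n \<omega> \<bullet> Y n \<omega>\<bar> - K) \<le> \<dots>" .
    qed
    also have "\<dots> = (\<integral>\<^sup>+\<omega>. ennreal ((norm (X n \<omega>))\<^sup>2 / (2 * a) - K) \<partial>M)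
        + ennreal (a / 2) * (\<integral>\<^sup>+\<omega>. ennreal ((norm (Y n \<omega>))\<^sup>2) \<partial>M)"
      by (subst nn_integral_add, measurable) (simp add: nn_integral_cmult)
    also have "(\<integral>\<^sup>+\<omega>. ennreal ((norm (X n \<omega>))\<^sup>2 / (2 * a) - K) \<partial>M)
        = (\<integral>\<^sup>+x. ennreal ((norm x)\<^sup>2 / (2 * a) - K) \<partial>\<nu>)"
      unfolding law[of n, symmetric] by (rule nn_integral_distr[symmetric]) measurable
    also have "(\<integral>\<^sup>+x. ennreal ((norm x)\<^sup>2 / (2 * a) - K) \<partial>\<nu>)
        + ennreal (a / 2) * (\<integral>\<^sup>+\<omega>. ennreal ((norm (Y n \<omega>))\<^sup>2) \<partial>M) \<le> ennreal (e / 2) + ennreal (a / 2) * ennreal \<bar>C\<bar>"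
      by (intro add_mono K mult_left_mono order_trans[OF bound] ennreal_leI) auto
    also have "\<dots> = ennreal (e / 2 + a / 2 * \<bar>C\<bar>)"
      using a \<open>0 < e\<close> by (subst ennreal_plus) (auto simp: ennreal_mult'[symmetric])
    also have "\<dots> \<le> ennreal e"
      using a by (intro ennreal_leI) simp
    finally show ?thesis .
  qed
  then show "\<exists>K\<ge>0. \<forall>n. (\<integral>\<^sup>+\<omega>. ennreal (\<bar>X n \<omega> \<bullet> Y n \<omega>\<bar> - K) \<partial>M) \<le> ennreal e"
    using K(1) by blast
qed measurable

text \<open>The sequence to compare with is the constant one given by the identity on
  \<open>\<mu>\<close> itself.\<close>

lemma law_limit_const:
  fixes X :: "nat \<Rightarrow> 'a \<Rightarrow> 'b::euclidean_space"
  assumes M: "prob_space M" and X: "\<And>n. X n \<in> borel_measurable M" "Z \<in> borel_measurable M"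
    and lim: "AE \<omega> in M. (\<lambda>n. X n \<omega>) \<longlonglongrightarrow> Z \<omega>"
    and law: "\<And>n. distr M borel (X n) = \<mu>" and \<mu>: "\<mu> \<in> P2"
  shows "distr M borel Z = \<mu>"
proof -
  note P = P2_D[OF \<mu>]
  have id: "distr \<mu> borel (\<lambda>x. x) = \<mu>"
    using P(1) by (intro distr_id2) simp
  have mid: "(\<lambda>x. x) \<in> borel_measurable \<mu>"
    using P(1) by (simp add: measurable_ident_sets)
  have int: "integrable M (\<lambda>\<omega>. (norm (X n \<omega>))\<^sup>2)" for n
    using distr_in_P2_iff[OF M X(1)] law \<mu> by simp
  have "distr M borel Z = distr \<mu> borel (\<lambda>x. x)"
    by (rule law_limit_unique[OF M P(2) X mid mid lim, of "\<integral>x. (norm x)\<^sup>2 \<partial>\<mu>"])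
       (simp_all add: second_moment_eq[OF X(1) int] law id)
  then show ?thesis
    by (simp add: id)
qed

text \<open>Direct method: the marginals of a minimizing sequence are fixed, so the limit pair keeps
  them, and Fatou's lemma gives lower semicontinuity of the cost.\<close>

lemma opt_couplings_nonempty:
  fixes \<mu> \<nu> :: "'a::euclidean_space measure"
  assumes \<mu>: "\<mu> \<in> P2" and \<nu>: "\<nu> \<in> P2"
  shows "opt_couplings \<mu> \<nu> \<noteq> {}"
proof -
  let ?t = "transport_cost 2 \<mu> \<nu>"
  have "\<exists>\<gamma>\<in>couplings \<mu> \<nu>. plan_cost 2 \<gamma> < ?t + ennreal (1 / real (Suc n))" for n
  proof -
    have "?t < ?t + ennreal (1 / real (Suc n))"
      using transport_cost_finite[OF \<mu> \<nu>] by (cases ?t) (auto simp: ennreal_plus[symmetric] ennreal_less_iff simp del: ennreal_plus)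
    then show ?thesis
      unfolding transport_cost_def INF_less_iff .
  qed
  then obtain \<gamma> where \<gamma>: "\<And>n. \<gamma> n \<in> couplings \<mu> \<nu>"
      "\<And>n. plan_cost 2 (\<gamma> n) < ?t + ennreal (1 / real (Suc n))"
    by metis
  obtain r \<Omega> X Y X' Y' where r: "strict_mono (r :: nat \<Rightarrow> nat)" and \<Omega>: "prob_space (\<Omega> :: real measure)"
    and X [measurable]: "\<And>n. X n \<in> borel_measurable \<Omega>" and Y [measurable]: "\<And>n. Y n \<in> borel_measurable \<Omega>"
    and X' [measurable]: "X' \<in> borel_measurable \<Omega>" and Y' [measurable]: "Y' \<in> borel_measurable \<Omega>"
    and law: "\<And>n. distr \<Omega> borel (\<lambda>\<omega>. (X n \<omega>, Y n \<omega>)) = \<gamma> (r n)"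
    and laws: "\<And>n. distr \<Omega> borel (X n) = \<mu>" "\<And>n. distr \<Omega> borel (Y n) = \<nu>"
    and lim: "AE \<omega> in \<Omega>. (\<lambda>n. X n \<omega>) \<longlonglongrightarrow> X' \<omega>" "AE \<omega> in \<Omega>. (\<lambda>n. Y n \<omega>) \<longlonglongrightarrow> Y' \<omega>"
    by (rule couplings_limit[where \<mu> = "\<lambda>_. \<mu>" and \<nu> = "\<lambda>_. \<nu>", OF \<mu> \<nu> \<gamma>(1) order_refl order_refl])
      (rule that)
  have "distr \<Omega> borel X' = \<mu>" "distr \<Omega> borel Y' = \<nu>"
    using law_limit_const[OF \<Omega> X X' lim(1) laws(1) \<mu>] law_limit_const[OF \<Omega> Y Y' lim(2) laws(2) \<nu>]
    by simp_all
  then have mem: "distr \<Omega> borel (\<lambda>\<omega>. (X' \<omega>, Y' \<omega>)) \<in> couplings \<mu> \<nu>"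
    using pair_in_couplings[OF \<Omega> X' Y'] by simp
  have cost: "plan_cost 2 (distr \<Omega> borel (\<lambda>\<omega>. (U \<omega>, V \<omega>))) = (\<integral>\<^sup>+\<omega>. ennreal ((norm (U \<omega> - V \<omega>))\<^sup>2) \<partial>\<Omega>)"
    if [measurable]: "U \<in> borel_measurable \<Omega>" "V \<in> borel_measurable \<Omega>" for U V :: "real \<Rightarrow> 'a"
    using plan_cost_distr[OF that, of 2] by (simp add: powr_numeral)
  have "(\<integral>\<^sup>+\<omega>. ennreal ((norm (X' \<omega> - Y' \<omega>))\<^sup>2) \<partial>\<Omega>) \<le> ?t"
  proof (rule ennreal_le_epsilon)
    fix e :: real assume "0 < e"
    then obtain N where N: "1 / real (Suc N) < e"
      using nat_approx_posE by (metis of_nat_Suc)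
    show "(\<integral>\<^sup>+\<omega>. ennreal ((norm (X' \<omega> - Y' \<omega>))\<^sup>2) \<partial>\<Omega>) \<le> ?t + ennreal e"
    \<comment> \<open>Dropping the first \<open>N\<close> terms makes the bound hold for every
      index, which is the form in which the lemma takes it.\<close>
    proof (rule nn_integral_le_AE_tendsto[where f = "\<lambda>n \<omega>. ennreal ((norm (X (n + N) \<omega> - Y (n + N) \<omega>))\<^sup>2)"])
      show "AE \<omega> in \<Omega>. (\<lambda>n. ennreal ((norm (X (n + N) \<omega> - Y (n + N) \<omega>))\<^sup>2))
          \<longlonglongrightarrow> ennreal ((norm (X' \<omega> - Y' \<omega>))\<^sup>2)"
        using lim
      proof eventually_elim
        case (elim \<omega>)
        from this[THEN LIMSEQ_ignore_initial_segment, of N] show ?case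
          by (intro tendsto_intros)
      qed
      fix n
      have "1 / real (Suc (r (n + N))) \<le> 1 / real (Suc N)"
        using seq_suble[OF r, of "n + N"] by (intro divide_left_mono) auto
      then show "(\<integral>\<^sup>+\<omega>. ennreal ((norm (X (n + N) \<omega> - Y (n + N) \<omega>))\<^sup>2) \<partial>\<Omega>) \<le> ?t + ennreal e"
        unfolding cost[OF X Y, symmetric] law using N
        by (intro order_trans[OF less_imp_le[OF \<gamma>(2)]] add_left_mono ennreal_leI) simp
    qed measurable
  qed
  then have "plan_cost 2 (distr \<Omega> borel (\<lambda>\<omega>. (X' \<omega>, Y' \<omega>))) = ?t"
    using cost[OF X' Y'] mem unfolding transport_cost_def by (intro antisym INF_lower) auto
  then show ?thesis
    using mem by (auto simp: opt_couplings_def)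
qed

text \<open>
  Expanding the squares reduces the claim to limits of integrals of inner products: over the coupling
  of \<open>\<rho>\<close>, the law of \<open>Z\<close>, with \<open>\<mu> n\<close> given by \<open>(Z, X n)\<close>, which tends to the diagonal one, and over optimal
  couplings of \<open>\<nu>\<close> with \<open>\<mu> n\<close>, whose cluster points couple \<open>\<nu>\<close> with \<open>\<rho>\<close>. The inner products are uniformly
  integrable because the first marginal is fixed.
\<close>

lemma Opial:
  fixes X :: "nat \<Rightarrow> 'b \<Rightarrow> 'a::euclidean_space"
  assumes M: "prob_space M" and X [measurable]: "\<And>n. X n \<in> borel_measurable M" and Z [measurable]: "Z \<in> borel_measurable M"
    and lim: "AE \<omega> in M. (\<lambda>n. X n \<omega>) \<longlonglongrightarrow> Z \<omega>"
    and law: "\<And>n. distr M borel (X n) = \<mu> n"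
    and P2: "\<And>n. \<mu> n \<in> P2" and bound: "\<And>n. (\<integral>x. (norm x)\<^sup>2 \<partial>\<mu> n) \<le> C"
    and \<nu>: "\<nu> \<in> P2" and "0 < e"
  shows "\<forall>\<^sub>F n in sequentially.
    (W 2 \<nu> (distr M borel Z))\<^sup>2 + (W 2 (distr M borel Z) (\<mu> n))\<^sup>2 \<le> (W 2 \<nu> (\<mu> n))\<^sup>2 + e"
proof (rule ccontr)
  interpret M: prob_space M by fact
  define \<rho> where "\<rho> = distr M borel Z"
  define m2 :: "'a measure \<Rightarrow> real" where "m2 \<kappa> = (\<integral>x. (norm x)\<^sup>2 \<partial>\<kappa>)" for \<kappa>
  have iX: "integrable M (\<lambda>\<omega>. (norm (X n \<omega>))\<^sup>2)" for n
    using distr_in_P2_iff[OF M X] law P2 by simp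
  have bX: "(\<integral>\<^sup>+\<omega>. ennreal ((norm (X n \<omega>))\<^sup>2) \<partial>M) \<le> ennreal C" for n
    unfolding second_moment_eq(1)[OF X iX] law using bound by (rule ennreal_leI)
  have iZ: "integrable M (\<lambda>\<omega>. (norm (Z \<omega>))\<^sup>2)"
    by (rule second_moment_limit[OF X Z lim bX])
  have \<rho>: "\<rho> \<in> P2"
    unfolding \<rho>_def distr_in_P2_iff[OF M Z] by (rule iZ)
  assume "\<not> ?thesis"
  from not_eventually_sequentiallyD[OF this] obtain q :: "nat \<Rightarrow> nat" where "strict_mono q" and
      "\<forall>n. \<not> (W 2 \<nu> \<rho>)\<^sup>2 + (W 2 \<rho> (\<mu> (q n)))\<^sup>2 \<le> (W 2 \<nu> (\<mu> (q n)))\<^sup>2 + e"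
    unfolding \<rho>_def by blast
  then have q: "strict_mono q" "\<And>n. (W 2 \<nu> (\<mu> (q n)))\<^sup>2 + e < (W 2 \<nu> \<rho>)\<^sup>2 + (W 2 \<rho> (\<mu> (q n)))\<^sup>2"
    by (simp_all add: not_le)
  have "\<exists>\<gamma>. \<gamma> \<in> opt_couplings \<nu> (\<mu> (q n))" for n
    using opt_couplings_nonempty[OF \<nu> P2] by blast
  then obtain \<gamma> where \<gamma>: "\<And>n. \<gamma> n \<in> opt_couplings \<nu> (\<mu> (q n))"
    by metis
  then have \<gamma>': "\<gamma> n \<in> couplings \<nu> (\<mu> (q n))" for n
    by (auto simp: opt_couplings_def)
  obtain r \<Omega> V U V' U' where r: "strict_mono (r :: nat \<Rightarrow> nat)" and \<Omega>: "prob_space (\<Omega> :: real measure)"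
    and V [measurable]: "\<And>n. V n \<in> borel_measurable \<Omega>" and U [measurable]: "\<And>n. U n \<in> borel_measurable \<Omega>"
    and V' [measurable]: "V' \<in> borel_measurable \<Omega>" and U' [measurable]: "U' \<in> borel_measurable \<Omega>"
    and law_VU: "\<And>n. distr \<Omega> borel (\<lambda>\<omega>. (V n \<omega>, U n \<omega>)) = \<gamma> (r n)"
    and laws: "\<And>n. distr \<Omega> borel (V n) = \<nu>" "\<And>n. distr \<Omega> borel (U n) = \<mu> (q (r n))"
    and lims: "AE \<omega> in \<Omega>. (\<lambda>n. V n \<omega>) \<longlonglongrightarrow> V' \<omega>" "AE \<omega> in \<Omega>. (\<lambda>n. U n \<omega>) \<longlonglongrightarrow> U' \<omega>"
    by (rule couplings_limit[where \<mu> = "\<lambda>_. \<nu>" and \<nu> = "\<lambda>n. \<mu> (q n)", OF \<nu> P2 \<gamma>' order_refl bound])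
      (rule that)
  interpret \<Omega>: prob_space \<Omega> by fact
  have mono: "strict_mono (q \<circ> r)"
    using q(1) r by (rule strict_mono_o)
  have iV: "integrable \<Omega> (\<lambda>\<omega>. (norm (V n \<omega>))\<^sup>2)" for n
    using distr_in_P2_iff[OF \<Omega> V] laws \<nu> by simp
  have iU: "integrable \<Omega> (\<lambda>\<omega>. (norm (U n \<omega>))\<^sup>2)" for n
    using distr_in_P2_iff[OF \<Omega> U] laws P2 by simp
  have bU: "(\<integral>\<^sup>+\<omega>. ennreal ((norm (U n \<omega>))\<^sup>2) \<partial>\<Omega>) \<le> ennreal C" for n
    unfolding second_moment_eq(1)[OF U iU] laws using bound by (rule ennreal_leI)
  have law_V': "distr \<Omega> borel V' = \<nu>"
    by (rule law_limit_const[OF \<Omega> V V' lims(1) laws(1) \<nu>])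
  have lim_qr: "AE \<omega> in M. (\<lambda>n. X (q (r n)) \<omega>) \<longlonglongrightarrow> Z \<omega>"
    using lim by eventually_elim (use LIMSEQ_subseq_LIMSEQ[OF _ mono] in \<open>auto simp: comp_def\<close>)
  have law_U': "distr \<Omega> borel U' = \<rho>"
    unfolding \<rho>_def
    by (rule law_limit_unique[OF \<Omega> M U U' X Z lims(2) lim_qr bU]) (simp add: laws law)
  have iU': "integrable \<Omega> (\<lambda>\<omega>. (norm (U' \<omega>))\<^sup>2)" and iV': "integrable \<Omega> (\<lambda>\<omega>. (norm (V' \<omega>))\<^sup>2)"
    using distr_in_P2_iff[OF \<Omega> U'] distr_in_P2_iff[OF \<Omega> V'] law_U' law_V' \<nu> \<rho> by simp_all
  have "(\<lambda>n. M.expectation (\<lambda>\<omega>. Z \<omega> \<bullet> X (q (r n)) \<omega>)) \<longlonglongrightarrow> M.expectation (\<lambda>\<omega>. Z \<omega> \<bullet> Z \<omega>)"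
    using M.inner_limit[OF Z Z X Z _ lim_qr \<rho>_def[symmetric] \<rho> bX] by simp
  also have "M.expectation (\<lambda>\<omega>. Z \<omega> \<bullet> Z \<omega>) = m2 \<rho>"
    unfolding m2_def \<rho>_def second_moment_eq(2)[OF Z iZ, symmetric] by (simp add: power2_norm_eq_inner)
  finally have lim_M: "(\<lambda>n. M.expectation (\<lambda>\<omega>. Z \<omega> \<bullet> X (q (r n)) \<omega>)) \<longlonglongrightarrow> m2 \<rho>" .
  have lim_\<Omega>: "(\<lambda>n. \<Omega>.expectation (\<lambda>\<omega>. V n \<omega> \<bullet> U n \<omega>)) \<longlonglongrightarrow> \<Omega>.expectation (\<lambda>\<omega>. V' \<omega> \<bullet> U' \<omega>)"
    by (rule \<Omega>.inner_limit[OF V V' U U' lims laws(1) \<nu> bU])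
  \<comment> \<open>Arbitrary couplings suffice for the two distances on the smaller side of the
    claim; the distance on the larger side is computed exactly, from optimal plans.\<close>
  have upper_\<rho>: "(W 2 \<rho> (\<mu> k))\<^sup>2 \<le> m2 \<rho> + m2 (\<mu> k) - 2 * M.expectation (\<lambda>\<omega>. Z \<omega> \<bullet> X k \<omega>)" for k
    using W2_sq_le[OF M Z X iZ iX, of k] integral_norm_diff_sq[OF Z X iZ iX, of k]
      second_moment_eq(2)[OF Z iZ] second_moment_eq(2)[OF X iX, of k]
    by (simp add: law m2_def \<rho>_def)
  have upper_\<nu>: "(W 2 \<nu> \<rho>)\<^sup>2 \<le> m2 \<nu> + m2 \<rho> - 2 * \<Omega>.expectation (\<lambda>\<omega>. V' \<omega> \<bullet> U' \<omega>)"
    using W2_sq_le[OF \<Omega> V' U' iV' iU'] integral_norm_diff_sq[OF V' U' iV' iU']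
      second_moment_eq(2)[OF V' iV'] second_moment_eq(2)[OF U' iU']
    by (simp add: law_V' law_U' m2_def)
  have exact: "(W 2 \<nu> (\<mu> (q (r n))))\<^sup>2 = m2 \<nu> + m2 (\<mu> (q (r n))) - 2 * \<Omega>.expectation (\<lambda>\<omega>. V n \<omega> \<bullet> U n \<omega>)" for n
  proof -
    have "(W 2 \<nu> (\<mu> (q (r n))))\<^sup>2 = (\<integral>z. (norm (fst z - snd z))\<^sup>2 \<partial>distr \<Omega> borel (\<lambda>\<omega>. (V n \<omega>, U n \<omega>)))"
      unfolding law_VU by (rule opt_coupling_cost[OF \<nu> P2 \<gamma>])
    also have "\<dots> = (\<integral>\<omega>. (norm (V n \<omega> - U n \<omega>))\<^sup>2 \<partial>\<Omega>)"
      by (rule integral_plan_distr[OF V U])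
    finally show ?thesis
      using integral_norm_diff_sq[OF V U iV iU, of n n] second_moment_eq(2)[OF V iV, of n] second_moment_eq(2)[OF U iU, of n]
      by (simp add: laws m2_def)
  qed
  \<comment> \<open>The second moments of \<open>\<mu> (q (r n))\<close> and of \<open>\<nu>\<close>
    cancel, so the former may fail to converge; only inner products remain.\<close>
  have "e \<le> 2 * m2 \<rho> - 2 * \<Omega>.expectation (\<lambda>\<omega>. V' \<omega> \<bullet> U' \<omega>) - 2 * M.expectation (\<lambda>\<omega>. Z \<omega> \<bullet> X (q (r n)) \<omega>)
      + 2 * \<Omega>.expectation (\<lambda>\<omega>. V n \<omega> \<bullet> U n \<omega>)" for n
    using q(2)[of "r n"] upper_\<rho>[of "q (r n)"] upper_\<nu> exact[of n] by linarith
  moreover have "(\<lambda>n. 2 * m2 \<rho> - 2 * \<Omega>.expectation (\<lambda>\<omega>. V' \<omega> \<bullet> U' \<omega>) - 2 * M.expectation (\<lambda>\<omega>. Z \<omega> \<bullet> X (q (r n)) \<omega>)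
      + 2 * \<Omega>.expectation (\<lambda>\<omega>. V n \<omega> \<bullet> U n \<omega>)) \<longlonglongrightarrow>
      2 * m2 \<rho> - 2 * \<Omega>.expectation (\<lambda>\<omega>. V' \<omega> \<bullet> U' \<omega>) - 2 * m2 \<rho> + 2 * \<Omega>.expectation (\<lambda>\<omega>. V' \<omega> \<bullet> U' \<omega>)"
    by (intro tendsto_intros lim_M lim_\<Omega>)
  ultimately have "e \<le> 2 * m2 \<rho> - 2 * \<Omega>.expectation (\<lambda>\<omega>. V' \<omega> \<bullet> U' \<omega>) - 2 * m2 \<rho> + 2 * \<Omega>.expectation (\<lambda>\<omega>. V' \<omega> \<bullet> U' \<omega>)"
    by (intro LIMSEQ_le_const) auto
  then show False
    using \<open>0 < e\<close> by simp
qed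

text \<open>One representation yields all properties for the same subsequence and limit. For
  \<open>W p\<close>, the differences \<open>X n - Z\<close> tend to 0 with bounded second moments,
  and the \<open>p\<close>-th power of the norm is subquadratic.\<close>

theorem bounded_P2_subsequence:
  fixes \<mu> :: "nat \<Rightarrow> 'a::euclidean_space measure"
  assumes P2: "\<And>n. \<mu> n \<in> P2" and bound: "\<And>n. (\<integral>x. (norm x)\<^sup>2 \<partial>\<mu> n) \<le> C"
  obtains r \<rho> where "strict_mono (r :: nat \<Rightarrow> nat)" "\<rho> \<in> P2"
    "\<And>f. f \<in> C2w \<Longrightarrow> (\<lambda>n. \<integral>x. f x \<partial>\<mu> (r n)) \<longlonglongrightarrow> (\<integral>x. f x \<partial>\<rho>)"
    "\<And>p. p \<in> {1..<2} \<Longrightarrow> (\<lambda>n. W p (\<mu> (r n)) \<rho>) \<longlonglongrightarrow> 0"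
    "\<And>\<nu> e. \<nu> \<in> P2 \<Longrightarrow> 0 < e \<Longrightarrow> \<forall>\<^sub>F n in sequentially.
      (W 2 \<nu> \<rho>)\<^sup>2 + (W 2 \<rho> (\<mu> (r n)))\<^sup>2 \<le> (W 2 \<nu> (\<mu> (r n)))\<^sup>2 + e"
proof -
  have C: "0 \<le> C"
    using order_trans[OF _ bound[of 0]] by simp
  have moment: "(\<integral>\<^sup>+x. ennreal ((norm x)\<^sup>2) \<partial>\<mu> n) \<le> ennreal C" for n
    using bound[of n] P2_D[OF P2[of n]] by (simp add: nn_integral_eq_integral ennreal_leI)
  obtain r \<Omega> X Z where r: "strict_mono (r :: nat \<Rightarrow> nat)" and \<Omega>: "prob_space (\<Omega> :: real measure)"
    and X [measurable]: "\<And>n. X n \<in> borel_measurable \<Omega>" and Z [measurable]: "Z \<in> borel_measurable \<Omega>"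
    and law: "\<And>n. distr \<Omega> borel (X n) = \<mu> (r n)" and lim: "AE \<omega> in \<Omega>. (\<lambda>n. X n \<omega>) \<longlonglongrightarrow> Z \<omega>"
    using Skorokhod_subsequence[of \<mu> C] P2_D[OF P2] moment by blast
  interpret \<Omega>: prob_space \<Omega> by fact
  define \<rho> where "\<rho> = distr \<Omega> borel Z"
  have iX: "integrable \<Omega> (\<lambda>\<omega>. (norm (X n \<omega>))\<^sup>2)" for n
    using distr_in_P2_iff[OF \<Omega> X] law P2 by simp
  have bX: "(\<integral>\<^sup>+\<omega>. ennreal ((norm (X n \<omega>))\<^sup>2) \<partial>\<Omega>) \<le> ennreal C" for n
    unfolding second_moment_eq(1)[OF X iX] law using bound by (rule ennreal_leI)
  note Z_moment = second_moment_limit[OF X Z lim bX]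
  have \<rho>: "\<rho> \<in> P2"
    unfolding \<rho>_def distr_in_P2_iff[OF \<Omega> Z] by (rule Z_moment(2))
  show thesis
  proof (rule that[OF r \<rho>])
    fix f :: "'a \<Rightarrow> real" assume f: "f \<in> C2w"
    have [measurable]: "f \<in> borel_measurable borel"
      by (rule C2w_measurable[OF f])
    show "(\<lambda>n. \<integral>x. f x \<partial>\<mu> (r n)) \<longlonglongrightarrow> (\<integral>x. f x \<partial>\<rho>)"
      using \<Omega>.C2w_limit[OF X Z lim bX f] unfolding law[symmetric] \<rho>_def by (simp add: integral_distr)
  next
    fix p :: real assume p: "p \<in> {1..<2}"
    have diff_bound: "(\<integral>\<^sup>+\<omega>. ennreal ((norm (X n \<omega> - Z \<omega>))\<^sup>2) \<partial>\<Omega>) \<le> ennreal (4 * C)" for n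
    proof -
      have "(norm (x - z))\<^sup>2 \<le> 2 * (norm x)\<^sup>2 + 2 * (norm z)\<^sup>2" for x z :: 'a
        using norm_diff_sq[of x z] norm_diff_sq[of x "- z"] zero_le_power2[of "norm (x - - z)"] by simp
      then have "(\<integral>\<^sup>+\<omega>. ennreal ((norm (X n \<omega> - Z \<omega>))\<^sup>2) \<partial>\<Omega>)
          \<le> (\<integral>\<^sup>+\<omega>. ennreal (2 * (norm (X n \<omega>))\<^sup>2 + 2 * (norm (Z \<omega>))\<^sup>2) \<partial>\<Omega>)"
        by (intro nn_integral_mono ennreal_leI)
      also have "\<dots> = (\<integral>\<^sup>+\<omega>. 2 * ennreal ((norm (X n \<omega>))\<^sup>2) + 2 * ennreal ((norm (Z \<omega>))\<^sup>2) \<partial>\<Omega>)"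
        by (intro nn_integral_cong) (simp add: ennreal_mult)
      also have "\<dots> = 2 * (\<integral>\<^sup>+\<omega>. ennreal ((norm (X n \<omega>))\<^sup>2) \<partial>\<Omega>) + 2 * (\<integral>\<^sup>+\<omega>. ennreal ((norm (Z \<omega>))\<^sup>2) \<partial>\<Omega>)"
        by (subst nn_integral_add) (simp_all add: nn_integral_cmult)
      also have "\<dots> \<le> 2 * ennreal C + 2 * ennreal C"
        by (intro add_mono mult_left_mono bX Z_moment(1)) auto
      also have "\<dots> = ennreal (4 * C)"
        using C by (simp add: ennreal_mult flip: distrib_right)
      finally show ?thesis .
    qed
    have "AE \<omega> in \<Omega>. (\<lambda>n. X n \<omega> - Z \<omega>) \<longlonglongrightarrow> 0"
      using lim by eventually_elim (simp add: LIM_zero)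
    then have lim_p: "(\<lambda>n. \<Omega>.expectation (\<lambda>\<omega>. norm (X n \<omega> - Z \<omega>) powr p)) \<longlonglongrightarrow> 0"
      using \<Omega>.C2w_limit[of "\<lambda>n \<omega>. X n \<omega> - Z \<omega>" "\<lambda>_. 0", OF _ _ _ diff_bound norm_powr_in_C2w[of p]] p by simp
    have int: "integrable \<Omega> (\<lambda>\<omega>. norm (X n \<omega> - Z \<omega>) powr p)" for n
    proof (rule Bochner_Integration.integrable_bound[where f = "\<lambda>\<omega>. 1 + (norm (X n \<omega> - Z \<omega>))\<^sup>2"])
      show "integrable \<Omega> (\<lambda>\<omega>. 1 + (norm (X n \<omega> - Z \<omega>))\<^sup>2)"
        using integrable_norm_diff_sq[OF X Z iX Z_moment(2)] by simp
      have "t powr p \<le> 1 + t\<^sup>2" if "0 \<le> t" for t :: real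
      proof (cases "t \<le> 1")
        case True
        then show ?thesis
          using powr_le1[of p t] that p by (intro add_increasing2) auto
      next
        case False
        then have "t powr p \<le> t powr 2"
          using p by (intro powr_mono) auto
        then show ?thesis
          using False by (simp add: powr_numeral)
      qed
      then show "AE \<omega> in \<Omega>. norm (norm (X n \<omega> - Z \<omega>) powr p) \<le> norm (1 + (norm (X n \<omega> - Z \<omega>))\<^sup>2)"
        by (intro AE_I2) simp
    qed measurable
    have "enn2real (transport_cost p (\<mu> (r n)) \<rho>) \<le> \<Omega>.expectation (\<lambda>\<omega>. norm (X n \<omega> - Z \<omega>) powr p)" for n
    proof (rule enn2real_leI)
      show "transport_cost p (\<mu> (r n)) \<rho> \<le> ennreal (\<Omega>.expectation (\<lambda>\<omega>. norm (X n \<omega> - Z \<omega>) powr p))"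
        using transport_cost_le[OF \<Omega> X Z, of p n] int[of n]
        unfolding law \<rho>_def[symmetric] by (simp add: nn_integral_eq_integral)
    qed simp
    then have "(\<lambda>n. enn2real (transport_cost p (\<mu> (r n)) \<rho>)) \<longlonglongrightarrow> 0"
      by (intro tendsto_sandwich[OF _ _ tendsto_const lim_p]) (auto intro: always_eventually)
    then show "(\<lambda>n. W p (\<mu> (r n)) \<rho>) \<longlonglongrightarrow> 0"
      unfolding W_def by (rule tendsto_zero_powrI[OF _ tendsto_const]) (use p in auto)
  next
    fix \<nu> :: "'a measure" and e :: real
    assume "\<nu> \<in> P2" "0 < e"
    then show "\<forall>\<^sub>F n in sequentially.
      (W 2 \<nu> \<rho>)\<^sup>2 + (W 2 \<rho> (\<mu> (r n)))\<^sup>2 \<le> (W 2 \<nu> (\<mu> (r n)))\<^sup>2 + e"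
      unfolding \<rho>_def by (rule Opial[OF \<Omega> X Z lim law P2 bound])
  qed
qed

section \<open>Symmetry and definiteness of \<open>W 2\<close>, and control of second
  moments\<close>

lemma W2_commute:
  fixes \<mu> \<nu> :: "'a::euclidean_space measure"
  assumes "\<mu> \<in> P2" "\<nu> \<in> P2"
  shows "W 2 \<mu> \<nu> = W 2 \<nu> \<mu>"
proof -
  have "W 2 \<kappa> \<rho> \<le> W 2 \<rho> \<kappa>" if P2: "\<rho> \<in> P2" "\<kappa> \<in> P2" for \<rho> \<kappa> :: "'a measure"
  proof -
    obtain \<gamma> where \<gamma>: "\<gamma> \<in> opt_couplings \<rho> \<kappa>"
      using opt_couplings_nonempty[OF P2] by blast
    then have "\<gamma> \<in> couplings \<rho> \<kappa>"
      by (simp add: opt_couplings_def)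
    note g = coupling_facts[OF P2 this]
    have "(W 2 \<kappa> \<rho>)\<^sup>2 \<le> (\<integral>z. (norm (snd z - fst z))\<^sup>2 \<partial>\<gamma>)"
      using W2_sq_le[OF g(1,4,3,8,7)] by (simp add: g(5,6))
    also have "\<dots> = (W 2 \<rho> \<kappa>)\<^sup>2"
      by (simp add: opt_coupling_cost[OF P2 \<gamma>] norm_minus_commute)
    finally show ?thesis
      by (rule power2_le_imp_le) (rule W_nonneg)
  qed
  then show ?thesis
    using assms by (intro antisym)
qed

lemma W2_self:
  assumes "\<mu> \<in> P2"
  shows "W 2 \<mu> \<mu> = 0"
proof -
  note P = P2_D[OF assms]
  have m: "(\<lambda>x. x) \<in> borel_measurable \<mu>"
    using P(1) by (simp add: measurable_ident_sets)
  have "distr \<mu> borel (\<lambda>x. x) = \<mu>"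
    using P(1) by (intro distr_id2) simp
  then have "(W 2 \<mu> \<mu>)\<^sup>2 \<le> 0"
    using W2_sq_le[OF P(2) m m P(3) P(3)] by simp
  then show ?thesis
    by simp
qed

text \<open>An optimal plan of cost 0 is carried by the diagonal, where both projections
  agree.\<close>

lemma W2_eq_0_imp_eq:
  assumes P2: "\<mu> \<in> P2" "\<nu> \<in> P2" and eq: "W 2 \<mu> \<nu> = 0"
  shows "\<mu> = \<nu>"
proof -
  obtain \<gamma> where \<gamma>: "\<gamma> \<in> opt_couplings \<mu> \<nu>"
    using opt_couplings_nonempty[OF P2] by blast
  then have "\<gamma> \<in> couplings \<mu> \<nu>"
    by (simp add: opt_couplings_def)
  note g = coupling_facts[OF P2 this]
  have "(\<integral>z. (norm (fst z - snd z))\<^sup>2 \<partial>\<gamma>) = 0"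
    using opt_coupling_cost[OF P2 \<gamma>] eq by simp
  then have "AE z in \<gamma>. (norm (fst z - snd z))\<^sup>2 = 0"
    using integrable_norm_diff_sq[OF g(3,4,7,8)] by (simp add: integral_nonneg_eq_0_iff_AE)
  then have "distr \<gamma> borel fst = distr \<gamma> borel snd"
    using g(3,4) by (intro distr_cong_AE) auto
  then show ?thesis
    by (simp add: g(5,6))
qed

text \<open>Turns a bound on the distance to a fixed measure into the moment bound that compactness
  requires.\<close>

lemma second_moment_le:
  assumes P2: "\<mu> \<in> P2" "\<nu> \<in> P2"
  shows "(\<integral>x. (norm x)\<^sup>2 \<partial>\<mu>) \<le> 2 * (\<integral>x. (norm x)\<^sup>2 \<partial>\<nu>) + 2 * (W 2 \<mu> \<nu>)\<^sup>2"
proof -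
  obtain \<gamma> where \<gamma>: "\<gamma> \<in> opt_couplings \<mu> \<nu>"
    using opt_couplings_nonempty[OF P2] by blast
  then have "\<gamma> \<in> couplings \<mu> \<nu>"
    by (simp add: opt_couplings_def)
  note g = coupling_facts[OF P2 this]
  have "(norm x)\<^sup>2 \<le> 2 * (norm y)\<^sup>2 + 2 * (norm (x - y))\<^sup>2" for x y :: 'a
    using norm_diff_sq[of "x - y" y] norm_diff_sq[of "x - y" "- y"] zero_le_power2[of "norm (x - y - y)"]
    by simp
  then have "(\<integral>z. (norm (fst z))\<^sup>2 \<partial>\<gamma>) \<le> (\<integral>z. 2 * (norm (snd z))\<^sup>2 + 2 * (norm (fst z - snd z))\<^sup>2 \<partial>\<gamma>)"
    using g(7,8) integrable_norm_diff_sq[OF g(3,4,7,8)] by (intro integral_mono) auto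
  also have "\<dots> = 2 * (\<integral>z. (norm (snd z))\<^sup>2 \<partial>\<gamma>) + 2 * (W 2 \<mu> \<nu>)\<^sup>2"
    using g(7,8) integrable_norm_diff_sq[OF g(3,4,7,8)] by (simp add: opt_coupling_cost[OF P2 \<gamma>])
  finally show ?thesis
    by (simp add: second_moment_eq(2)[OF g(3,7)] second_moment_eq(2)[OF g(4,8)] g(5,6))
qed


section \<open>Generalized geodesics and proximal points\<close>

lemma generalized_geodesic_plan:
  fixes \<nu> \<mu>\<^sub>0 \<mu>\<^sub>1 :: "'a::euclidean_space measure"
  assumes gg: "generalized_geodesic \<nu> \<mu>\<^sub>0 \<mu>\<^sub>1 c" and P2: "\<nu> \<in> P2" "\<mu>\<^sub>0 \<in> P2" "\<mu>\<^sub>1 \<in> P2"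
  obtains M :: "('a \<times> 'a \<times> 'a) measure" and X Y Z where "prob_space M"
    "X \<in> borel_measurable M" "Y \<in> borel_measurable M" "Z \<in> borel_measurable M"
    "distr M borel X = \<nu>" "distr M borel Y = \<mu>\<^sub>0" "distr M borel Z = \<mu>\<^sub>1"
    "integrable M (\<lambda>\<omega>. (norm (X \<omega>))\<^sup>2)" "integrable M (\<lambda>\<omega>. (norm (Y \<omega>))\<^sup>2)"
    "integrable M (\<lambda>\<omega>. (norm (Z \<omega>))\<^sup>2)"
    "(W 2 \<mu>\<^sub>0 \<nu>)\<^sup>2 = (\<integral>\<omega>. (norm (X \<omega> - Y \<omega>))\<^sup>2 \<partial>M)" "(W 2 \<mu>\<^sub>1 \<nu>)\<^sup>2 = (\<integral>\<omega>. (norm (X \<omega> - Z \<omega>))\<^sup>2 \<partial>M)"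
    "\<And>t. t \<in> {0..1} \<Longrightarrow> c t = distr M borel (\<lambda>\<omega>. (1 - t) *\<^sub>R Y \<omega> + t *\<^sub>R Z \<omega>)"
proof -
  obtain \<gamma> :: "('a \<times> 'a \<times> 'a) measure" where sets: "sets \<gamma> = sets borel" and prob: "prob_space \<gamma>"
    and laws: "distr \<gamma> borel fst = \<nu>" "distr \<gamma> borel (\<lambda>\<omega>. fst (snd \<omega>)) = \<mu>\<^sub>0"
      "distr \<gamma> borel (\<lambda>\<omega>. snd (snd \<omega>)) = \<mu>\<^sub>1"
    and opt: "distr \<gamma> borel (\<lambda>\<omega>. (fst \<omega>, fst (snd \<omega>))) \<in> opt_couplings \<nu> \<mu>\<^sub>0"
      "distr \<gamma> borel (\<lambda>\<omega>. (fst \<omega>, snd (snd \<omega>))) \<in> opt_couplings \<nu> \<mu>\<^sub>1"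
    and c: "\<And>t. t \<in> {0..1} \<Longrightarrow> c t = distr \<gamma> borel (\<lambda>\<omega>. (1 - t) *\<^sub>R fst (snd \<omega>) + t *\<^sub>R snd (snd \<omega>))"
    using gg unfolding generalized_geodesic_def case_prod_beta' by auto
  have id: "(\<lambda>\<omega>. \<omega>) \<in> borel_measurable \<gamma>"
    using sets by (simp add: measurable_ident_sets)
  have X: "fst \<in> borel_measurable \<gamma>" and Y: "(\<lambda>\<omega>. fst (snd \<omega>)) \<in> borel_measurable \<gamma>"
    and Z: "(\<lambda>\<omega>. snd (snd \<omega>)) \<in> borel_measurable \<gamma>"
    using borel_measurable_fst[OF id] borel_measurable_fst[OF borel_measurable_snd[OF id]]
      borel_measurable_snd[OF borel_measurable_snd[OF id]] by simp_all
  have "(W 2 \<nu> \<mu>\<^sub>0)\<^sup>2 = (\<integral>\<omega>. (norm (fst \<omega> - fst (snd \<omega>)))\<^sup>2 \<partial>\<gamma>)"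
    "(W 2 \<nu> \<mu>\<^sub>1)\<^sup>2 = (\<integral>\<omega>. (norm (fst \<omega> - snd (snd \<omega>)))\<^sup>2 \<partial>\<gamma>)"
    unfolding opt_coupling_cost[OF P2(1,2) opt(1)] opt_coupling_cost[OF P2(1,3) opt(2)]
    by (rule integral_plan_distr[OF X Y] integral_plan_distr[OF X Z])+
  then show thesis
    using distr_in_P2_iff[OF prob X] distr_in_P2_iff[OF prob Y] distr_in_P2_iff[OF prob Z] P2
    by (intro that[OF prob X Y Z laws _ _ _ _ _ c]) (simp_all add: laws W2_commute)
qed

lemma norm_convex_combination_sq:
  fixes x y z :: "'a::real_inner"
  shows "(norm ((1 - s) *\<^sub>R y + s *\<^sub>R z - x))\<^sup>2
    = (1 - s) * (norm (x - y))\<^sup>2 + s * (norm (x - z))\<^sup>2 - s * (1 - s) * (norm (y - z))\<^sup>2"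
  by (simp add: power2_norm_eq_inner inner_add inner_diff inner_commute algebra_simps)

text \<open>The Hilbert space identity for convex combinations is integrated over the three-plan.
  Optimality of the two plans with the base makes the first two terms exact; the pair
  \<open>(Y, Z)\<close> is merely a coupling, but its cost carries a minus sign, so replacing it by
  the smaller squared distance goes in the right direction. The same identity with
  \<open>x = 0\<close> gives the finite second moment.\<close>

lemma generalized_geodesic_bound:
  fixes \<nu> \<mu>\<^sub>0 \<mu>\<^sub>1 :: "'a::euclidean_space measure"
  assumes gg: "generalized_geodesic \<nu> \<mu>\<^sub>0 \<mu>\<^sub>1 c" and P2: "\<nu> \<in> P2" "\<mu>\<^sub>0 \<in> P2" "\<mu>\<^sub>1 \<in> P2"
    and s: "s \<in> {0..1}"
  shows "c s \<in> P2"
    "(W 2 (c s) \<nu>)\<^sup>2 \<le> (1 - s) * (W 2 \<mu>\<^sub>0 \<nu>)\<^sup>2 + s * (W 2 \<mu>\<^sub>1 \<nu>)\<^sup>2 - s * (1 - s) * (W 2 \<mu>\<^sub>0 \<mu>\<^sub>1)\<^sup>2"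
proof -
  obtain M :: "('a \<times> 'a \<times> 'a) measure" and X Y Z where M: "prob_space M"
    and XYZ [measurable]: "X \<in> borel_measurable M" "Y \<in> borel_measurable M" "Z \<in> borel_measurable M"
    and laws: "distr M borel X = \<nu>" "distr M borel Y = \<mu>\<^sub>0" "distr M borel Z = \<mu>\<^sub>1"
    and int: "integrable M (\<lambda>\<omega>. (norm (X \<omega>))\<^sup>2)" "integrable M (\<lambda>\<omega>. (norm (Y \<omega>))\<^sup>2)"
      "integrable M (\<lambda>\<omega>. (norm (Z \<omega>))\<^sup>2)"
    and W: "(W 2 \<mu>\<^sub>0 \<nu>)\<^sup>2 = (\<integral>\<omega>. (norm (X \<omega> - Y \<omega>))\<^sup>2 \<partial>M)" "(W 2 \<mu>\<^sub>1 \<nu>)\<^sup>2 = (\<integral>\<omega>. (norm (X \<omega> - Z \<omega>))\<^sup>2 \<partial>M)"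
    and c: "\<And>t. t \<in> {0..1} \<Longrightarrow> c t = distr M borel (\<lambda>\<omega>. (1 - t) *\<^sub>R Y \<omega> + t *\<^sub>R Z \<omega>)"
    by (rule generalized_geodesic_plan[OF gg P2]) (rule that)
  define V where "V \<omega> = (1 - s) *\<^sub>R Y \<omega> + s *\<^sub>R Z \<omega>" for \<omega>
  have V [measurable]: "V \<in> borel_measurable M"
    unfolding V_def by measurable
  have cs: "c s = distr M borel V"
    using c[OF s] by (simp add: V_def[abs_def])
  have "(\<lambda>\<omega>. (norm (V \<omega>))\<^sup>2) = (\<lambda>\<omega>. (1 - s) * (norm (Y \<omega>))\<^sup>2 + s * (norm (Z \<omega>))\<^sup>2 - s * (1 - s) * (norm (Y \<omega> - Z \<omega>))\<^sup>2)"
    by (rule ext) (use norm_convex_combination_sq[where x = 0 and s = s] in \<open>simp add: V_def\<close>)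
  then have iV: "integrable M (\<lambda>\<omega>. (norm (V \<omega>))\<^sup>2)"
    using int integrable_norm_diff_sq[OF XYZ(2,3) int(2,3)] by simp
  then show "c s \<in> P2"
    unfolding cs distr_in_P2_iff[OF M V] .
  have "(W 2 (c s) \<nu>)\<^sup>2 \<le> (\<integral>\<omega>. (norm (V \<omega> - X \<omega>))\<^sup>2 \<partial>M)"
    using W2_sq_le[OF M V XYZ(1) iV int(1)] by (simp add: cs laws)
  also have "\<dots> = (1 - s) * (W 2 \<mu>\<^sub>0 \<nu>)\<^sup>2 + s * (W 2 \<mu>\<^sub>1 \<nu>)\<^sup>2 - s * (1 - s) * (\<integral>\<omega>. (norm (Y \<omega> - Z \<omega>))\<^sup>2 \<partial>M)"
    unfolding V_def norm_convex_combination_sq W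
    using integrable_norm_diff_sq[OF XYZ(2,3) int(2,3)] integrable_norm_diff_sq[OF XYZ(1,2) int(1,2)]
      integrable_norm_diff_sq[OF XYZ(1,3) int(1,3)] by simp
  also have "\<dots> \<le> (1 - s) * (W 2 \<mu>\<^sub>0 \<nu>)\<^sup>2 + s * (W 2 \<mu>\<^sub>1 \<nu>)\<^sup>2 - s * (1 - s) * (W 2 \<mu>\<^sub>0 \<mu>\<^sub>1)\<^sup>2"
    using W2_sq_le[OF M XYZ(2,3) int(2,3)] s by (intro diff_left_mono mult_left_mono) (auto simp: laws)
  finally show "(W 2 (c s) \<nu>)\<^sup>2 \<le> (1 - s) * (W 2 \<mu>\<^sub>0 \<nu>)\<^sup>2 + s * (W 2 \<mu>\<^sub>1 \<nu>)\<^sup>2 - s * (1 - s) * (W 2 \<mu>\<^sub>0 \<mu>\<^sub>1)\<^sup>2" .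
qed

text \<open>
  The coupling that carries a generalized geodesic takes the place of the gluing lemma in the
  triangle inequality.
\<close>

lemma W2_triangle_if_generalized_geodesic:
  fixes \<nu> \<mu>\<^sub>0 \<mu>\<^sub>1 :: "'a::euclidean_space measure"
  assumes gg: "generalized_geodesic \<nu> \<mu>\<^sub>0 \<mu>\<^sub>1 c" and P2: "\<nu> \<in> P2" "\<mu>\<^sub>0 \<in> P2" "\<mu>\<^sub>1 \<in> P2"
  shows "W 2 \<mu>\<^sub>0 \<mu>\<^sub>1 \<le> W 2 \<mu>\<^sub>0 \<nu> + W 2 \<mu>\<^sub>1 \<nu>"
proof -
  obtain M :: "('a \<times> 'a \<times> 'a) measure" and X Y Z where M: "prob_space M"
    and XYZ [measurable]: "X \<in> borel_measurable M" "Y \<in> borel_measurable M" "Z \<in> borel_measurable M"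
    and laws: "distr M borel X = \<nu>" "distr M borel Y = \<mu>\<^sub>0" "distr M borel Z = \<mu>\<^sub>1"
    and int: "integrable M (\<lambda>\<omega>. (norm (X \<omega>))\<^sup>2)" "integrable M (\<lambda>\<omega>. (norm (Y \<omega>))\<^sup>2)"
      "integrable M (\<lambda>\<omega>. (norm (Z \<omega>))\<^sup>2)"
    and W: "(W 2 \<mu>\<^sub>0 \<nu>)\<^sup>2 = (\<integral>\<omega>. (norm (X \<omega> - Y \<omega>))\<^sup>2 \<partial>M)" "(W 2 \<mu>\<^sub>1 \<nu>)\<^sup>2 = (\<integral>\<omega>. (norm (X \<omega> - Z \<omega>))\<^sup>2 \<partial>M)"
    and c: "\<And>t. t \<in> {0..1} \<Longrightarrow> c t = distr M borel (\<lambda>\<omega>. (1 - t) *\<^sub>R Y \<omega> + t *\<^sub>R Z \<omega>)"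
    by (rule generalized_geodesic_plan[OF gg P2]) (rule that)
  show ?thesis
  proof (rule field_le_epsilon)
    fix e :: real assume "0 < e"
    \<comment> \<open>Young's inequality with the weights \<open>b / a\<close> and
      \<open>a / b\<close> reproduces the square of the sum \<open>a + b\<close>; adding
      \<open>e / 2\<close> keeps both positive when a distance vanishes.\<close>
    define a where "a = W 2 \<mu>\<^sub>0 \<nu> + e / 2"
    define b where "b = W 2 \<mu>\<^sub>1 \<nu> + e / 2"
    have ab: "0 < a" "0 < b" "W 2 \<mu>\<^sub>0 \<nu> \<le> a" "W 2 \<mu>\<^sub>1 \<nu> \<le> b"
      using \<open>0 < e\<close> W_nonneg[of 2 \<mu>\<^sub>0 \<nu>] W_nonneg[of 2 \<mu>\<^sub>1 \<nu>] by (simp_all add: a_def b_def)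
    have young: "(norm (y - z))\<^sup>2 \<le> (1 + b / a) * (norm (x - y))\<^sup>2 + (1 + a / b) * (norm (x - z))\<^sup>2" for x y z :: 'a
    proof -
      have "0 \<le> (norm (b *\<^sub>R (x - y) + a *\<^sub>R (x - z)))\<^sup>2 / (a * b)"
        using ab by simp
      also have "\<dots> = b / a * (norm (x - y))\<^sup>2 + a / b * (norm (x - z))\<^sup>2 + 2 * ((x - y) \<bullet> (x - z))"
        unfolding power2_norm_eq_inner inner_add_left inner_add_right inner_scaleR_left inner_scaleR_right
          inner_commute[of "x - z" "x - y"]
        using ab by (simp add: divide_simps) (simp add: algebra_simps)
      also have "2 * ((x - y) \<bullet> (x - z)) = (norm (x - y))\<^sup>2 + (norm (x - z))\<^sup>2 - (norm (y - z))\<^sup>2"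
        by (simp add: power2_norm_eq_inner inner_diff inner_commute algebra_simps)
      finally show ?thesis
        by (simp add: algebra_simps)
    qed
    have "(W 2 \<mu>\<^sub>0 \<mu>\<^sub>1)\<^sup>2 \<le> (\<integral>\<omega>. (norm (Y \<omega> - Z \<omega>))\<^sup>2 \<partial>M)"
      using W2_sq_le[OF M XYZ(2,3) int(2,3)] by (simp add: laws)
    also have "\<dots> \<le> (\<integral>\<omega>. (1 + b / a) * (norm (X \<omega> - Y \<omega>))\<^sup>2 + (1 + a / b) * (norm (X \<omega> - Z \<omega>))\<^sup>2 \<partial>M)"
      using integrable_norm_diff_sq[OF XYZ(2,3) int(2,3)] integrable_norm_diff_sq[OF XYZ(1,2) int(1,2)]
        integrable_norm_diff_sq[OF XYZ(1,3) int(1,3)] by (intro integral_mono young) auto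
    also have "\<dots> = (1 + b / a) * (W 2 \<mu>\<^sub>0 \<nu>)\<^sup>2 + (1 + a / b) * (W 2 \<mu>\<^sub>1 \<nu>)\<^sup>2"
      unfolding W using integrable_norm_diff_sq[OF XYZ(1,2) int(1,2)]
        integrable_norm_diff_sq[OF XYZ(1,3) int(1,3)] by simp
    also have "\<dots> \<le> (1 + b / a) * a\<^sup>2 + (1 + a / b) * b\<^sup>2"
      using ab by (intro add_mono mult_left_mono power_mono W_nonneg) auto
    also have "\<dots> = (a + b)\<^sup>2"
      using ab by (simp add: field_simps power2_eq_square)
    finally have "W 2 \<mu>\<^sub>0 \<mu>\<^sub>1 \<le> a + b"
      by (rule power2_le_imp_le) (use ab in simp)
    then show "W 2 \<mu>\<^sub>0 \<mu>\<^sub>1 \<le> W 2 \<mu>\<^sub>0 \<nu> + W 2 \<mu>\<^sub>1 \<nu> + e"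
      by (simp add: a_def b_def)
  qed
qed

text \<open>Properness and the existence of a minimizer are condensed into an attained real minimum
  \<open>g\<^sub>0\<close>, so that every value bounded above by a real is itself real.\<close>

locale proximal_functional =
  fixes G :: "'a::euclidean_space measure \<Rightarrow> ereal" and g\<^sub>0 :: real
  assumes lsc: "lsc_W2 G"
    and conv: "convex_along_generalized_geodesics G"
    and lower: "\<And>\<nu>. \<nu> \<in> P2 \<Longrightarrow> ereal g\<^sub>0 \<le> G \<nu>"
    and attained: "\<exists>\<nu>\<in>P2. G \<nu> = ereal g\<^sub>0"
begin

text \<open>The convexity assumption on \<open>G\<close> supplies a generalized geodesic, and thus a
  three-plan, for any endpoints and base.\<close>

lemma W2_triangle:
  fixes \<mu> \<nu> \<rho> :: "'a measure"
  assumes "\<mu> \<in> P2" "\<nu> \<in> P2" "\<rho> \<in> P2"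
  shows "W 2 \<mu> \<rho> \<le> W 2 \<mu> \<nu> + W 2 \<nu> \<rho>"
proof -
  obtain c where "generalized_geodesic \<nu> \<mu> \<rho> c"
    using conv assms unfolding convex_along_generalized_geodesics_def by blast
  then show ?thesis
    using W2_triangle_if_generalized_geodesic[of \<nu> \<mu> \<rho> c] W2_commute[of \<rho> \<nu>] assms by simp
qed

lemma interpolant:
  assumes P2: "\<nu> \<in> P2" "\<mu>\<^sub>0 \<in> P2" "\<mu>\<^sub>1 \<in> P2" and G: "G \<mu>\<^sub>0 = ereal a" "G \<mu>\<^sub>1 = ereal b" and s: "s \<in> {0..1}"
  obtains \<rho> where "\<rho> \<in> P2" "G \<rho> \<le> ereal ((1 - s) * a + s * b)"
    "(W 2 \<rho> \<nu>)\<^sup>2 \<le> (1 - s) * (W 2 \<mu>\<^sub>0 \<nu>)\<^sup>2 + s * (W 2 \<mu>\<^sub>1 \<nu>)\<^sup>2 - s * (1 - s) * (W 2 \<mu>\<^sub>0 \<mu>\<^sub>1)\<^sup>2"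
proof -
  obtain c where c: "generalized_geodesic \<nu> \<mu>\<^sub>0 \<mu>\<^sub>1 c"
      "\<And>s. s \<in> {0..1} \<Longrightarrow> G (c s) \<le> ereal (1 - s) * G \<mu>\<^sub>0 + ereal s * G \<mu>\<^sub>1"
    using conv P2 unfolding convex_along_generalized_geodesics_def by blast
  show thesis
    using generalized_geodesic_bound[OF c(1) P2 s] c(2)[OF s] by (intro that[of "c s"]) (simp_all add: G)
qed

lemma finite_if_bounded:
  assumes "\<nu> \<in> P2" "G \<nu> \<le> ereal b"
  obtains a where "G \<nu> = ereal a" "g\<^sub>0 \<le> a" "a \<le> b"
  using lower[OF assms(1)] assms(2) by (cases "G \<nu>") auto

lemma lsc_limit:
  assumes "\<rho> \<in> P2" "\<And>n. \<nu> n \<in> P2" "(\<lambda>n. W 2 (\<nu> n) \<rho>) \<longlonglongrightarrow> 0" "c < G \<rho>"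
  shows "\<forall>\<^sub>F n in sequentially. c < G (\<nu> n)"
proof -
  obtain \<delta> where "\<delta> > 0" and \<delta>: "\<And>\<kappa>. \<kappa> \<in> P2 \<Longrightarrow> W 2 \<kappa> \<rho> < \<delta> \<Longrightarrow> c < G \<kappa>"
    using lsc assms(1,4) unfolding lsc_W2_def by blast
  from order_tendstoD(2)[OF assms(3) this(1)] show ?thesis
    by eventually_elim (intro \<delta> assms(2))
qed

text \<open>
  A minimizing sequence is Cauchy by strong convexity; its weak cluster point is a limit in \<open>W 2\<close> by
  the Opial property, so completeness of the Wasserstein space is not needed separately.
\<close>

lemma prox_exists:
  assumes "0 < \<tau>" and \<mu>: "\<mu> \<in> P2"
  shows "\<exists>\<rho>. is_arg_min (\<lambda>\<nu>. G \<nu> + ereal ((W 2 \<nu> \<mu>)\<^sup>2 / (2 * \<tau>))) (\<lambda>\<nu>. \<nu> \<in> P2) \<rho>"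
proof -
  define \<Phi> where "\<Phi> \<nu> = G \<nu> + ereal ((W 2 \<nu> \<mu>)\<^sup>2 / (2 * \<tau>))" for \<nu>
  obtain \<nu>s where \<nu>s: "\<nu>s \<in> P2" "G \<nu>s = ereal g\<^sub>0"
    using attained by blast
  have "ereal g\<^sub>0 \<le> (INF \<nu>\<in>P2. \<Phi> \<nu>)"
  proof (rule INF_greatest)
    fix \<nu> :: "'a measure" assume "\<nu> \<in> P2"
    then show "ereal g\<^sub>0 \<le> \<Phi> \<nu>"
      using add_mono[OF lower[of \<nu>], of 0 "ereal ((W 2 \<nu> \<mu>)\<^sup>2 / (2 * \<tau>))"] \<open>0 < \<tau>\<close> by (simp add: \<Phi>_def)
  qed
  moreover have "(INF \<nu>\<in>P2. \<Phi> \<nu>) \<le> \<Phi> \<nu>s"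
    using \<nu>s(1) by (rule INF_lower)
  ultimately obtain i where i: "(INF \<nu>\<in>P2. \<Phi> \<nu>) = ereal i"
    by (cases "INF \<nu>\<in>P2. \<Phi> \<nu>") (auto simp: \<Phi>_def \<nu>s(2))
  have i_le: "i \<le> x + (W 2 \<nu> \<mu>)\<^sup>2 / (2 * \<tau>)" if "\<nu> \<in> P2" "G \<nu> \<le> ereal x" for \<nu> x
  proof -
    have "ereal i \<le> \<Phi> \<nu>"
      unfolding i[symmetric] using that(1) by (rule INF_lower)
    also have "\<dots> \<le> ereal (x + (W 2 \<nu> \<mu>)\<^sup>2 / (2 * \<tau>))"
      unfolding \<Phi>_def using add_right_mono[OF that(2), of "ereal ((W 2 \<nu> \<mu>)\<^sup>2 / (2 * \<tau>))"] by simp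
    finally show ?thesis by simp
  qed
  have "\<exists>\<nu>\<in>P2. \<Phi> \<nu> < ereal (i + 1 / real (Suc k))" for k
    using i by (subst INF_less_iff[symmetric]) simp
  then obtain \<nu> where \<nu>: "\<And>k. \<nu> k \<in> P2" and \<Phi>\<nu>: "\<And>k. \<Phi> (\<nu> k) < ereal (i + 1 / real (Suc k))"
    by metis
  have "\<exists>a. G (\<nu> k) = ereal a" for k
    using \<Phi>\<nu>[of k] lower[OF \<nu>[of k]] unfolding \<Phi>_def by (cases "G (\<nu> k)") auto
  then obtain g where g: "\<And>k. G (\<nu> k) = ereal (g k)"
    by metis
  have g_less: "g k + (W 2 (\<nu> k) \<mu>)\<^sup>2 / (2 * \<tau>) < i + 1 / real (Suc k)" for k
    using \<Phi>\<nu>[of k] unfolding \<Phi>_def g by simp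
  \<comment> \<open>The objective at the midpoint is at least \<open>i\<close>, while strong
    convexity lowers it by a quarter of the squared distance over \<open>2 * \<tau>\<close>; solving
    for the distance leaves the factor \<open>4 * \<tau>\<close>.\<close>
  have cauchy: "(W 2 (\<nu> k) (\<nu> l))\<^sup>2 \<le> 4 * \<tau> * (1 / real (Suc k) + 1 / real (Suc l))" for k l
  proof -
    obtain \<rho> where \<rho>: "\<rho> \<in> P2" "G \<rho> \<le> ereal ((1 - 1/2) * g k + 1/2 * g l)"
      "(W 2 \<rho> \<mu>)\<^sup>2 \<le> (1 - 1/2) * (W 2 (\<nu> k) \<mu>)\<^sup>2 + 1/2 * (W 2 (\<nu> l) \<mu>)\<^sup>2 - 1/2 * (1 - 1/2) * (W 2 (\<nu> k) (\<nu> l))\<^sup>2"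
      using interpolant[OF \<mu> \<nu>[of k] \<nu>[of l] g g, where s = "1/2"] by auto
    have "(W 2 \<rho> \<mu>)\<^sup>2 / (2 * \<tau>) \<le> ((1 - 1/2) * (W 2 (\<nu> k) \<mu>)\<^sup>2 + 1/2 * (W 2 (\<nu> l) \<mu>)\<^sup>2 - 1/2 * (1 - 1/2) * (W 2 (\<nu> k) (\<nu> l))\<^sup>2) / (2 * \<tau>)"
      using \<rho>(3) \<open>0 < \<tau>\<close> by (intro divide_right_mono) auto
    also have "\<dots> = 1/2 * ((W 2 (\<nu> k) \<mu>)\<^sup>2 / (2 * \<tau>)) + 1/2 * ((W 2 (\<nu> l) \<mu>)\<^sup>2 / (2 * \<tau>)) - (W 2 (\<nu> k) (\<nu> l))\<^sup>2 / (8 * \<tau>)"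
      using \<open>0 < \<tau>\<close> by (simp add: field_simps)
    finally have "(W 2 (\<nu> k) (\<nu> l))\<^sup>2 / (8 * \<tau>) \<le> 1/2 * (1 / real (Suc k) + 1 / real (Suc l))"
      using i_le[OF \<rho>(1,2)] g_less[of k] g_less[of l] by argo
    moreover have "x \<le> 4 * \<tau> * t" if "x / (8 * \<tau>) \<le> 1/2 * t" for x t
      using that \<open>0 < \<tau>\<close> by (simp add: pos_divide_le_eq algebra_simps)
    ultimately show ?thesis
      by blast
  qed
  have moment: "(\<integral>x. (norm x)\<^sup>2 \<partial>\<nu> k) \<le> 2 * (\<integral>x. (norm x)\<^sup>2 \<partial>\<mu>) + 4 * \<tau> * (i + 1 - g\<^sub>0)" for k
  proof -
    have "g\<^sub>0 \<le> g k"
      using lower[OF \<nu>[of k]] by (simp add: g)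
    moreover have "1 / real (Suc k) \<le> 1"
      by simp
    ultimately have "(W 2 (\<nu> k) \<mu>)\<^sup>2 / (2 * \<tau>) \<le> i + 1 - g\<^sub>0"
      using g_less[of k] by linarith
    then have "(W 2 (\<nu> k) \<mu>)\<^sup>2 \<le> (i + 1 - g\<^sub>0) * (2 * \<tau>)"
      using \<open>0 < \<tau>\<close> by (subst (asm) pos_divide_le_eq) auto
    then show ?thesis
      using second_moment_le[OF \<nu> \<mu>, of k] by (simp add: algebra_simps)
  qed
  obtain r \<rho> where r: "strict_mono (r :: nat \<Rightarrow> nat)" and \<rho>: "\<rho> \<in> P2"
    and opial: "\<And>\<kappa> e. \<kappa> \<in> P2 \<Longrightarrow> 0 < e \<Longrightarrow> \<forall>\<^sub>F n in sequentially.
      (W 2 \<kappa> \<rho>)\<^sup>2 + (W 2 \<rho> (\<nu> (r n)))\<^sup>2 \<le> (W 2 \<kappa> (\<nu> (r n)))\<^sup>2 + e"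
    by (rule bounded_P2_subsequence[OF \<nu> moment]) (rule that)
  have inv: "(\<lambda>k. 4 * \<tau> * (1 / real (Suc k))) \<longlonglongrightarrow> 0"
    using tendsto_mult_right_zero[OF LIMSEQ_Suc[OF lim_1_over_n], of "4 * \<tau>"] by simp
  \<comment> \<open>With \<open>\<nu> k\<close> as test measure the Opial inequality acts as weak
    lower semicontinuity of the distance, so the Cauchy estimate passes to the limit in its second
    index.\<close>
  have close: "(W 2 (\<nu> k) \<rho>)\<^sup>2 \<le> 4 * \<tau> * (1 / real (Suc k))" for k
  proof (rule field_le_epsilon)
    fix e :: real assume "0 < e"
    have "\<forall>\<^sub>F n in sequentially. 4 * \<tau> * (1 / real (Suc (r n))) < e / 2"
      using order_tendstoD(2)[OF LIMSEQ_subseq_LIMSEQ[OF inv r], of "e / 2"] \<open>0 < e\<close> by (simp add: comp_def)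
    with opial[OF \<nu>[of k], of "e / 2"] have "\<forall>\<^sub>F n in sequentially.
        (W 2 (\<nu> k) \<rho>)\<^sup>2 + (W 2 \<rho> (\<nu> (r n)))\<^sup>2 \<le> (W 2 (\<nu> k) (\<nu> (r n)))\<^sup>2 + e / 2
        \<and> 4 * \<tau> * (1 / real (Suc (r n))) < e / 2"
      using \<open>0 < e\<close> by (simp add: eventually_conj)
    then obtain n where n: "(W 2 (\<nu> k) \<rho>)\<^sup>2 + (W 2 \<rho> (\<nu> (r n)))\<^sup>2 \<le> (W 2 (\<nu> k) (\<nu> (r n)))\<^sup>2 + e / 2"
        "4 * \<tau> * (1 / real (Suc (r n))) < e / 2"
      using eventually_happens'[OF sequentially_bot] by blast
    have "0 \<le> (W 2 \<rho> (\<nu> (r n)))\<^sup>2"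
      by simp
    then show "(W 2 (\<nu> k) \<rho>)\<^sup>2 \<le> 4 * \<tau> * (1 / real (Suc k)) + e"
      using n cauchy[of k "r n"] unfolding distrib_left by linarith
  qed
  have "(\<lambda>k. (W 2 (\<nu> k) \<rho>)\<^sup>2) \<longlonglongrightarrow> 0"
    by (rule tendsto_sandwich[OF _ _ tendsto_const inv]) (use close in \<open>auto intro: always_eventually\<close>)
  from tendsto_real_sqrt[OF this] have W\<rho>: "(\<lambda>k. W 2 (\<nu> k) \<rho>) \<longlonglongrightarrow> 0"
    by (simp add: W_nonneg)
  have "(\<lambda>k. W 2 (\<nu> k) \<mu>) \<longlonglongrightarrow> W 2 \<rho> \<mu>"
  proof (rule Lim_transform[OF tendsto_const], rule Lim_null_comparison[OF _ W\<rho>], intro always_eventually allI)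
    fix k
    show "norm (W 2 (\<nu> k) \<mu> - W 2 \<rho> \<mu>) \<le> W 2 (\<nu> k) \<rho>"
      using W2_triangle[OF \<rho> \<nu>[of k] \<mu>] W2_triangle[OF \<nu>[of k] \<rho> \<mu>] W2_commute[OF \<rho> \<nu>[of k]] by simp
  qed
  then have lim: "(\<lambda>k. i + 1 / real (Suc k) - (W 2 (\<nu> k) \<mu>)\<^sup>2 / (2 * \<tau>)) \<longlonglongrightarrow> i + 0 - (W 2 \<rho> \<mu>)\<^sup>2 / (2 * \<tau>)"
    using \<open>0 < \<tau>\<close> LIMSEQ_Suc[OF lim_1_over_n] by (intro tendsto_intros) simp_all
  \<comment> \<open>The minimizing sequence now converges in \<open>W 2\<close>, so lower
    semicontinuity of \<open>G\<close> applies to it.\<close>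
  have "G \<rho> \<le> ereal (i - (W 2 \<rho> \<mu>)\<^sup>2 / (2 * \<tau>))"
  proof (rule ccontr)
    assume "\<not> ?thesis"
    then obtain c where c: "i - (W 2 \<rho> \<mu>)\<^sup>2 / (2 * \<tau>) < c" "ereal c < G \<rho>"
      using ereal_dense2[of "ereal (i - (W 2 \<rho> \<mu>)\<^sup>2 / (2 * \<tau>))" "G \<rho>"] by (auto simp: not_le)
    have "\<forall>\<^sub>F k in sequentially. c < i + 1 / real (Suc k) - (W 2 (\<nu> k) \<mu>)\<^sup>2 / (2 * \<tau>)"
      using lsc_limit[OF \<rho> \<nu> W\<rho> c(2)]
    proof eventually_elim
      case (elim k)
      then show ?case
        using g_less[of k] by (simp add: g)
    qed
    then have "c \<le> i + 0 - (W 2 \<rho> \<mu>)\<^sup>2 / (2 * \<tau>)"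
      by (intro tendsto_lowerbound[OF lim]) (auto elim: eventually_mono)
    then show False
      using c(1) by simp
  qed
  then have "\<Phi> \<rho> \<le> ereal (i - (W 2 \<rho> \<mu>)\<^sup>2 / (2 * \<tau>)) + ereal ((W 2 \<rho> \<mu>)\<^sup>2 / (2 * \<tau>))"
    unfolding \<Phi>_def by (rule add_right_mono)
  then have "\<Phi> \<rho> \<le> \<Phi> \<kappa>" if "\<kappa> \<in> P2" for \<kappa>
    using INF_lower[OF that, of \<Phi>] by (simp add: i)
  then show ?thesis
    using \<rho> unfolding is_arg_min_def \<Phi>_def[symmetric] by (auto simp: not_less)
qed

lemma J_is_arg_min:
  assumes "0 < \<tau>" "\<mu> \<in> P2"
  shows "is_arg_min (\<lambda>\<nu>. G \<nu> + ereal ((W 2 \<nu> \<mu>)\<^sup>2 / (2 * \<tau>))) (\<lambda>\<nu>. \<nu> \<in> P2) (J G \<tau> \<mu>)"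
  unfolding J_def arg_min_def using prox_exists[OF assms] by (rule someI_ex)

text \<open>The proximal point is compared with the interpolant at parameter \<open>s\<close>
  towards \<open>\<nu>\<close>, based at \<open>\<mu>\<close>. After division by \<open>s\<close>
  the factor \<open>s * (1 - s)\<close> of the squared distance becomes \<open>1 - s\<close>, which
  tends to 1 as \<open>s\<close> tends to 0.\<close>

lemma J_variational:
  assumes "0 < \<tau>" and \<mu>: "\<mu> \<in> P2"
  obtains a where "J G \<tau> \<mu> \<in> P2" "G (J G \<tau> \<mu>) = ereal a" "g\<^sub>0 \<le> a"
    "\<And>\<nu> b. \<nu> \<in> P2 \<Longrightarrow> G \<nu> = ereal b \<Longrightarrow>
      2 * \<tau> * a + (W 2 (J G \<tau> \<mu>) \<mu>)\<^sup>2 + (W 2 (J G \<tau> \<mu>) \<nu>)\<^sup>2 \<le> 2 * \<tau> * b + (W 2 \<nu> \<mu>)\<^sup>2"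
proof -
  define \<rho> where "\<rho> = J G \<tau> \<mu>"
  have \<rho>: "\<rho> \<in> P2"
    using J_is_arg_min[OF assms] unfolding \<rho>_def is_arg_min_def by blast
  have min: "G \<rho> + ereal ((W 2 \<rho> \<mu>)\<^sup>2 / (2 * \<tau>)) \<le> G \<nu> + ereal ((W 2 \<nu> \<mu>)\<^sup>2 / (2 * \<tau>))" if "\<nu> \<in> P2" for \<nu>
    using J_is_arg_min[OF assms] that unfolding \<rho>_def is_arg_min_def by (auto simp: not_less)
  obtain \<nu>s where \<nu>s: "\<nu>s \<in> P2" "G \<nu>s = ereal g\<^sub>0"
    using attained by blast
  obtain a where a: "G \<rho> = ereal a" "g\<^sub>0 \<le> a"
    using min[OF \<nu>s(1)] lower[OF \<rho>] \<nu>s by (cases "G \<rho>") auto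
  have "2 * \<tau> * a + (W 2 \<rho> \<mu>)\<^sup>2 + (W 2 \<rho> \<nu>)\<^sup>2 \<le> 2 * \<tau> * b + (W 2 \<nu> \<mu>)\<^sup>2" if \<nu>: "\<nu> \<in> P2" "G \<nu> = ereal b" for \<nu> b
  proof (rule field_le_epsilon)
    fix e :: real assume "0 < e"
    define w where "w = (W 2 \<rho> \<nu>)\<^sup>2"
    \<comment> \<open>In place of the limit in \<open>s\<close>: this value bounds the lost term
      \<open>s * w\<close> by \<open>e\<close>.\<close>
    define s where "s = min 1 (e / (w + 1))"
    have "0 \<le> w"
      by (simp add: w_def)
    then have s: "0 < s" "s \<le> 1" "s * w \<le> e"
    proof -
      show "0 < s" "s \<le> 1"
        using \<open>0 < e\<close> \<open>0 \<le> w\<close> by (auto simp: s_def)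
      have "s * w \<le> e / (w + 1) * (w + 1)"
        using \<open>0 \<le> w\<close> \<open>0 < e\<close> by (intro mult_mono) (auto simp: s_def)
      then show "s * w \<le> e"
        using \<open>0 \<le> w\<close> by simp
    qed
    obtain \<kappa> where \<kappa>: "\<kappa> \<in> P2" "G \<kappa> \<le> ereal ((1 - s) * a + s * b)"
        "(W 2 \<kappa> \<mu>)\<^sup>2 \<le> (1 - s) * (W 2 \<rho> \<mu>)\<^sup>2 + s * (W 2 \<nu> \<mu>)\<^sup>2 - s * (1 - s) * (W 2 \<rho> \<nu>)\<^sup>2"
      using interpolant[OF \<mu> \<rho> \<nu>(1) a(1) \<nu>(2), where s = s] s by auto
    obtain k where k: "G \<kappa> = ereal k" "k \<le> (1 - s) * a + s * b"
      using finite_if_bounded[OF \<kappa>(1,2)] by metis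
    have "a + (W 2 \<rho> \<mu>)\<^sup>2 / (2 * \<tau>) \<le> k + (W 2 \<kappa> \<mu>)\<^sup>2 / (2 * \<tau>)"
      using min[OF \<kappa>(1)] by (simp add: a k)
    from mult_left_mono[OF this, of "2 * \<tau>"]
    have "2 * \<tau> * a + (W 2 \<rho> \<mu>)\<^sup>2 \<le> 2 * \<tau> * k + (W 2 \<kappa> \<mu>)\<^sup>2"
      using \<open>0 < \<tau>\<close> by (simp add: distrib_left)
    also have "\<dots> \<le> 2 * \<tau> * ((1 - s) * a + s * b)
        + ((1 - s) * (W 2 \<rho> \<mu>)\<^sup>2 + s * (W 2 \<nu> \<mu>)\<^sup>2 - s * (1 - s) * (W 2 \<rho> \<nu>)\<^sup>2)"
      using k(2) \<kappa>(3) \<open>0 < \<tau>\<close> by (intro add_mono mult_left_mono) auto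
    finally have "s * (2 * \<tau> * a + (W 2 \<rho> \<mu>)\<^sup>2 + w - s * w) \<le> s * (2 * \<tau> * b + (W 2 \<nu> \<mu>)\<^sup>2)"
      by (simp add: w_def algebra_simps)
    then have "2 * \<tau> * a + (W 2 \<rho> \<mu>)\<^sup>2 + w - s * w \<le> 2 * \<tau> * b + (W 2 \<nu> \<mu>)\<^sup>2"
      using s(1) by simp
    then show "2 * \<tau> * a + (W 2 \<rho> \<mu>)\<^sup>2 + (W 2 \<rho> \<nu>)\<^sup>2 \<le> 2 * \<tau> * b + (W 2 \<nu> \<mu>)\<^sup>2 + e"
      using s(3) by (simp add: w_def)
  qed
  then show thesis
    using \<rho> a unfolding \<rho>_def by (intro that)
qed

text \<open>Testing the inequality for \<open>J\<close> with \<open>\<mu>'\<close> and comparing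
  with the step condition leaves \<open>W 2 \<mu>' \<rho> \<le> \<epsilon>\<close> for the proximal
  point \<open>\<rho>\<close>, and estimates for \<open>\<rho>\<close> then carry over to
  \<open>\<mu>'\<close>. Descent is stated only for finite \<open>G \<mu>\<close>, since the initial
  measure may have infinite value.\<close>

lemma inexact_step:
  assumes "0 < \<tau>" "0 \<le> \<epsilon>" and \<mu>: "\<mu> \<in> P2" and \<mu>': "\<mu>' \<in> P2"
    and step: "G \<mu>' + ereal ((W 2 \<mu>' \<mu>)\<^sup>2 / (2 * \<tau>)) \<le> G (J G \<tau> \<mu>) + ereal ((W 2 (J G \<tau> \<mu>) \<mu>)\<^sup>2 / (2 * \<tau>))
      + ereal (\<epsilon>\<^sup>2 / (2 * \<tau>))"
  obtains a where "G \<mu>' = ereal a" "g\<^sub>0 \<le> a"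
    "\<And>b. G \<mu> = ereal b \<Longrightarrow> a \<le> b + \<epsilon>\<^sup>2 / (2 * \<tau>)"
    "\<And>\<nu>. \<nu> \<in> P2 \<Longrightarrow> G \<nu> = ereal g\<^sub>0 \<Longrightarrow> W 2 \<mu>' \<nu> \<le> W 2 \<mu> \<nu> + \<epsilon>"
    "\<And>\<nu>. \<nu> \<in> P2 \<Longrightarrow> G \<nu> = ereal g\<^sub>0 \<Longrightarrow>
      2 * \<tau> * (a - g\<^sub>0) \<le> (W 2 \<mu> \<nu>)\<^sup>2 - (W 2 \<mu>' \<nu>)\<^sup>2 + 2 * \<epsilon> * W 2 \<mu>' \<nu> + \<epsilon>\<^sup>2"
proof -
  define \<rho> where "\<rho> = J G \<tau> \<mu>"
  obtain h where \<rho>: "\<rho> \<in> P2" and h: "G \<rho> = ereal h" "g\<^sub>0 \<le> h"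
    and var: "\<And>\<nu> b. \<nu> \<in> P2 \<Longrightarrow> G \<nu> = ereal b \<Longrightarrow>
      2 * \<tau> * h + (W 2 \<rho> \<mu>)\<^sup>2 + (W 2 \<rho> \<nu>)\<^sup>2 \<le> 2 * \<tau> * b + (W 2 \<nu> \<mu>)\<^sup>2"
    by (rule J_variational[OF \<open>0 < \<tau>\<close> \<mu>, folded \<rho>_def]) (rule that)
  obtain a where a: "G \<mu>' = ereal a" "g\<^sub>0 \<le> a"
    using step lower[OF \<mu>'] h unfolding \<rho>_def[symmetric] by (cases "G \<mu>'") auto
  have "a + (W 2 \<mu>' \<mu>)\<^sup>2 / (2 * \<tau>) \<le> h + (W 2 \<rho> \<mu>)\<^sup>2 / (2 * \<tau>) + \<epsilon>\<^sup>2 / (2 * \<tau>)"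
    using step unfolding \<rho>_def[symmetric] by (simp add: a h)
  from mult_left_mono[OF this, of "2 * \<tau>"]
  have le: "2 * \<tau> * a + (W 2 \<mu>' \<mu>)\<^sup>2 \<le> 2 * \<tau> * h + (W 2 \<rho> \<mu>)\<^sup>2 + \<epsilon>\<^sup>2"
    using \<open>0 < \<tau>\<close> by (simp add: distrib_left)
  have "(W 2 \<rho> \<mu>')\<^sup>2 \<le> \<epsilon>\<^sup>2"
    using le var[OF \<mu>' a(1)] by linarith
  then have close: "W 2 \<mu>' \<rho> \<le> \<epsilon>"
    unfolding W2_commute[OF \<rho> \<mu>'] using \<open>0 \<le> \<epsilon>\<close> by (rule power2_le_imp_le)
  have near: "W 2 \<mu>' \<nu> \<le> \<epsilon> + W 2 \<rho> \<nu>" if "\<nu> \<in> P2" for \<nu>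
    using W2_triangle[OF \<mu>' \<rho> that] close by simp
  show thesis
  proof (rule that[OF a])
    fix b assume b: "G \<mu> = ereal b"
    have "2 * \<tau> * h + (W 2 \<rho> \<mu>)\<^sup>2 + (W 2 \<rho> \<mu>)\<^sup>2 \<le> 2 * \<tau> * b"
      using var[OF \<mu> b] by (simp add: W2_self[OF \<mu>])
    then have "2 * \<tau> * a \<le> 2 * \<tau> * b + \<epsilon>\<^sup>2"
      using le zero_le_power2[of "W 2 \<mu>' \<mu>"] zero_le_power2[of "W 2 \<rho> \<mu>"] by linarith
    then show "a \<le> b + \<epsilon>\<^sup>2 / (2 * \<tau>)"
      using \<open>0 < \<tau>\<close> by (simp add: field_simps)
  next
    fix \<nu> assume \<nu>: "\<nu> \<in> P2" "G \<nu> = ereal g\<^sub>0"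
    have "2 * \<tau> * g\<^sub>0 \<le> 2 * \<tau> * h"
      using h(2) \<open>0 < \<tau>\<close> by simp
    then have "(W 2 \<rho> \<nu>)\<^sup>2 \<le> (W 2 \<nu> \<mu>)\<^sup>2"
      using var[OF \<nu>] zero_le_power2[of "W 2 \<rho> \<mu>"] by linarith
    then have "W 2 \<rho> \<nu> \<le> W 2 \<mu> \<nu>"
      unfolding W2_commute[OF \<nu>(1) \<mu>] by (rule power2_le_imp_le) (rule W_nonneg)
    then show "W 2 \<mu>' \<nu> \<le> W 2 \<mu> \<nu> + \<epsilon>"
      using near[OF \<nu>(1)] by simp
    \<comment> \<open>Squaring \<open>W 2 \<mu>' \<nu> - \<epsilon> \<le> W 2 \<rho> \<nu>\<close>
      requires a nonnegative left side; otherwise the error term alone dominates.\<close>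
    have "(W 2 \<mu>' \<nu>)\<^sup>2 \<le> (W 2 \<rho> \<nu>)\<^sup>2 + 2 * \<epsilon> * W 2 \<mu>' \<nu>"
    proof (cases "W 2 \<mu>' \<nu> \<le> \<epsilon>")
      case True
      then have "W 2 \<mu>' \<nu> * W 2 \<mu>' \<nu> \<le> 2 * \<epsilon> * W 2 \<mu>' \<nu>"
        using \<open>0 \<le> \<epsilon>\<close> by (intro mult_right_mono) (auto simp: W_nonneg)
      then show ?thesis
        using zero_le_power2[of "W 2 \<rho> \<nu>"] unfolding power2_eq_square[of "W 2 \<mu>' \<nu>"] by linarith
    next
      case False
      then have "(W 2 \<mu>' \<nu> - \<epsilon>)\<^sup>2 \<le> (W 2 \<rho> \<nu>)\<^sup>2"
        using near[OF \<nu>(1)] by (intro power_mono) auto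
      then have "\<epsilon>\<^sup>2 + (W 2 \<mu>' \<nu>)\<^sup>2 \<le> (W 2 \<rho> \<nu>)\<^sup>2 + 2 * \<epsilon> * W 2 \<mu>' \<nu>"
        by (simp add: power2_diff algebra_simps)
      then show ?thesis
        using zero_le_power2[of \<epsilon>] by linarith
    qed
    then show "2 * \<tau> * (a - g\<^sub>0) \<le> (W 2 \<mu> \<nu>)\<^sup>2 - (W 2 \<mu>' \<nu>)\<^sup>2 + 2 * \<epsilon> * W 2 \<mu>' \<nu> + \<epsilon>\<^sup>2"
      using le var[OF \<nu>, unfolded W2_commute[OF \<nu>(1) \<mu>]] zero_le_power2[of "W 2 \<mu>' \<mu>"]
      unfolding right_diff_distrib by linarith
  qed
qed

end


section \<open>The inexact proximal iteration\<close>

locale inexact_proximal = proximal_functional G g\<^sub>0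
  for G :: "'a::euclidean_space measure \<Rightarrow> ereal" and g\<^sub>0 :: real +
  fixes \<epsilon> \<tau> \<sigma> :: "nat \<Rightarrow> real" and \<mu> :: "nat \<Rightarrow> 'a measure"
  assumes \<epsilon>_nonneg: "\<And>n. \<epsilon> n \<ge> 0"
    and \<epsilon>_summable: "summable \<epsilon>"
    and \<tau>_pos: "\<And>n. \<tau> n > 0"
    and \<tau>_diverges: "filterlim (\<lambda>n. \<Sum>i<n. \<tau> i) at_top sequentially"
    and \<sigma>_eq: "\<And>n. \<sigma> n = (\<Sum>i<n. \<tau> i)"
    and \<mu>_P2: "\<And>n. \<mu> n \<in> P2"
    and \<mu>_step: "\<And>n. G (\<mu> (Suc n)) + ereal ((W 2 (\<mu> (Suc n)) (\<mu> n))\<^sup>2 / (2 * \<tau> n))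
        \<le> G (J G (\<tau> n) (\<mu> n)) + ereal ((W 2 (J G (\<tau> n) (\<mu> n)) (\<mu> n))\<^sup>2 / (2 * \<tau> n))
          + ereal ((\<epsilon> n)\<^sup>2 / (2 * \<tau> n))"
begin

text \<open>\<open>G (\<mu> 0)\<close> may be infinite, and \<open>g 0\<close> is then the default
  value 0. Statements about values therefore start at \<open>Suc n\<close>, or carry the factor
  \<open>\<sigma> 0 = 0\<close>.\<close>

definition g :: "nat \<Rightarrow> real" where
  "g n = real_of_ereal (G (\<mu> n))"

lemma G_Suc: "G (\<mu> (Suc n)) = ereal (g (Suc n))" "g\<^sub>0 \<le> g (Suc n)"
proof -
  obtain a where "G (\<mu> (Suc n)) = ereal a" "g\<^sub>0 \<le> a"
    by (rule inexact_step[OF \<tau>_pos \<epsilon>_nonneg \<mu>_P2 \<mu>_P2 \<mu>_step[of n]]) (rule that)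
  then show "G (\<mu> (Suc n)) = ereal (g (Suc n))" "g\<^sub>0 \<le> g (Suc n)"
    by (simp_all add: g_def)
qed

lemma g_step: "g (Suc (Suc n)) \<le> g (Suc n) + (\<epsilon> (Suc n))\<^sup>2 / (2 * \<tau> (Suc n))"
proof -
  obtain a where "G (\<mu> (Suc (Suc n))) = ereal a"
    "\<And>b. G (\<mu> (Suc n)) = ereal b \<Longrightarrow> a \<le> b + (\<epsilon> (Suc n))\<^sup>2 / (2 * \<tau> (Suc n))"
    by (rule inexact_step[OF \<tau>_pos \<epsilon>_nonneg \<mu>_P2 \<mu>_P2 \<mu>_step[of "Suc n"]]) (rule that)
  then show ?thesis
    using G_Suc by simp
qed

lemma minimizer_step:
  assumes \<nu>: "\<nu> \<in> P2" "G \<nu> = ereal g\<^sub>0"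
  shows "W 2 (\<mu> (Suc n)) \<nu> \<le> W 2 (\<mu> n) \<nu> + \<epsilon> n"
    "2 * \<tau> n * (g (Suc n) - g\<^sub>0)
      \<le> (W 2 (\<mu> n) \<nu>)\<^sup>2 - (W 2 (\<mu> (Suc n)) \<nu>)\<^sup>2 + 2 * \<epsilon> n * W 2 (\<mu> (Suc n)) \<nu> + (\<epsilon> n)\<^sup>2"
proof -
  obtain a where "G (\<mu> (Suc n)) = ereal a"
    "W 2 (\<mu> (Suc n)) \<nu> \<le> W 2 (\<mu> n) \<nu> + \<epsilon> n"
    "2 * \<tau> n * (a - g\<^sub>0)
      \<le> (W 2 (\<mu> n) \<nu>)\<^sup>2 - (W 2 (\<mu> (Suc n)) \<nu>)\<^sup>2 + 2 * \<epsilon> n * W 2 (\<mu> (Suc n)) \<nu> + (\<epsilon> n)\<^sup>2"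
    by (rule inexact_step[OF \<tau>_pos \<epsilon>_nonneg \<mu>_P2 \<mu>_P2 \<mu>_step[of n]]) (rule that, use \<nu> in auto)
  then show "W 2 (\<mu> (Suc n)) \<nu> \<le> W 2 (\<mu> n) \<nu> + \<epsilon> n"
    "2 * \<tau> n * (g (Suc n) - g\<^sub>0)
      \<le> (W 2 (\<mu> n) \<nu>)\<^sup>2 - (W 2 (\<mu> (Suc n)) \<nu>)\<^sup>2 + 2 * \<epsilon> n * W 2 (\<mu> (Suc n)) \<nu> + (\<epsilon> n)\<^sup>2"
    by (simp_all add: g_def)
qed

lemma sum_\<epsilon>_le: "(\<Sum>i<n. \<epsilon> i) \<le> suminf \<epsilon>"
  using \<epsilon>_nonneg by (intro sum_le_suminf \<epsilon>_summable) auto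

text \<open>Quasi-Fejer monotonicity: subtracting the accumulated errors makes the distances decreasing.\<close>

lemma W2_minimizer_convergent:
  assumes \<nu>: "\<nu> \<in> P2" "G \<nu> = ereal g\<^sub>0"
  shows "convergent (\<lambda>n. W 2 (\<mu> n) \<nu>)"
proof -
  define b where "b n = W 2 (\<mu> n) \<nu> - (\<Sum>i<n. \<epsilon> i)" for n
  have "b (Suc n) \<le> b n" for n
    using minimizer_step(1)[OF \<nu>, of n] by (simp add: b_def)
  then have "decseq b"
    by (rule decseq_SucI)
  moreover have "- suminf \<epsilon> \<le> b n" for n
    using sum_\<epsilon>_le[of n] W_nonneg[of 2 "\<mu> n" \<nu>] by (simp add: b_def)
  ultimately obtain l where "b \<longlonglongrightarrow> l"
    using decseq_convergent by blast
  then have "(\<lambda>n. b n + (\<Sum>i<n. \<epsilon> i)) \<longlonglongrightarrow> l + suminf \<epsilon>"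
    using \<epsilon>_summable by (intro tendsto_add summable_LIMSEQ)
  then show ?thesis
    by (auto simp: b_def convergent_def)
qed

lemma W2_minimizer_bounded:
  assumes \<nu>: "\<nu> \<in> P2" "G \<nu> = ereal g\<^sub>0"
  obtains B where "0 \<le> B" "\<And>n. W 2 (\<mu> n) \<nu> \<le> B"
proof -
  obtain B where "0 < B" and B: "\<forall>n. norm (W 2 (\<mu> n) \<nu>) \<le> B"
    using convergent_imp_Bseq[OF W2_minimizer_convergent[OF \<nu>]] by (rule BseqE)
  have "W 2 (\<mu> n) \<nu> \<le> B" for n
    using B[rule_format, of n] by simp
  with \<open>0 < B\<close> show thesis
    by (intro that[of B]) auto
qed

text \<open>Summing the second estimate of \<open>minimizer_step\<close> telescopes the squared
  distances. With distances at most \<open>B\<close> and every error at most the total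
  \<open>S\<close>, the error terms of one step are at most
  \<open>(2 * B + S) * \<epsilon> n\<close>, which is summable.\<close>

lemma gap_sum_bounded:
  obtains C where "0 \<le> C" "\<And>n. (\<Sum>i<n. \<tau> i * (g (Suc i) - g\<^sub>0)) \<le> C"
proof -
  obtain \<nu> where \<nu>: "\<nu> \<in> P2" "G \<nu> = ereal g\<^sub>0"
    using attained by blast
  obtain B where B: "0 \<le> B" "\<And>n. W 2 (\<mu> n) \<nu> \<le> B"
    using W2_minimizer_bounded[OF \<nu>] by blast
  define S where "S = suminf \<epsilon>"
  have S: "(\<Sum>i<n. \<epsilon> i) \<le> S" for n
    unfolding S_def by (rule sum_\<epsilon>_le)
  have \<epsilon>_le: "\<epsilon> i \<le> S" for i
    using S[of "Suc i"] sum_nonneg[of "{..<i}" \<epsilon>] \<epsilon>_nonneg by simp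
  have "2 * (\<Sum>i<n. \<tau> i * (g (Suc i) - g\<^sub>0)) \<le> B\<^sup>2 - (W 2 (\<mu> n) \<nu>)\<^sup>2 + (2 * B + S) * (\<Sum>i<n. \<epsilon> i)" for n
  proof (induction n)
    case 0
    then show ?case
      using B(2)[of 0] W_nonneg[of 2 "\<mu> 0" \<nu>] by (simp add: power_mono)
  next
    case (Suc n)
    have "2 * \<epsilon> n * W 2 (\<mu> (Suc n)) \<nu> \<le> 2 * \<epsilon> n * B"
      using B(2) \<epsilon>_nonneg by (intro mult_left_mono) auto
    moreover have "(\<epsilon> n)\<^sup>2 \<le> S * \<epsilon> n"
      unfolding power2_eq_square using \<epsilon>_le \<epsilon>_nonneg by (intro mult_right_mono)
    ultimately have "2 * \<tau> n * (g (Suc n) - g\<^sub>0)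
        \<le> (W 2 (\<mu> n) \<nu>)\<^sup>2 - (W 2 (\<mu> (Suc n)) \<nu>)\<^sup>2 + (2 * B + S) * \<epsilon> n"
      using minimizer_step(2)[OF \<nu>, of n] by (simp add: algebra_simps)
    then show ?case
      using Suc.IH by (simp add: algebra_simps)
  qed
  moreover have "(2 * B + S) * (\<Sum>i<n. \<epsilon> i) \<le> (2 * B + S) * S" for n
    using B(1) S \<epsilon>_le[of 0] \<epsilon>_nonneg[of 0] by (intro mult_left_mono) auto
  ultimately have "2 * (\<Sum>i<n. \<tau> i * (g (Suc i) - g\<^sub>0)) \<le> B\<^sup>2 - (W 2 (\<mu> n) \<nu>)\<^sup>2 + (2 * B + S) * S" for n
    by (meson add_left_mono order_trans)
  then have bound: "2 * (\<Sum>i<n. \<tau> i * (g (Suc i) - g\<^sub>0)) \<le> B\<^sup>2 + (2 * B + S) * S" for n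
    by (rule order_trans) simp
  show thesis
    by (rule that[of "(B\<^sup>2 + (2 * B + S) * S) / 2"]) (use bound[of 0] bound in \<open>simp_all add: field_simps\<close>)
qed

section \<open>Convergence rates of the values\<close>

lemma INF_G: "(INF \<nu>\<in>P2. G \<nu>) = ereal g\<^sub>0"
proof (rule antisym)
  show "(INF \<nu>\<in>P2. G \<nu>) \<le> ereal g\<^sub>0"
    using attained by (metis INF_lower)
  show "ereal g\<^sub>0 \<le> (INF \<nu>\<in>P2. G \<nu>)"
    by (intro INF_greatest lower)
qed

lemma \<sigma>_pos: "0 < n \<Longrightarrow> 0 < \<sigma> n"
  unfolding \<sigma>_eq using \<tau>_pos by (intro sum_pos) auto

lemma bigO_if_bounded_gap:
  assumes "\<And>n. 0 < n \<Longrightarrow> G (\<kappa> n) = ereal (v n) \<and> g\<^sub>0 \<le> v n \<and> \<sigma> n * (v n - g\<^sub>0) \<le> C" and "0 \<le> C"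
  shows "bigO_ereal (\<lambda>n. G (\<kappa> n) - (INF \<nu>\<in>P2. G \<nu>)) (\<lambda>n. 1 / \<sigma> n)"
  unfolding bigO_ereal_def INF_G
proof (intro exI conjI)
  \<comment> \<open>\<open>bigO_ereal\<close> asks for a positive constant, and \<open>C\<close> may
    be 0.\<close>
  show "0 < C + 1"
    using \<open>0 \<le> C\<close> by simp
  show "\<forall>\<^sub>F n in sequentially. \<bar>G (\<kappa> n) - ereal g\<^sub>0\<bar> \<le> ereal ((C + 1) * \<bar>1 / \<sigma> n\<bar>)"
    using eventually_gt_at_top[of 0]
  proof eventually_elim
    case (elim n)
    note v = assms(1)[OF elim] and \<sigma> = \<sigma>_pos[OF elim]
    have "v n - g\<^sub>0 \<le> (C + 1) / \<sigma> n"
      using v \<sigma> by (simp add: pos_le_divide_eq mult.commute)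
    then show ?case
      using v \<sigma> by simp
  qed
qed

text \<open>The best value is at most each \<open>g (Suc i)\<close> with \<open>i < n\<close>,
  because \<open>best_index\<close> compares the indices up to and including \<open>n\<close>; hence
  its gap is at most their average with weights \<open>\<tau> i\<close>, whose total is
  \<open>\<sigma> n\<close>.\<close>

lemma best_iterate_rate:
  assumes j: "best_index (\<lambda>i. G (\<mu> i)) j"
  shows "bigO_ereal (\<lambda>n. G (\<mu> (j n)) - (INF \<nu>\<in>P2. G \<nu>)) (\<lambda>n. 1 / \<sigma> n)"
proof -
  obtain C where C: "0 \<le> C" "\<And>n. (\<Sum>i<n. \<tau> i * (g (Suc i) - g\<^sub>0)) \<le> C"
    using gap_sum_bounded by blast
  have le: "G (\<mu> (j n)) \<le> ereal (g (Suc i))" if "i < n" for i n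
  proof -
    have "\<not> G (\<mu> (Suc i)) < G (\<mu> (j n))"
      using j that unfolding best_index_def is_arg_min_def by auto
    then show ?thesis
      by (simp add: G_Suc(1) not_less)
  qed
  show ?thesis
  proof (rule bigO_if_bounded_gap[OF _ C(1)])
    fix n :: nat assume "0 < n"
    \<comment> \<open>For \<open>0 < n\<close> the iterate of index 1 takes part in the comparison,
      and its value is finite even when \<open>G (\<mu> 0)\<close> is not.\<close>
    then obtain v where v: "G (\<mu> (j n)) = ereal v" "g\<^sub>0 \<le> v"
      using finite_if_bounded[OF \<mu>_P2 le[of 0 n]] by blast
    have v_le: "v \<le> g (Suc i)" if "i < n" for i
      using le[OF that] v(1) by simp
    have "\<sigma> n * (v - g\<^sub>0) = (\<Sum>i<n. \<tau> i * (v - g\<^sub>0))"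
      by (simp add: \<sigma>_eq sum_distrib_right)
    also have "\<dots> \<le> (\<Sum>i<n. \<tau> i * (g (Suc i) - g\<^sub>0))"
      using v_le less_imp_le[OF \<tau>_pos] by (intro sum_mono mult_left_mono) auto
    also have "\<dots> \<le> C"
      by (rule C(2))
    finally show "G (\<mu> (j n)) = ereal (g (j n)) \<and> g\<^sub>0 \<le> g (j n) \<and> \<sigma> n * (g (j n) - g\<^sub>0) \<le> C"
      using v by (simp add: g_def)
  qed
qed

text \<open>Passing from \<open>n\<close> to \<open>Suc n\<close> adds the weight
  \<open>\<tau> n\<close> to the new gap, which \<open>gap_sum_bounded\<close> controls, and the
  possible increase of \<open>g\<close> enters with factor \<open>\<sigma> n\<close>; this produces
  the series assumed summable.\<close>

lemma weighted_gap_bounded: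
  assumes sm: "summable (\<lambda>n. \<sigma> n / \<tau> n * (\<epsilon> n)\<^sup>2)"
  obtains C where "0 \<le> C" "\<And>n. \<sigma> n * (g n - g\<^sub>0) \<le> C"
proof -
  obtain C where C: "0 \<le> C" "\<And>n. (\<Sum>i<n. \<tau> i * (g (Suc i) - g\<^sub>0)) \<le> C"
    using gap_sum_bounded by blast
  let ?d = "\<lambda>n. \<sigma> n / \<tau> n * (\<epsilon> n)\<^sup>2"
  have \<sigma>_nonneg: "0 \<le> \<sigma> n" for n
    unfolding \<sigma>_eq using less_imp_le[OF \<tau>_pos] by (intro sum_nonneg) auto
  have nonneg: "0 \<le> ?d n" for n
    using \<sigma>_nonneg[of n] \<tau>_pos[of n] by simp
  have "\<sigma> n * (g n - g\<^sub>0) \<le> (\<Sum>i<n. ?d i) + (\<Sum>i<n. \<tau> i * (g (Suc i) - g\<^sub>0))" for n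
  proof (induction n)
    case 0
    then show ?case
      by (simp add: \<sigma>_eq)
  next
    case (Suc n)
    have "\<sigma> n * (g (Suc n) - g\<^sub>0) \<le> \<sigma> n * (g n - g\<^sub>0) + ?d n"
    proof (cases n)
      case 0
      then show ?thesis
        by (simp add: \<sigma>_eq)
    next
      case (Suc m)
      have "(\<epsilon> n)\<^sup>2 / (2 * \<tau> n) \<le> (\<epsilon> n)\<^sup>2 / \<tau> n"
        using \<tau>_pos[of n] by (intro divide_left_mono) auto
      then have "g (Suc n) - g\<^sub>0 \<le> g n - g\<^sub>0 + (\<epsilon> n)\<^sup>2 / \<tau> n"
        using g_step[of m] by (simp add: Suc)
      from mult_left_mono[OF this \<sigma>_nonneg[of n]] show ?thesis
        by (simp add: distrib_left)
    qed
    moreover have "\<sigma> (Suc n) * (g (Suc n) - g\<^sub>0) = \<sigma> n * (g (Suc n) - g\<^sub>0) + \<tau> n * (g (Suc n) - g\<^sub>0)"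
      by (simp add: \<sigma>_eq distrib_right)
    ultimately show ?case
      using Suc.IH by simp
  qed
  moreover have "(\<Sum>i<n. ?d i) \<le> suminf ?d" for n
    using nonneg by (intro sum_le_suminf sm) auto
  ultimately have "\<sigma> n * (g n - g\<^sub>0) \<le> suminf ?d + C" for n
    using C(2)[of n] by (meson add_mono order_trans)
  moreover have "0 \<le> suminf ?d + C"
    using C(1) suminf_nonneg[OF sm nonneg] by simp
  ultimately show thesis
    using that by blast
qed

lemma last_iterate_rate:
  assumes "summable (\<lambda>n. \<sigma> n / \<tau> n * (\<epsilon> n)\<^sup>2)"
  shows "bigO_ereal (\<lambda>n. G (\<mu> n) - (INF \<nu>\<in>P2. G \<nu>)) (\<lambda>n. 1 / \<sigma> n)" "g \<longlonglongrightarrow> g\<^sub>0"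
proof -
  obtain C where C: "0 \<le> C" "\<And>n. \<sigma> n * (g n - g\<^sub>0) \<le> C"
    using weighted_gap_bounded[OF assms] by blast
  have pos: "G (\<mu> n) = ereal (g n) \<and> g\<^sub>0 \<le> g n" if "0 < n" for n
    using that G_Suc by (cases n) auto
  then show "bigO_ereal (\<lambda>n. G (\<mu> n) - (INF \<nu>\<in>P2. G \<nu>)) (\<lambda>n. 1 / \<sigma> n)"
    using C(2) by (intro bigO_if_bounded_gap[OF _ C(1), of \<mu> g]) auto
  \<comment> \<open>Divergence of the sum of the step sizes turns the bound on the weighted gap into
    convergence of the values.\<close>
  have "\<sigma> = (\<lambda>n. \<Sum>i<n. \<tau> i)"
    by (rule ext) (rule \<sigma>_eq)
  then have "filterlim \<sigma> at_top sequentially"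
    using \<tau>_diverges by simp
  then have "(\<lambda>n. C / \<sigma> n) \<longlonglongrightarrow> 0"
    by (intro tendsto_divide_0[OF tendsto_const] filterlim_at_top_imp_at_infinity)
  moreover have "\<forall>\<^sub>F n in sequentially. norm (g n - g\<^sub>0) \<le> C / \<sigma> n"
    using eventually_gt_at_top[of 0]
    by eventually_elim (use pos C(2) \<sigma>_pos in \<open>simp add: pos_le_divide_eq mult.commute\<close>)
  ultimately have "(\<lambda>n. g n - g\<^sub>0) \<longlonglongrightarrow> 0"
    by (rule Lim_null_comparison[rotated])
  then show "g \<longlonglongrightarrow> g\<^sub>0"
    by (simp add: LIM_zero_iff)
qed

text \<open>Along with weak convergence this records what the Skorokhod representation yields for
  the subsequence, so that the arguments below deal with distances alone and no longer with random
  variables.\<close>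

definition cluster :: "(nat \<Rightarrow> nat) \<Rightarrow> 'a measure \<Rightarrow> bool" where
  "cluster q \<rho> \<longleftrightarrow> strict_mono q \<and> \<rho> \<in> P2 \<and>
     (\<forall>f\<in>C2w. (\<lambda>n. \<integral>x. f x \<partial>\<mu> (q n)) \<longlonglongrightarrow> (\<integral>x. f x \<partial>\<rho>)) \<and>
     (\<forall>p\<in>{1..<2}. (\<lambda>n. W p (\<mu> (q n)) \<rho>) \<longlonglongrightarrow> 0) \<and>
     (\<forall>\<nu>\<in>P2. \<forall>e>0. \<forall>\<^sub>F n in sequentially.
        (W 2 \<nu> \<rho>)\<^sup>2 + (W 2 \<rho> (\<mu> (q n)))\<^sup>2 \<le> (W 2 \<nu> (\<mu> (q n)))\<^sup>2 + e)"

text \<open>Distances to a minimizer are bounded, hence so are the second moments. Starting from an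
  arbitrary subsequence prepares the passage from cluster points to the full sequence.\<close>

lemma cluster_exists:
  assumes s: "strict_mono s"
  obtains r \<rho> where "strict_mono (r :: nat \<Rightarrow> nat)" "cluster (s \<circ> r) \<rho>"
proof -
  obtain \<nu> where \<nu>: "\<nu> \<in> P2" "G \<nu> = ereal g\<^sub>0"
    using attained by blast
  obtain B where B: "0 \<le> B" "\<And>n. W 2 (\<mu> n) \<nu> \<le> B"
    using W2_minimizer_bounded[OF \<nu>] by blast
  have moment: "(\<integral>x. (norm x)\<^sup>2 \<partial>\<mu> (s n)) \<le> 2 * (\<integral>x. (norm x)\<^sup>2 \<partial>\<nu>) + 2 * B\<^sup>2" for n
    using second_moment_le[OF \<mu>_P2 \<nu>(1), of "s n"] power_mono[OF B(2) W_nonneg, of "s n" 2] by simp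
  show thesis
  proof (rule bounded_P2_subsequence[where \<mu> = "\<lambda>n. \<mu> (s n)", OF \<mu>_P2 moment])
    fix r \<rho>
    assume r: "strict_mono (r :: nat \<Rightarrow> nat)" and \<rho>: "\<rho> \<in> P2"
      "\<And>f. f \<in> C2w \<Longrightarrow> (\<lambda>n. \<integral>x. f x \<partial>\<mu> (s (r n))) \<longlonglongrightarrow> (\<integral>x. f x \<partial>\<rho>)"
      "\<And>p. p \<in> {1..<2} \<Longrightarrow> (\<lambda>n. W p (\<mu> (s (r n))) \<rho>) \<longlonglongrightarrow> 0"
      "\<And>\<nu> e. \<nu> \<in> P2 \<Longrightarrow> 0 < e \<Longrightarrow> \<forall>\<^sub>F n in sequentially.
        (W 2 \<nu> \<rho>)\<^sup>2 + (W 2 \<rho> (\<mu> (s (r n))))\<^sup>2 \<le> (W 2 \<nu> (\<mu> (s (r n))))\<^sup>2 + e"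
    have "cluster (s \<circ> r) \<rho>"
      unfolding cluster_def using \<rho> strict_mono_o[OF s r] by simp
    with r show thesis
      by (rule that)
  qed
qed

text \<open>
  The proximal point of the limit is no farther from the iterates than the limit itself, up to the
  vanishing gap, which by the Opial property forces it to coincide with the limit.
\<close>

lemma cluster_minimizer:
  assumes gap: "g \<longlonglongrightarrow> g\<^sub>0" and cl: "cluster q \<rho>"
  shows "G \<rho> = ereal g\<^sub>0"
proof -
  have q: "strict_mono q" and \<rho>: "\<rho> \<in> P2"
    and opial: "\<And>\<nu> e. \<nu> \<in> P2 \<Longrightarrow> 0 < e \<Longrightarrow> \<forall>\<^sub>F n in sequentially.
        (W 2 \<nu> \<rho>)\<^sup>2 + (W 2 \<rho> (\<mu> (q n)))\<^sup>2 \<le> (W 2 \<nu> (\<mu> (q n)))\<^sup>2 + e"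
    using cl by (auto simp: cluster_def)
  define \<kappa> where "\<kappa> = J G 1 \<rho>"
  obtain h where \<kappa>: "\<kappa> \<in> P2" and h: "G \<kappa> = ereal h" "g\<^sub>0 \<le> h"
    and var: "\<And>\<nu> b. \<nu> \<in> P2 \<Longrightarrow> G \<nu> = ereal b \<Longrightarrow>
      2 * 1 * h + (W 2 \<kappa> \<rho>)\<^sup>2 + (W 2 \<kappa> \<nu>)\<^sup>2 \<le> 2 * 1 * b + (W 2 \<nu> \<rho>)\<^sup>2"
    by (rule J_variational[OF zero_less_one \<rho>, folded \<kappa>_def]) (rule that)
  have gap_q: "(\<lambda>n. 2 * g (q n)) \<longlonglongrightarrow> 2 * g\<^sub>0"
    using LIMSEQ_subseq_LIMSEQ[OF gap q] by (intro tendsto_intros) (simp add: comp_def)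
  \<comment> \<open>Adding the inequality for \<open>\<kappa>\<close>, tested with
    \<open>\<mu> (q n)\<close>, to the Opial inequality for \<open>\<kappa>\<close> cancels the
    distances from \<open>\<rho>\<close> and \<open>\<kappa>\<close> to the iterate, whose limits
    are unknown.\<close>
  have le: "2 * h + 2 * (W 2 \<kappa> \<rho>)\<^sup>2 \<le> 2 * g\<^sub>0 + e" if "0 < e" for e
  proof (rule tendsto_le[OF sequentially_bot tendsto_add[OF gap_q tendsto_const] tendsto_const])
    show "\<forall>\<^sub>F n in sequentially. 2 * h + 2 * (W 2 \<kappa> \<rho>)\<^sup>2 \<le> 2 * g (q n) + e"
      using opial[OF \<kappa> that] eventually_gt_at_top[of 0]
    proof eventually_elim
      case (elim n)
      then have "0 < q n"
        using seq_suble[OF q, of n] by simp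
      then obtain m where "q n = Suc m"
        by (cases "q n") auto
      then show ?case
        using elim var[OF \<mu>_P2 G_Suc(1)[of m]] W2_commute[OF \<rho> \<mu>_P2[of "q n"]] by simp
    qed
  qed
  have "2 * h + 2 * (W 2 \<kappa> \<rho>)\<^sup>2 \<le> 2 * g\<^sub>0"
    by (rule field_le_epsilon) (rule le)
  then have W0: "(W 2 \<kappa> \<rho>)\<^sup>2 = 0" and "h = g\<^sub>0"
    using h(2) zero_le_power2[of "W 2 \<kappa> \<rho>"] by linarith+
  moreover have "\<kappa> = \<rho>"
    using W2_eq_0_imp_eq[OF \<kappa> \<rho>] W0 by simp
  ultimately show ?thesis
    using h(1) by simp
qed

text \<open>Both cluster points are minimizers, so the distances to each converge along the full
  sequence, to the same limits along either subsequence. The two Opial inequalities with exchanged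
  roles then add up to \<open>(W 2 \<rho> \<rho>')\<^sup>2 \<le> 0\<close>.\<close>

lemma cluster_unique:
  assumes gap: "g \<longlonglongrightarrow> g\<^sub>0" and cl: "cluster q \<rho>" "cluster q' \<rho>'"
  shows "\<rho> = \<rho>'"
proof -
  define l where "l \<nu> = lim (\<lambda>n. W 2 (\<mu> n) \<nu>)" for \<nu>
  have l: "(\<lambda>n. W 2 (\<mu> n) \<nu>) \<longlonglongrightarrow> l \<nu>" if "cluster s \<nu>" for s \<nu>
    using W2_minimizer_convergent[of \<nu>] cluster_minimizer[OF gap that] that
    by (simp add: l_def convergent_LIMSEQ_iff cluster_def)
  have le: "(W 2 \<kappa> \<nu>)\<^sup>2 + (l \<nu>)\<^sup>2 \<le> (l \<kappa>)\<^sup>2" if cs: "cluster s \<nu>" and ct: "cluster t \<kappa>" for s t \<nu> \<kappa>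
  proof (rule field_le_epsilon)
    fix e :: real assume "0 < e"
    have s: "strict_mono s" and P2: "\<nu> \<in> P2" "\<kappa> \<in> P2"
      using cs ct by (auto simp: cluster_def)
    have lim: "(\<lambda>n. W 2 (\<mu> (s n)) \<nu>) \<longlonglongrightarrow> l \<nu>" "(\<lambda>n. W 2 (\<mu> (s n)) \<kappa>) \<longlonglongrightarrow> l \<kappa>"
      using LIMSEQ_subseq_LIMSEQ[OF l[OF cs] s] LIMSEQ_subseq_LIMSEQ[OF l[OF ct] s] by (simp_all add: comp_def)
    show "(W 2 \<kappa> \<nu>)\<^sup>2 + (l \<nu>)\<^sup>2 \<le> (l \<kappa>)\<^sup>2 + e"
    proof (rule tendsto_le[OF sequentially_bot])
      show "(\<lambda>n. (W 2 (\<mu> (s n)) \<kappa>)\<^sup>2 + e) \<longlonglongrightarrow> (l \<kappa>)\<^sup>2 + e"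
        "(\<lambda>n. (W 2 \<kappa> \<nu>)\<^sup>2 + (W 2 (\<mu> (s n)) \<nu>)\<^sup>2) \<longlonglongrightarrow> (W 2 \<kappa> \<nu>)\<^sup>2 + (l \<nu>)\<^sup>2"
        by (intro tendsto_intros lim)+
      show "\<forall>\<^sub>F n in sequentially. (W 2 \<kappa> \<nu>)\<^sup>2 + (W 2 (\<mu> (s n)) \<nu>)\<^sup>2 \<le> (W 2 (\<mu> (s n)) \<kappa>)\<^sup>2 + e"
        using cs \<open>0 < e\<close> P2 unfolding cluster_def by (simp add: W2_commute[OF \<mu>_P2])
    qed
  qed
  have P2: "\<rho> \<in> P2" "\<rho>' \<in> P2"
    using cl by (auto simp: cluster_def)
  have "(W 2 \<rho> \<rho>')\<^sup>2 = 0"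
    using le[OF cl] le[OF cl(2,1)] zero_le_power2[of "W 2 \<rho> \<rho>'"]
    unfolding W2_commute[OF P2(2,1)] by linarith
  then show ?thesis
    by (intro W2_eq_0_imp_eq P2) simp
qed

text \<open>Every subsequence has a further one clustering at \<open>\<rho>\<close>. Stating this
  for real sequences covers the integrals of \<open>C2w\<close> functions and the distances
  \<open>W p\<close> at once.\<close>

lemma tendsto_if_cluster_tendsto:
  fixes a :: "nat \<Rightarrow> real"
  assumes gap: "g \<longlonglongrightarrow> g\<^sub>0" and cl: "cluster q \<rho>"
    and sub: "\<And>s. cluster s \<rho> \<Longrightarrow> (\<lambda>n. a (s n)) \<longlonglongrightarrow> b"
  shows "a \<longlonglongrightarrow> b"
proof (rule ccontr)
  assume "\<not> ?thesis"
  then obtain e where e: "0 < e" "\<not> (\<forall>\<^sub>F n in sequentially. dist (a n) b < e)"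
    unfolding tendsto_iff by blast
  from not_eventually_sequentiallyD[OF e(2)] obtain s :: "nat \<Rightarrow> nat"
    where s: "strict_mono s" "\<And>n. \<not> dist (a (s n)) b < e"
    by blast
  obtain r \<rho>' where "cluster (s \<circ> r) \<rho>'"
    using cluster_exists[OF s(1)] by blast
  moreover from this have "\<rho>' = \<rho>"
    using cluster_unique[OF gap _ cl] by blast
  ultimately have "cluster (s \<circ> r) \<rho>"
    by simp
  from tendstoD[OF sub[OF this] e(1)] have "\<forall>\<^sub>F n in sequentially. dist (a (s (r n))) b < e"
    by simp
  then show False
    using s(2) by simp
qed

lemma weak_convergence:
  assumes gap: "g \<longlonglongrightarrow> g\<^sub>0"
  shows "\<exists>\<rho>. is_arg_min G (\<lambda>\<nu>. \<nu> \<in> P2) \<rho> \<and> limitin tau_w2 \<mu> \<rho> sequentially \<and>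
    (\<forall>p\<in>{1..<2}. (\<lambda>n. W p (\<mu> n) \<rho>) \<longlonglongrightarrow> 0)"
proof -
  have "strict_mono (id :: nat \<Rightarrow> nat)"
    by (simp add: strict_mono_def)
  then obtain r \<rho> where cl: "cluster (id \<circ> r) \<rho>"
    by (rule cluster_exists)
  then have \<rho>: "\<rho> \<in> P2"
    by (simp add: cluster_def)
  have "is_arg_min G (\<lambda>\<nu>. \<nu> \<in> P2) \<rho>"
    using \<rho> lower cluster_minimizer[OF gap cl] by (auto simp: is_arg_min_def not_less)
  moreover have "limitin tau_w2 \<mu> \<rho> sequentially"
    unfolding limitin_tau_w2_iff[of \<mu>, OF \<mu>_P2]
  proof (intro conjI ballI \<rho>)
    fix f :: "'a \<Rightarrow> real" assume f: "f \<in> C2w"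
    show "(\<lambda>n. \<integral>x. f x \<partial>\<mu> n) \<longlonglongrightarrow> (\<integral>x. f x \<partial>\<rho>)"
      by (rule tendsto_if_cluster_tendsto[OF gap cl]) (use f in \<open>simp add: cluster_def\<close>)
  qed
  moreover have "\<forall>p\<in>{1..<2}. (\<lambda>n. W p (\<mu> n) \<rho>) \<longlonglongrightarrow> 0"
  proof
    fix p :: real assume p: "p \<in> {1..<2}"
    show "(\<lambda>n. W p (\<mu> n) \<rho>) \<longlonglongrightarrow> 0"
      by (rule tendsto_if_cluster_tendsto[OF gap cl]) (use p in \<open>simp add: cluster_def\<close>)
  qed
  ultimately show ?thesis
    by blast
qed

end

theorem theorem3p8:
  fixes G :: "'a::euclidean_space measure \<Rightarrow> ereal"
    and \<epsilon> \<tau> \<sigma> :: "nat \<Rightarrow> real"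
    and \<mu> :: "nat \<Rightarrow> 'a measure"
  assumes G_proper: "proper_on_P2 G"
    and G_lsc: "lsc_W2 G"
    and G_convex: "convex_along_generalized_geodesics G"
    and G_argmin: "\<exists>\<nu>. is_arg_min G (\<lambda>\<nu>. \<nu> \<in> P2) \<nu>"
    and \<epsilon>_nonneg: "\<And>n. \<epsilon> n \<ge> 0"
    and \<epsilon>_summable: "summable \<epsilon>"
    and \<tau>_pos: "\<And>n. \<tau> n > 0"
    and \<tau>_diverges: "filterlim (\<lambda>n. \<Sum>i<n. \<tau> i) at_top sequentially"
    and \<sigma>_eq: "\<And>n. \<sigma> n = (\<Sum>i<n. \<tau> i)"
    and \<mu>_P2: "\<And>n. \<mu> n \<in> P2"
    and \<mu>_step: "\<And>n. G (\<mu> (Suc n)) + ereal ((W 2 (\<mu> (Suc n)) (\<mu> n))\<^sup>2 / (2 * \<tau> n))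
        \<le> G (J G (\<tau> n) (\<mu> n)) + ereal ((W 2 (J G (\<tau> n) (\<mu> n)) (\<mu> n))\<^sup>2 / (2 * \<tau> n))
          + ereal ((\<epsilon> n)\<^sup>2 / (2 * \<tau> n))"
  shows "(\<forall>j. best_index (\<lambda>i. G (\<mu> i)) j \<longrightarrow>
            bigO_ereal (\<lambda>n. G (\<mu> (j n)) - (INF \<nu>\<in>P2. G \<nu>)) (\<lambda>n. 1 / \<sigma> n)) \<and>
         (summable (\<lambda>n. \<sigma> n / \<tau> n * (\<epsilon> n)\<^sup>2) \<longrightarrow>
            bigO_ereal (\<lambda>n. G (\<mu> n) - (INF \<nu>\<in>P2. G \<nu>)) (\<lambda>n. 1 / \<sigma> n) \<and>
            (\<exists>\<mu>s. is_arg_min G (\<lambda>\<nu>. \<nu> \<in> P2) \<mu>s \<and>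
                  limitin tau_w2 \<mu> \<mu>s sequentially \<and>
                  (\<forall>p\<in>{1..<2}. (\<lambda>n. W p (\<mu> n) \<mu>s) \<longlonglongrightarrow> 0)))"
proof -
  obtain \<nu> where \<nu>: "\<nu> \<in> P2" and min: "\<And>\<kappa>. \<kappa> \<in> P2 \<Longrightarrow> G \<nu> \<le> G \<kappa>"
    using G_argmin by (auto simp: is_arg_min_def not_less)
  \<comment> \<open>A measure of finite value excludes the minimal value +infinity; properness
    excludes -infinity.\<close>
  obtain \<kappa> where "\<kappa> \<in> P2" "G \<kappa> < \<infinity>"
    using G_proper by (auto simp: proper_on_P2_def)
  then obtain g\<^sub>0 where g\<^sub>0: "G \<nu> = ereal g\<^sub>0"
    using min[of \<kappa>] G_proper \<nu> by (cases "G \<nu>") (auto simp: proper_on_P2_def)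
  interpret inexact_proximal G g\<^sub>0 \<epsilon> \<tau> \<sigma> \<mu>
  proof
    show "ereal g\<^sub>0 \<le> G \<kappa>" if "\<kappa> \<in> P2" for \<kappa>
      using min[OF that] g\<^sub>0 by simp
    show "\<exists>\<nu>\<in>P2. G \<nu> = ereal g\<^sub>0"
      using \<nu> g\<^sub>0 by blast
  qed (fact G_lsc G_convex \<epsilon>_nonneg \<epsilon>_summable \<tau>_pos \<tau>_diverges \<sigma>_eq \<mu>_P2 \<mu>_step)+
  show ?thesis
    using best_iterate_rate last_iterate_rate weak_convergence by blast
qed

end
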